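(* Let $L$ be the number of modes. There exist $2^{2L-1}$ pairs $(\Sigma,\Sigma')$ of $2L\times2L$ antisymmetric matrices, all of whose off-diagonal entries are $\pm1$, such that for every fermionic Gaussian operator $\mathcal G_{\mathcal M}$ on $L$ modes (with $T_{22}$ invertible) and all $\sigma^z$-basis configurations $\mathcal S,\mathcal S'$, $$\langle\mathcal S|\mathcal G_{\mathcal M}|\mathcal S'\rangle=\det[T_{22}]^{1/2}\,\operatorname{pf}\bigl[\mathcal K^z(\mathcal S,\mathcal S')\bigr],$$ where $\mathcal K^z(\mathcal S,\mathcal S')$ is the $2L\times2L$ antisymmetric matrix whose entries for $n>m$ are $$\mathcal K^z_{mn}(\mathcal S,\mathcal S')=\Bigl(\tfrac{1+\bar s_m}{2}\Bigr)\Bigl(\tfrac{1+\bar s_n}{2}\Bigr)\Sigma_{mn}\mathcal A_{mn}+\Bigl(\tfrac{1-\bar s_m}{2}\Bigr)\Bigl(\tfrac{1-\bar s_n}{2}\Bigr)\Sigma'_{mn}.$$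
   Context: Fermions: $c_1,\dots,c_L,c_1^\dagger,\dots,c_L^\dagger$ are the fermionic annihilation and creation operators on the $L$-mode Fock space with vacuum $|0\rangle$ ($\{c_i,c_j^\dagger\}=\delta_{ij}$, $\{c_i,c_j\}=0$, $c_i|0\rangle=0$). A fermionic Gaussian operator is $$\mathcal{G}_{\mathcal M}=\exp\Bigl[\tfrac12\begin{pmatrix}\mathbf c^\dagger & \mathbf c\end{pmatrix}\mathcal M\begin{pmatrix}\mathbf c\\ \mathbf c^\dagger\end{pmatrix}\Bigr],\qquad (\mathbf c^\dagger,\mathbf c)=(c_1^\dagger,\dots,c_L^\dagger,c_1,\dots,c_L),$$ where $\mathcal M$ is a complex $2L\times2L$ matrix with $\Xi\mathcal M+(\Xi\mathcal M)^T=0$, $\Xi=\begin{pmatrix}0&I\\ I&0\end{pmatrix}$. Write $e^{\mathcal M}=\begin{pmatrix}T_{11}&T_{12}\\ T_{21}&T_{22}\end{pmatrix}$ in $L\times L$ blocks, with $T_{22}$ invertible, and set $X=T_{12}T_{22}^{-1}$, $Z=T_{22}^{-1}T_{21}$, $e^{-Y}=T_{22}^T$ and $$\mathcal A=\begin{pmatrix}X&e^{Y}\\ -e^{Y^T}&Z\end{pmatrix},$$ a $2L\times 2L$ antisymmetric matrix. Here $\det[T_{22}]^{1/2}$ means $e^{-\frac12\operatorname{Tr}Y}$, where $Y$ is a matrix with $e^{-Y}=T_{22}^T$ for which $\mathcal G_{\mathcal M}=\exp[\tfrac12\mathbf c^\dagger X\mathbf c^\dagger]\exp[\mathbf c^\dagger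 Y\mathbf c-\tfrac12\operatorname{Tr}Y]\exp[\tfrac12\mathbf cZ\mathbf c]$ holds; only the sign of the square root, depending on $\mathcal M$ alone, is at issue. Spin basis: $\langle\mathcal S|=\langle s_L,\dots,s_2,s_1|$ and $|\mathcal S'\rangle=|s'_1,\dots,s'_L\rangle\equiv|s_{L+1},\dots,s_{2L}\rangle$ are $\sigma^z$-basis states, and $\bar s_j=+1$ for spin up, $\bar s_j=-1$ for spin down ($1\le j\le 2L$). Spins and fermions are related by the Jordan–Wigner transformation $c_l=\prod_{j<l}(-\sigma^z_j)\sigma_l^-$, so that spin up means occupied and spin down means empty. Explicitly, if $i_1<\dots<i_p$ are the up sites of $\mathcal S'$ and $j_1<\dots<j_q$ those of $\mathcal S$, then $|\mathcal S'\rangle=c^\dagger_{i_1}\cdots c^\dagger_{i_p}|0\rangle$ and $\langle\mathcal S|=\langle0|c_{j_q}\cdots c_{j_1}$. $\operatorname{pf}$ denotes the Pfaffian.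
   Formalization: For L = 1 one pair is claimed instead of 2^(2L-1) = 2, since the configurations (up,up) and (down,down) force both off-diagonal signs to be 1; L ≥ 1 is assumed. If no Y as described exists, det[T22]^{1/2} is some root depending on M alone. *)

theory Defs
  imports
    Complex_Main
    "Jordan_Normal_Form.Determinant"
    "Jordan_Normal_Form.Gauss_Jordan_Elimination"
begin

text \<open>Modes, sites and matrix indices are counted from 0, so that the modes are
  \<open>0, \<dots>, L - 1\<close> and the rows and columns of a \<open>2L \<times> 2L\<close> matrix are \<open>0, \<dots>, 2L - 1\<close>.\<close>

definition mat_exp :: "complex mat \<Rightarrow> complex mat" where
  "mat_exp A = mat (dim_row A) (dim_row A) (\<lambda>(i, j). \<Sum>k. (A ^\<^sub>m k) $$ (i, j) / fact k)"

definition mat_trace :: "complex mat \<Rightarrow> complex" where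
  "mat_trace A = (\<Sum>i<dim_row A. A $$ (i, i))"

text \<open>Only meaningful for matrices of even size.\<close>

definition pfaffian :: "complex mat \<Rightarrow> complex" where
  "pfaffian A = (let n = dim_row A div 2 in
     (\<Sum>p | p permutes {0..<2 * n}.
        of_int (sign p) * (\<Prod>i<n. A $$ (p (2 * i), p (2 * i + 1)))) / (2 ^ n * fact n))"

definition antisymmetric_mat :: "complex mat \<Rightarrow> bool" where
  "antisymmetric_mat A \<longleftrightarrow> transpose_mat A = - A"

definition sign_mat :: "nat \<Rightarrow> complex mat \<Rightarrow> bool" where
  "sign_mat n \<Sigma> \<longleftrightarrow> \<Sigma> \<in> carrier_mat n n \<and> antisymmetric_mat \<Sigma> \<and>
     (\<forall>i<n. \<forall>j<n. i \<noteq> j \<longrightarrow> \<Sigma> $$ (i, j) \<in> {1, -1})"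


text \<open>The Fock space on \<open>L\<close> modes is \<open>\<complex>\<close> to the power \<open>2 ^ L\<close>. The basis vector with index \<open>s\<close> has
  mode \<open>l\<close> occupied (spin \<open>l\<close> up) iff bit \<open>l\<close> of \<open>s\<close> is set. In this basis the string
  \<open>\<Prod>j<l. - \<sigma>\<^sup>z\<^sub>j\<close> is diagonal with a factor \<open>-1\<close> for each up spin at a site \<open>j < l\<close>, and
  the lowering operator at site \<open>l\<close> clears bit \<open>l\<close>; the matrix below is their product.\<close>

definition jw_sign :: "nat \<Rightarrow> nat \<Rightarrow> complex" where
  "jw_sign l s = (-1) ^ card {j. j < l \<and> bit s j}"

definition annihilate :: "nat \<Rightarrow> nat \<Rightarrow> complex mat" where
  "annihilate L l = mat (2 ^ L) (2 ^ L)
     (\<lambda>(r, s). if bit s l \<and> r = unset_bit l s then jw_sign l s else 0)"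

text \<open>The matrix of an annihilation operator is real, so its adjoint is its transpose.\<close>

definition create :: "nat \<Rightarrow> nat \<Rightarrow> complex mat" where
  "create L l = transpose_mat (annihilate L l)"

definition vacuum :: "nat \<Rightarrow> complex vec" where
  "vacuum L = unit_vec (2 ^ L) 0"

text \<open>The operator \<open>\<Sum>a<n. \<Sum>b<n. W\<^sub>a\<^sub>b u\<^sub>a v\<^sub>b\<close> on the Fock space.\<close>

definition bilinear_op ::
  "nat \<Rightarrow> nat \<Rightarrow> (nat \<Rightarrow> complex mat) \<Rightarrow> complex mat \<Rightarrow> (nat \<Rightarrow> complex mat) \<Rightarrow> complex mat" where
  "bilinear_op L n u W v = mat (2 ^ L) (2 ^ L)
     (\<lambda>(r, s). \<Sum>a<n. \<Sum>b<n. W $$ (a, b) * (u a * v b) $$ (r, s))"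

definition nambu :: "nat \<Rightarrow> nat \<Rightarrow> complex mat" where
  "nambu L a = (if a < L then annihilate L a else create L (a - L))"

definition nambu_adj :: "nat \<Rightarrow> nat \<Rightarrow> complex mat" where
  "nambu_adj L a = (if a < L then create L a else annihilate L (a - L))"

definition Xi :: "nat \<Rightarrow> complex mat" where
  "Xi L = four_block_mat (0\<^sub>m L L) (1\<^sub>m L) (1\<^sub>m L) (0\<^sub>m L L)"

definition gaussian_generator :: "nat \<Rightarrow> complex mat \<Rightarrow> bool" where
  "gaussian_generator L M \<longleftrightarrow> M \<in> carrier_mat (2 * L) (2 * L) \<and>
     Xi L * M + transpose_mat (Xi L * M) = 0\<^sub>m (2 * L) (2 * L)"

definition gaussian_op :: "nat \<Rightarrow> complex mat \<Rightarrow> complex mat" where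
  "gaussian_op L M = mat_exp ((1 / 2) \<cdot>\<^sub>m bilinear_op L (2 * L) (nambu_adj L) M (nambu L))"


definition T12 :: "nat \<Rightarrow> complex mat \<Rightarrow> complex mat" where
  "T12 L M = (case split_block (mat_exp M) L L of (A, B, C, D) \<Rightarrow> B)"

definition T21 :: "nat \<Rightarrow> complex mat \<Rightarrow> complex mat" where
  "T21 L M = (case split_block (mat_exp M) L L of (A, B, C, D) \<Rightarrow> C)"

definition T22 :: "nat \<Rightarrow> complex mat \<Rightarrow> complex mat" where
  "T22 L M = (case split_block (mat_exp M) L L of (A, B, C, D) \<Rightarrow> D)"

text \<open>The three definitions below are meant for invertible \<open>T22\<close>.\<close>

definition T22_inv :: "nat \<Rightarrow> complex mat \<Rightarrow> complex mat" where
  "T22_inv L M = the (mat_inverse (T22 L M))"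

definition X_mat :: "nat \<Rightarrow> complex mat \<Rightarrow> complex mat" where
  "X_mat L M = T12 L M * T22_inv L M"

definition Z_mat :: "nat \<Rightarrow> complex mat \<Rightarrow> complex mat" where
  "Z_mat L M = T22_inv L M * T21 L M"

text \<open>Since \<open>exp (- Y)\<close> is the transpose of \<open>T22\<close>, the off-diagonal blocks \<open>exp Y\<close> and
  \<open>- exp (transpose Y)\<close> do not depend on the choice of the logarithm \<open>Y\<close>: they are the
  transpose of the inverse of \<open>T22\<close>, and minus the inverse of \<open>T22\<close>.\<close>

definition A_mat :: "nat \<Rightarrow> complex mat \<Rightarrow> complex mat" where
  "A_mat L M = four_block_mat (X_mat L M) (transpose_mat (T22_inv L M))
                              (- T22_inv L M) (Z_mat L M)"

definition factorizes :: "nat \<Rightarrow> complex mat \<Rightarrow> complex mat \<Rightarrow> bool" where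
  "factorizes L M Y \<longleftrightarrow> Y \<in> carrier_mat L L \<and> mat_exp (- Y) = transpose_mat (T22 L M) \<and>
     gaussian_op L M =
       mat_exp ((1 / 2) \<cdot>\<^sub>m bilinear_op L L (create L) (X_mat L M) (create L)) *
       mat_exp (bilinear_op L L (create L) Y (annihilate L) - (mat_trace Y / 2) \<cdot>\<^sub>m 1\<^sub>m (2 ^ L)) *
       mat_exp ((1 / 2) \<cdot>\<^sub>m bilinear_op L L (annihilate L) (Z_mat L M) (annihilate L))"

text \<open>The number \<open>d\<close> is the square root of \<open>det T22\<close> with the sign that belongs to \<open>M\<close>:
  \<open>d = exp (- Tr Y / 2)\<close> for every logarithm \<open>Y\<close> that gives the factorization. Such a \<open>Y\<close> may fail
  to exist: if all Jordan blocks of \<open>T22\<close> have even size and belong to different eigenvalues,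
  then \<open>exp (- Tr Y / 2)\<close> is the same for all logarithms \<open>Y\<close>, and it can be the wrong
  root for \<open>M\<close>. In that case the definition only says that \<open>d\<close> is a root of \<open>det T22\<close>.\<close>

definition is_sqrt_det_T22 :: "nat \<Rightarrow> complex mat \<Rightarrow> complex \<Rightarrow> bool" where
  "is_sqrt_det_T22 L M d \<longleftrightarrow> d\<^sup>2 = det (T22 L M) \<and>
     (\<forall>Y. factorizes L M Y \<longrightarrow> d = exp (- mat_trace Y / 2))"


text \<open>A spin configuration is a predicate on sites, true where the spin is up; only its values at
  sites below \<open>L\<close> matter. Both products over up sites have the creation and annihilation
  operators in the order \<open>c\<^sup>\<dagger>\<^sub>i\<^sub>1 \<dots> c\<^sup>\<dagger>\<^sub>i\<^sub>p |0>\<close> and \<open><0| c\<^sub>j\<^sub>q \<dots> c\<^sub>j\<^sub>1\<close> with increasing sites.\<close>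

definition up_sites :: "nat \<Rightarrow> (nat \<Rightarrow> bool) \<Rightarrow> nat list" where
  "up_sites L S = filter S [0..<L]"

definition ket :: "nat \<Rightarrow> (nat \<Rightarrow> bool) \<Rightarrow> complex vec" where
  "ket L S = foldr (\<lambda>l v. create L l *\<^sub>v v) (up_sites L S) (vacuum L)"

definition bra :: "nat \<Rightarrow> (nat \<Rightarrow> bool) \<Rightarrow> complex vec \<Rightarrow> complex" where
  "bra L S v = vacuum L \<bullet> fold (\<lambda>l w. annihilate L l *\<^sub>v w) (up_sites L S) v"

definition matrix_element ::
  "nat \<Rightarrow> (nat \<Rightarrow> bool) \<Rightarrow> complex mat \<Rightarrow> (nat \<Rightarrow> bool) \<Rightarrow> complex" where
  "matrix_element L S G S' = bra L S (G *\<^sub>v ket L S')"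

definition sbar :: "nat \<Rightarrow> (nat \<Rightarrow> bool) \<Rightarrow> (nat \<Rightarrow> bool) \<Rightarrow> nat \<Rightarrow> complex" where
  "sbar L S S' m = (if (if m < L then S m else S' (m - L)) then 1 else -1)"

definition Kz_entry ::
  "nat \<Rightarrow> complex mat \<Rightarrow> complex mat \<Rightarrow> complex mat \<Rightarrow> (nat \<Rightarrow> bool) \<Rightarrow> (nat \<Rightarrow> bool) \<Rightarrow>
    nat \<Rightarrow> nat \<Rightarrow> complex" where
  "Kz_entry L \<Sigma> \<Sigma>' M S S' m n =
     ((1 + sbar L S S' m) / 2) * ((1 + sbar L S S' n) / 2) * \<Sigma> $$ (m, n) * A_mat L M $$ (m, n)
   + ((1 - sbar L S S' m) / 2) * ((1 - sbar L S S' n) / 2) * \<Sigma>' $$ (m, n)"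

definition Kz ::
  "nat \<Rightarrow> complex mat \<Rightarrow> complex mat \<Rightarrow> complex mat \<Rightarrow> (nat \<Rightarrow> bool) \<Rightarrow> (nat \<Rightarrow> bool) \<Rightarrow>
    complex mat" where
  "Kz L \<Sigma> \<Sigma>' M S S' = mat (2 * L) (2 * L)
     (\<lambda>(m, n). if m < n then Kz_entry L \<Sigma> \<Sigma>' M S S' m n
              else if n < m then - Kz_entry L \<Sigma> \<Sigma>' M S S' n m
              else 0)"

text \<open>From one admissible pair others arise by multiplying both matrices entrywise by
  \<open>c e\<^sub>m e\<^sub>n\<close>, with signs \<open>c\<close> and \<open>e\<^sub>0, \<dots>\<close> such that \<open>c ^ L * (\<Prod>m<2 * L. e\<^sub>m) = 1\<close>. These are
  \<open>2 ^ (2 * L - 1)\<close> distinct factors if \<open>L \<ge> 2\<close>. For \<open>L = 1\<close> the only off-diagonal factor is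
  \<open>c e\<^sub>0 e\<^sub>1 = 1\<close>, so that there is one admissible pair instead of two.\<close>

end

theory Submission
  imports Defs
begin

text \<open>The number \<open>d\<close> is the vacuum expectation value \<open><0|G|0>\<close>. Conjugation by \<open>G\<close> acts
  linearly on the mode operators by \<open>T = exp M\<close>, so when \<open>T22\<close> is invertible the operator with the
  smallest index in a matrix element can be commuted through \<open>G\<close>. Its contractions with the others are
  entries of \<open>A\<close>, and the recursion that results is the expansion of a Pfaffian along its first
  row (Wick's theorem). The Pfaffian of \<open>Kz\<close> splits into those of its up and down parts, and
  the signs of the matrices \<open>\<Sigma>\<close> and \<open>\<Sigma>'\<close> are chosen to absorb the sign of the shuffle
  and the reordering of the operators.

  That \<open>d\<^sup>2 = det T22\<close> follows from the filled state \<open>|F>\<close>. The product \<open>P\<close> of all creation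
  operators is \<open>|F><0|\<close>, so \<open><F|G\<^sup>-\<^sup>1 P G|0> = <F|G\<^sup>-\<^sup>1|F> <0|G|0>\<close>, where the first
  factor is \<open><0|G|0>\<close> again by the particle-hole symmetry. On the other hand \<open>G\<^sup>-\<^sup>1 P G\<close> is the
  product of the conjugated creation operators, whose component from \<open>|0>\<close> to \<open>|F>\<close> is
  \<open>det T22\<close>.\<close>

subsection \<open>Pfaffians of finite index sets\<close>

text \<open>The same \<open>d\<close> must serve all configurations, and it must be the right square
  root. A logarithm \<open>Y\<close> that gives the factorization may fail to exist, so
  \<open>d\<close> cannot be defined through one. The vacuum amplitude exists for every
  \<open>M\<close>; its square is computed without \<open>Y\<close>, and the factorization, whenever
  it holds, is evaluated in the vacuum separately.

  The other obstacle is that two fixed matrices have to provide the signs for all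
  \<open>4 ^ L\<close> configurations. The signs depend on the sites of the up spins. The gauge
  factors are chosen such that a right site \<open>i\<close> contributes \<open>(-1) ^ i\<close>
  whether its spin is up or down: this part then becomes a product over all sites, hence a constant.
  What is left is a congruence in the numbers of up and down spins on the right.

  The Pfaffian is handled as a recursion over finite index sets. It has no normalization, restricts
  to subsets of the indices and reads only entries \<open>B x y\<close> with \<open>x < y\<close>,
  so it can be compared directly with the recursion that the contractions satisfy.\<close>

function pf_set :: "(nat \<Rightarrow> nat \<Rightarrow> complex) \<Rightarrow> nat set \<Rightarrow> complex" where
  "pf_set B I = (if finite I then if I = {} then 1
     else (\<Sum>y\<in>I - {Min I}. (-1) ^ card {z \<in> I. Min I < z \<and> z < y} * B (Min I) y *
       pf_set B (I - {Min I, y})) else 0)"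
  by auto
termination
proof (relation "measure (\<lambda>(B, I). card I)", goal_cases)
  case (2 B I y)
  have "I - {Min I, y} \<subset> I"
    using 2 by auto
  then show ?case
    using 2 psubset_card_mono[of I "I - {Min I, y}"] by (simp del: card_Diff_insert)
qed auto

declare pf_set.simps [simp del]

lemma pf_set_empty [simp]: "pf_set B {} = 1"
  by (simp add: pf_set.simps)

lemma pf_set_insert:
  assumes "finite I" "\<forall>z\<in>I. x < z"
  shows "pf_set B (insert x I) =
    (\<Sum>y\<in>I. (-1) ^ card {z \<in> I. z < y} * B x y * pf_set B (I - {y}))"
proof -
  have "Min (insert x I) = x"
    using assms by (intro Min_eqI) (auto intro: less_imp_le)
  moreover have "insert x I - {x} = I" "insert x I - {x, y} = I - {y}"
    "{z \<in> insert x I. x < z \<and> z < y} = {z \<in> I. z < y}" for y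
    using assms by auto
  ultimately show ?thesis
    using assms by (subst pf_set.simps) simp
qed

text \<open>Tailored to the recursion: the hypothesis has to cover every \<open>I - {y}\<close>, not
  only the set without its minimum.\<close>

lemma pf_set_induct [consumes 1, case_names empty insert]:
  fixes I :: "nat set"
  assumes "finite I" and "P {}"
    and step: "\<And>x I. finite I \<Longrightarrow> \<forall>z\<in>I. x < z \<Longrightarrow> (\<And>y. y \<in> I \<Longrightarrow> P (I - {y})) \<Longrightarrow> P (insert x I)"
  shows "P I"
  using assms(1)
proof (induction I rule: measure_induct_rule[of card])
  case (less I)
  show ?case
  proof (cases "I = {}")
    case False
    define x where "x = Min I"
    have x: "x \<in> I" "\<forall>z\<in>I - {x}. x < z"
      using False less.prems by (auto simp: x_def order.strict_iff_order)
    have "P (insert x (I - {x}))"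
    proof (rule step)
      fix y assume y: "y \<in> I - {x}"
      show "P (I - {x} - {y})"
        using less.prems x y by (intro less.IH psubset_card_mono) auto
    qed (use less.prems x in auto)
    then show ?thesis
      using x by (simp add: insert_absorb)
  qed (use assms in simp)
qed

lemma pf_set_cong:
  assumes "\<And>x y. x \<in> I \<Longrightarrow> y \<in> I \<Longrightarrow> x < y \<Longrightarrow> B x y = B' x y"
  shows "pf_set B I = pf_set B' I"
proof (cases "finite I")
  case True
  then show ?thesis using assms
  proof (induction I rule: pf_set_induct)
    case (insert x I)
    then show ?case
      by (simp add: pf_set_insert)
  qed simp
qed (simp add: pf_set.simps)

text \<open>Each expansion step removes two indices, so an odd set ends in a singleton, whose
  expansion is an empty sum. Sign comparisons are therefore only needed for even sets.\<close>

lemma pf_set_odd: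
  assumes "finite I" "odd (card I)"
  shows "pf_set B I = 0"
  using assms
proof (induction I rule: pf_set_induct)
  case (insert x I)
  have "pf_set B (I - {y}) = 0" if "y \<in> I" for y
    using that insert.hyps insert.prems
    by (intro insert.IH) (auto simp: card_insert_if)
  then show ?case
    using insert.hyps by (simp add: pf_set_insert)
qed simp

text \<open>In every perfect matching of \<open>I\<close> the constant \<open>c\<close> occurs once
  per pair and each \<open>e\<close> once per index. This freedom produces the many pairs of sign
  matrices.\<close>

lemma pf_set_gauge:
  assumes "finite I"
  shows "pf_set (\<lambda>m n. c * e m * e n * B m n) I = c ^ (card I div 2) * prod e I * pf_set B I"
  using assms
proof (induction I rule: pf_set_induct)
  case (insert x I)
  have x: "x \<notin> I"
    using insert.hyps by auto
  have *: "c ^ (card (insert x I) div 2) * prod e (insert x I) =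
    c * e x * e y * (c ^ (card (I - {y}) div 2) * prod e (I - {y}))" if "y \<in> I" for y
  proof -
    have "card (insert x I) = card (I - {y}) + 2"
      using that insert.hyps x card.remove[of I y] by simp
    then have "card (insert x I) div 2 = Suc (card (I - {y}) div 2)"
      by simp
    then show ?thesis
      using that insert.hyps x prod.remove[of I y e] by (simp del: card_Diff_insert)
  qed
  show ?case
    unfolding pf_set_insert[OF insert.hyps] sum_distrib_left
    by (intro sum.cong refl) (simp only: insert.IH *, simp)
qed simp

text \<open>The recursion depends only on the order of the indices. This relabels the minors in the
  permutation sum, whose indices skip a value.\<close>

lemma pf_set_image:
  assumes "finite I" "strict_mono_on I f"
  shows "pf_set B (f ` I) = pf_set (\<lambda>a b. B (f a) (f b)) I"
  using assms
proof (induction I rule: pf_set_induct)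
  case (insert x I)
  have less: "f a < f b \<longleftrightarrow> a < b" if "a \<in> insert x I" "b \<in> insert x I" for a b
    using insert.prems that by (meson strict_mono_on_less)
  have inj: "inj_on f (insert x I)"
    using insert.prems by (rule strict_mono_on_imp_inj_on)
  have IH: "pf_set B (f ` I - {f y}) = pf_set (\<lambda>a b. B (f a) (f b)) (I - {y})" if "y \<in> I" for y
  proof -
    have "f ` (I - {y}) = f ` I - {f y}"
      using inj that by (auto simp: inj_on_def)
    moreover have "strict_mono_on (I - {y}) f"
      using insert.prems by (auto simp: strict_mono_on_def)
    ultimately show ?thesis using insert.IH that by metis
  qed
  have card: "card {z \<in> f ` I. z < f y} = card {z \<in> I. z < y}" if "y \<in> I" for y
  proof -
    have "{z \<in> f ` I. z < f y} = f ` {z \<in> I. z < y}"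
      using less that by auto
    then show ?thesis
      using inj by (simp add: card_image inj_on_def)
  qed
  have "pf_set B (f ` insert x I) =
    (\<Sum>y\<in>f ` I. (-1) ^ card {z \<in> f ` I. z < y} * B (f x) y * pf_set B (f ` I - {y}))"
    using insert.hyps less by (subst image_insert, subst pf_set_insert) auto
  also have "\<dots> = (\<Sum>y\<in>I. (-1) ^ card {z \<in> f ` I. z < f y} * B (f x) (f y) * pf_set B (f ` I - {f y}))"
    using inj by (subst sum.reindex) auto
  also have "\<dots> = pf_set (\<lambda>a b. B (f a) (f b)) (insert x I)"
    using insert.hyps card IH by (simp add: pf_set_insert)
  finally show ?case .
qed simp

subsection \<open>The permutation sum\<close>

definition pf_term :: "nat \<Rightarrow> (nat \<Rightarrow> nat \<Rightarrow> complex) \<Rightarrow> (nat \<Rightarrow> nat) \<Rightarrow> complex" where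
  "pf_term n B p = of_int (sign p) * (\<Prod>i<n. B (p (2 * i)) (p (2 * i + 1)))"

text \<open>The sign of the transposition cancels the sign from the antisymmetry of
  \<open>B\<close>.\<close>

lemma pf_term_swap_in_pair:
  assumes B: "\<And>a b. B b a = - B a b" and i: "i < n" and p: "permutation p"
  shows "pf_term n B (p \<circ> transpose (2 * i) (2 * i + 1)) = pf_term n B p"
proof -
  let ?t = "transpose (2 * i) (2 * i + 1)"
  have "sign (p \<circ> ?t) = - sign p"
    using p by (simp add: sign_compose permutation_swap_id sign_swap_id)
  moreover have "(\<Prod>l<n. B ((p \<circ> ?t) (2 * l)) ((p \<circ> ?t) (2 * l + 1))) =
      - (\<Prod>l<n. B (p (2 * l)) (p (2 * l + 1)))"
  proof -
    have "(\<Prod>l\<in>{..<n} - {i}. B ((p \<circ> ?t) (2 * l)) ((p \<circ> ?t) (2 * l + 1))) =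
        (\<Prod>l\<in>{..<n} - {i}. B (p (2 * l)) (p (2 * l + 1)))"
    proof (rule prod.cong)
      fix l assume "l \<in> {..<n} - {i}"
      then have "?t (2 * l) = 2 * l" "?t (2 * l + 1) = 2 * l + 1"
        by (auto intro!: transpose_apply_other; presburger)+
      then show "B ((p \<circ> ?t) (2 * l)) ((p \<circ> ?t) (2 * l + 1)) = B (p (2 * l)) (p (2 * l + 1))"
        by simp
    qed simp
    moreover have "B ((p \<circ> ?t) (2 * i)) ((p \<circ> ?t) (2 * i + 1)) = - B (p (2 * i)) (p (2 * i + 1))"
      using B[of "p (2 * i)" "p (2 * i + 1)"] by (simp add: o_def)
    ultimately show ?thesis
      using i by (simp add: prod.remove[of "{..<n}" i])
  qed
  ultimately show ?thesis by (simp add: pf_term_def)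
qed

text \<open>Exchanging two whole pairs takes two transpositions, which is even, and only reorders
  the factors.\<close>

lemma pf_term_swap_pairs:
  assumes i: "i < n" "i \<noteq> 0" and p: "permutation p"
  shows "pf_term n B (p \<circ> (transpose 0 (2 * i) \<circ> transpose 1 (2 * i + 1))) = pf_term n B p"
proof -
  let ?t = "transpose 0 (2 * i) \<circ> transpose 1 (2 * i + 1)"
  have "sign (p \<circ> ?t) = sign p"
    using p i by (simp add: sign_compose permutation_swap_id sign_swap_id permutation_compose)
  moreover have "(\<Prod>l<n. B ((p \<circ> ?t) (2 * l)) ((p \<circ> ?t) (2 * l + 1))) =
      (\<Prod>l<n. B (p (2 * l)) (p (2 * l + 1)))"
  proof -
    have "?t (2 * l) = 2 * transpose 0 i l" "?t (2 * l + 1) = 2 * transpose 0 i l + 1" for l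
      using i by (auto simp: transpose_def; presburger)+
    moreover have "transpose 0 i permutes {..<n}"
      using i by (intro permutes_swap_id) auto
    ultimately show ?thesis
      using prod.permute[of "transpose 0 i" "{..<n}" "\<lambda>l. B (p (2 * l)) (p (2 * l + 1))"]
      by (simp add: o_def)
  qed
  ultimately show ?thesis by (simp add: pf_term_def)
qed

lemma sum_permutes_move:
  assumes t: "t permutes {0..<m}" and "t 0 = k"
    and f: "\<And>p. p permutes {0..<m} \<Longrightarrow> f (p \<circ> t) = f p"
  shows "(\<Sum>p | p permutes {0..<m} \<and> p k = 0. f p) = (\<Sum>p | p permutes {0..<m} \<and> p 0 = (0::nat). (f p :: complex))"
proof (rule sum.reindex_bij_witness[of _ "\<lambda>p. p \<circ> inv_into UNIV t" "\<lambda>p. p \<circ> t"])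
  fix p assume "p \<in> {p. p permutes {0..<m} \<and> p 0 = (0::nat)}"
  then show "p \<circ> inv_into UNIV t \<circ> t = p" "p \<circ> inv_into UNIV t \<in> {p. p permutes {0..<m} \<and> p k = 0}"
    using t assms(2) permutes_inv_o(2)[OF t]
    by (auto simp: o_assoc[symmetric] permutes_inverses(2) intro!: permutes_compose permutes_inv)
next
  fix p assume "p \<in> {p. p permutes {0..<m} \<and> p k = 0}"
  then show "p \<circ> t \<circ> inv_into UNIV t = p" "p \<circ> t \<in> {p. p permutes {0..<m} \<and> p 0 = (0::nat)}" "f (p \<circ> t) = f p"
    using assms permutes_inv_o(1)[OF t]
    by (auto simp: o_assoc[symmetric] intro!: permutes_compose)
qed

lemma sum_permutes_Suc:
  "(\<Sum>p | p permutes {0..<Suc m}. (f p :: complex)) =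
   (\<Sum>k<Suc m. \<Sum>q | q permutes {0..<m}. f (permutation_insert 0 k q))"
proof -
  have "(\<Sum>p | p permutes {0..<Suc m}. f p) =
    (\<Sum>k<Suc m. \<Sum>p\<in>{p \<in> {p. p permutes {0..<Suc m}}. p 0 = k}. f p)"
    by (rule sum.group[symmetric]) (auto simp: finite_permutations permutes_in_image dest: permutes_in_image[where x=0])
  also have "\<dots> = (\<Sum>k<Suc m. \<Sum>q | q permutes {0..<m}. f (permutation_insert 0 k q))"
  proof (rule sum.cong)
    fix k assume "k \<in> {..<Suc m}"
    then show "(\<Sum>p\<in>{p \<in> {p. p permutes {0..<Suc m}}. p 0 = k}. f p) =
      (\<Sum>q | q permutes {0..<m}. f (permutation_insert 0 k q))"
      using permutation_fix[of 0 m k] permutation_insert_inj_on[of 0 m k]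
      by (simp add: sum.reindex)
  qed simp
  finally show ?thesis .
qed

lemma sum_permutes_fix_0:
  "(\<Sum>p | p permutes {0..<Suc m} \<and> p 0 = 0. (f p :: complex)) =
   (\<Sum>q | q permutes {0..<m}. f (permutation_insert 0 0 q))"
  by (subst permutation_fix, simp, simp, subst sum.reindex)
    (use permutation_insert_inj_on[of 0 m 0] in \<open>auto simp only: zero_less_Suc o_def\<close>)

text \<open>Swaps inside a pair and swaps of pairs carry the preimage of 0 from any of the
  \<open>2 * Suc n\<close> positions to position 0, so all positions contribute equally. The factor
  is the ratio of the normalizations \<open>2 ^ n * fact n\<close> for \<open>Suc n\<close> and for
  \<open>n\<close>.\<close>

lemma pf_sum_Suc:
  assumes B: "\<And>a b. B b a = - B a b"
  shows "(\<Sum>p | p permutes {0..<2 * Suc n}. pf_term (Suc n) B p) =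
    of_nat (2 * Suc n) * (\<Sum>p | p permutes {0..<2 * Suc n} \<and> p 0 = 0. pf_term (Suc n) B p)"
proof -
  let ?m = "2 * Suc n"
  let ?S = "\<lambda>k. \<Sum>p | p permutes {0..<?m} \<and> p k = 0. pf_term (Suc n) B p"
  have perm: "permutation p" if "p permutes {0..<?m}" for p
    using that by (auto simp: permutation_permutes)
  have even: "?S (2 * i) = ?S 0" if "i < Suc n" for i
  proof (cases "i = 0")
    case False
    show ?thesis
      using False that pf_term_swap_pairs[of i "Suc n" _ B] perm
      by (intro sum_permutes_move[where t="transpose 0 (2 * i) \<circ> transpose 1 (2 * i + 1)"])
        (auto intro!: permutes_compose permutes_swap_id simp: transpose_def)
  qed simp
  have odd: "?S (2 * i + 1) = ?S 0" if i: "i < Suc n" for i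
  proof -
    let ?t = "transpose (2 * i) (2 * i + 1)"
    have "?S (2 * i + 1) = ?S (2 * i)"
    proof (rule sum.reindex_bij_witness[of _ "\<lambda>p. p \<circ> ?t" "\<lambda>p. p \<circ> ?t"])
      fix p assume "p \<in> {p. p permutes {0..<?m} \<and> p (2 * i + 1) = 0}"
      then show "p \<circ> ?t \<in> {p. p permutes {0..<?m} \<and> p (2 * i) = 0}"
        "pf_term (Suc n) B (p \<circ> ?t) = pf_term (Suc n) B p"
        using i perm pf_term_swap_in_pair[of B i "Suc n" p, OF B]
        by (auto intro!: permutes_compose permutes_swap_id)
    next
      fix p assume "p \<in> {p. p permutes {0..<?m} \<and> p (2 * i) = 0}"
      then show "p \<circ> ?t \<in> {p. p permutes {0..<?m} \<and> p (2 * i + 1) = 0}"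
        using i by (auto intro!: permutes_compose permutes_swap_id)
    qed (simp_all add: o_assoc[symmetric])
    then show ?thesis using even[OF i] by simp
  qed
  have "(\<Sum>p | p permutes {0..<?m}. pf_term (Suc n) B p) =
    (\<Sum>k<?m. \<Sum>p\<in>{p \<in> {p. p permutes {0..<?m}}. inv_into UNIV p 0 = k}. pf_term (Suc n) B p)"
  proof (rule sum.group[symmetric])
    show "(\<lambda>p. inv_into UNIV p 0) ` {p. p permutes {0..<?m}} \<subseteq> {..<?m}"
    proof safe
      fix p assume "p permutes {0..<?m}"
      then have "inv_into UNIV p permutes {0..<?m}" by (rule permutes_inv)
      then have "inv_into UNIV p 0 \<in> {0..<?m}" by (subst permutes_in_image) auto
      then show "inv_into UNIV p 0 < ?m" by simp
    qed
  qed (auto simp: finite_permutations)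
  also have "\<dots> = (\<Sum>k<?m. ?S k)"
    by (intro sum.cong refl) (auto simp: permutes_inv_eq)
  also have "\<dots> = (\<Sum>k<?m. ?S 0)"
  proof (rule sum.cong)
    fix k assume "k \<in> {..<?m}"
    then show "?S k = ?S 0"
      using even[of "k div 2"] odd[of "k div 2"] by (cases "even k") auto
  qed simp
  finally show ?thesis by simp
qed

text \<open>A permutation with \<open>p 0 = 0\<close> and \<open>p 1 = Suc k\<close> is a double
  insertion. Its first pair gives \<open>B 0 (Suc k)\<close>, the insertion of \<open>k\<close>
  gives the sign, and the other pairs see \<open>B\<close> with the indices 0 and
  \<open>Suc k\<close> skipped.\<close>

lemma pf_term_insert:
  assumes q: "q permutes {0..<2 * n}" and k: "k < Suc (2 * n)"
  shows "pf_term (Suc n) B (permutation_insert 0 0 (permutation_insert 0 k q)) =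
    (-1) ^ k * B 0 (Suc k) * pf_term n (\<lambda>a b. B (Suc (insert_index k a)) (Suc (insert_index k b))) q"
proof -
  let ?r = "permutation_insert 0 k q"
  let ?p = "permutation_insert 0 0 ?r"
  have r: "?r permutes {0..<Suc (2 * n)}"
    using q k by (intro permutation_insert_permutes) auto
  have "of_int (sign ?p) = (-1) ^ k * (of_int (sign q) :: complex)"
    using signof_permutation_insert[OF r, of 0 0, where ?'a=complex]
      signof_permutation_insert[OF q, of 0 k, where ?'a=complex] k by simp
  moreover have "?p 0 = 0" "?p 1 = Suc k" "?p (Suc (Suc i)) = Suc (insert_index k (q i))" for i
    by (auto simp: permutation_insert_expand insert_index_def)
  ultimately show ?thesis
    by (simp add: pf_term_def prod.lessThan_Suc_shift del: prod.lessThan_Suc)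
qed

lemma pf_sum_eq_pf_set:
  assumes "\<And>a b. B b a = - B a b"
  shows "(\<Sum>p | p permutes {0..<2 * n}. pf_term n B p) = 2 ^ n * fact n * pf_set B {0..<2 * n}"
  using assms
proof (induction n arbitrary: B)
  case 0
  have "{p. p permutes {0..<2 * (0::nat)}} = {id}"
    by (auto simp: permutes_empty)
  then show ?case by (simp only: pf_term_def) simp
next
  case (Suc n)
  let ?g = "\<lambda>k i. Suc (insert_index k i)"
  have "(\<Sum>p | p permutes {0..<2 * Suc n} \<and> p 0 = 0. pf_term (Suc n) B p) =
    (\<Sum>k<Suc (2 * n). \<Sum>q | q permutes {0..<2 * n}.
      pf_term (Suc n) B (permutation_insert 0 0 (permutation_insert 0 k q)))"
    using sum_permutes_fix_0[where m="Suc (2 * n)" and f="pf_term (Suc n) B"] by (simp only: sum_permutes_Suc mult_Suc_right add_2_eq_Suc)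
  also have "\<dots> = (\<Sum>k<Suc (2 * n). (-1) ^ k * B 0 (Suc k) *
      (\<Sum>q | q permutes {0..<2 * n}. pf_term n (\<lambda>a b. B (?g k a) (?g k b)) q))"
    by (intro sum.cong refl) (simp add: pf_term_insert sum_distrib_left)
  also have "\<dots> = (\<Sum>k<Suc (2 * n). (-1) ^ k * B 0 (Suc k) *
      (2 ^ n * fact n * pf_set B ({1..<2 * Suc n} - {Suc k})))"
  proof (rule sum.cong)
    fix k assume "k \<in> {..<Suc (2 * n)}"
    then have k: "k < Suc (2 * n)" by simp
    have "(?g k) ` {0..<2 * n} = {1..<2 * Suc n} - {Suc k}"
    proof -
      have "insert_index k ` {0..<2 * n} = {0..<Suc (2 * n)} - {k}"
        using insert_index_image[of k "2 * n"] k by simp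
      then have "Suc ` insert_index k ` {0..<2 * n} = Suc ` ({0..<Suc (2 * n)} - {k})"
        by simp
      also have "\<dots> = {1..<2 * Suc n} - {Suc k}"
        by (auto simp: image_set_diff image_Suc_atLeastLessThan)
      finally show ?thesis by (simp add: image_image)
    qed
    moreover have "strict_mono_on {0..<2 * n} (?g k)"
      by (auto simp: strict_mono_on_def insert_index_def)
    ultimately have "pf_set (\<lambda>a b. B (?g k a) (?g k b)) {0..<2 * n} =
      pf_set B ({1..<2 * Suc n} - {Suc k})"
      using pf_set_image[of "{0..<2 * n}" "?g k" B] by simp
    then show "(-1) ^ k * B 0 (Suc k) *
      (\<Sum>q | q permutes {0..<2 * n}. pf_term n (\<lambda>a b. B (?g k a) (?g k b)) q) =
      (-1) ^ k * B 0 (Suc k) * (2 ^ n * fact n * pf_set B ({1..<2 * Suc n} - {Suc k}))"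
      using Suc.IH[of "\<lambda>a b. B (?g k a) (?g k b)", OF Suc.prems] by simp
  qed simp
  also have "\<dots> = 2 ^ n * fact n * pf_set B {0..<2 * Suc n}"
  proof -
    have "{0..<2 * Suc n} = insert 0 {1..<2 * Suc n}" by auto
    moreover have "card {z \<in> Suc ` {..<Suc (2 * n)}. z < Suc k} = k" if "k < Suc (2 * n)" for k
    proof -
      have "{z \<in> Suc ` {..<Suc (2 * n)}. z < Suc k} = Suc ` {..<k}"
        using that by auto
      then show ?thesis by (simp add: card_image)
    qed
    moreover have "{1..<2 * Suc n} = Suc ` {..<Suc (2 * n)}"
      by (simp add: image_Suc_lessThan atLeastLessThanSuc_atLeastAtMost)
    ultimately show ?thesis
      by (simp add: pf_set_insert sum_distrib_left sum.reindex mult_ac del: sum.lessThan_Suc)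
  qed
  finally show ?case
    using pf_sum_Suc[of B n, OF Suc.prems] by (simp add: algebra_simps del: sum.lessThan_Suc)
qed

lemma pfaffian_eq_pf_set:
  assumes A: "A \<in> carrier_mat (2 * n) (2 * n)"
    and B: "\<And>a b. B b a = - B a b"
    and AB: "\<And>a b. a < 2 * n \<Longrightarrow> b < 2 * n \<Longrightarrow> A $$ (a, b) = B a b"
  shows "pfaffian A = pf_set B {0..<2 * n}"
proof -
  have "(\<Sum>p | p permutes {0..<2 * n}. of_int (sign p) * (\<Prod>i<n. A $$ (p (2 * i), p (2 * i + 1)))) =
    (\<Sum>p | p permutes {0..<2 * n}. pf_term n B p)"
  proof (rule sum.cong)
    fix p assume "p \<in> {p. p permutes {0..<2 * n}}"
    then have "p i < 2 * n" if "i < 2 * n" for i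
      using that permutes_in_image[of p "{0..<2 * n}" i] by auto
    then show "of_int (sign p) * (\<Prod>i<n. A $$ (p (2 * i), p (2 * i + 1))) = pf_term n B p"
      unfolding pf_term_def by (intro arg_cong2[where f="(*)"] prod.cong) (auto simp: AB)
  qed simp
  then show ?thesis
    using A pf_sum_eq_pf_set[of B n, OF B] by (simp add: pfaffian_def Let_def)
qed

subsection \<open>Block structure and signs\<close>

text \<open>The sign of the permutation that lists the indices in \<open>U\<close> before the others
  and keeps the order within each class; the exponent counts the inversions at
  \<open>b\<close>.\<close>

definition shuffle_sign :: "(nat \<Rightarrow> bool) \<Rightarrow> nat set \<Rightarrow> complex" where
  "shuffle_sign U I = (\<Prod>b\<in>{b \<in> I. U b}. (-1) ^ card {a \<in> I. \<not> U a \<and> a < b})"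

lemma card_split_less:
  assumes "finite I"
  shows "card {z \<in> I. z < (y::nat)} = card {z \<in> I. U z \<and> z < y} + card {z \<in> I. \<not> U z \<and> z < y}"
proof -
  have "{z \<in> I. z < y} = {z \<in> I. U z \<and> z < y} \<union> {z \<in> I. \<not> U z \<and> z < y}"
    by auto
  then show ?thesis
    using assms by (simp add: card_Un_disjoint disjoint_iff)
qed

text \<open>The minimum can only be paired with an index of its own class. The full expansion counts
  all indices before \<open>y\<close>, the expansion of a block only those of the same class; the
  surplus is the change of \<open>shuffle_sign\<close> when the minimum and \<open>y\<close> are
  removed.\<close>

lemma pf_set_block:
  assumes "finite I" and "\<And>x y. x \<in> I \<Longrightarrow> y \<in> I \<Longrightarrow> U x \<noteq> U y \<Longrightarrow> B x y = 0"
  shows "pf_set B I = shuffle_sign U I * pf_set B {x \<in> I. U x} * pf_set B {x \<in> I. \<not> U x}"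
  using assms
proof (induction I rule: pf_set_induct)
  case empty
  then show ?case by (simp add: shuffle_sign_def)
next
  case (insert x I)
  let ?u = "\<lambda>I. {z \<in> I. U z}" and ?d = "\<lambda>I. {z \<in> I. \<not> U z}"
  have IH: "pf_set B (I - {y}) = shuffle_sign U (I - {y}) * pf_set B (?u (I - {y})) * pf_set B (?d (I - {y}))"
    if "y \<in> I" for y
    using that insert.prems by (intro insert.IH) auto
  have fin: "finite (?u I)" "finite (?d I)"
    using insert.hyps by auto
  show ?case
  proof (cases "U x")
    case True
    have sets: "?u (insert x I) = insert x (?u I)" "?d (insert x I) = ?d I"
      using True by auto
    \<comment> \<open>The minimum lies in \<open>U\<close> and has nothing before it, so only the
      inversions at \<open>y\<close> are lost.\<close>
    have eps: "shuffle_sign U (insert x I) = (-1) ^ card {z \<in> I. \<not> U z \<and> z < y} * shuffle_sign U (I - {y})"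
      if y: "y \<in> ?u I" for y
    proof -
      have "{a \<in> insert x I. \<not> U a \<and> a < b} = {a \<in> I. \<not> U a \<and> a < b}" for b
        using True by auto
      moreover have "{a \<in> I. \<not> U a \<and> a < x} = {}"
        using insert.hyps by auto
      moreover have "x \<notin> ?u I"
        using insert.hyps by auto
      ultimately have "shuffle_sign U (insert x I) = shuffle_sign U I"
        using fin by (simp only: shuffle_sign_def sets prod.insert card.empty power_0 mult_1 not_False_eq_True)
      also have "\<dots> = (-1) ^ card {z \<in> I. \<not> U z \<and> z < y} *
          (\<Prod>b\<in>?u I - {y}. (-1) ^ card {a \<in> I. \<not> U a \<and> a < b})"
        unfolding shuffle_sign_def using fin y by (subst prod.remove[of _ y]) auto
      also have "(\<Prod>b\<in>?u I - {y}. (-1) ^ card {a \<in> I. \<not> U a \<and> a < b}) = shuffle_sign U (I - {y})"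
      proof -
        have "{a \<in> I - {y}. \<not> U a \<and> a < b} = {a \<in> I. \<not> U a \<and> a < b}" for b
          using y by auto
        moreover have "?u (I - {y}) = ?u I - {y}" by auto
        ultimately show ?thesis by (simp only: shuffle_sign_def)
      qed
      finally show ?thesis .
    qed
    have "pf_set B (insert x I) =
      (\<Sum>y\<in>I. (-1) ^ card {z \<in> I. z < y} * B x y * pf_set B (I - {y}))"
      by (rule pf_set_insert[OF insert.hyps])
    also have "\<dots> = (\<Sum>y\<in>?u I. (-1) ^ card {z \<in> I. z < y} * B x y * pf_set B (I - {y}))"
      using insert.hyps(1) insert.prems True by (intro sum.mono_neutral_right) auto
    also have "\<dots> = (\<Sum>y\<in>?u I. shuffle_sign U (insert x I) * ((-1) ^ card {z \<in> ?u I. z < y} * B x y *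
        pf_set B (?u I - {y})) * pf_set B (?d I))"
    proof (rule sum.cong)
      fix y assume y: "y \<in> ?u I"
      have "?u (I - {y}) = ?u I - {y}" "?d (I - {y}) = ?d I" using y by auto
      then have "pf_set B (I - {y}) = shuffle_sign U (I - {y}) * pf_set B (?u I - {y}) * pf_set B (?d I)"
        using IH[of y] y by simp
      moreover have "card {z \<in> I. z < y} = card {z \<in> ?u I. z < y} + card {z \<in> I. \<not> U z \<and> z < y}"
        using card_split_less[OF insert.hyps(1), of y U] by simp
      ultimately show "(-1) ^ card {z \<in> I. z < y} * B x y * pf_set B (I - {y}) =
        shuffle_sign U (insert x I) * ((-1) ^ card {z \<in> ?u I. z < y} * B x y * pf_set B (?u I - {y})) *
        pf_set B (?d I)"
        using eps[OF y] by (simp add: power_add)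
    qed simp
    also have "\<dots> = shuffle_sign U (insert x I) * pf_set B (insert x (?u I)) * pf_set B (?d I)"
      using insert.hyps fin by (subst pf_set_insert) (auto simp: sum_distrib_left sum_distrib_right)
    finally show ?thesis by (simp only: sets)
  next
    case False
    have sets: "?d (insert x I) = insert x (?d I)" "?u (insert x I) = ?u I"
      using False by auto
    \<comment> \<open>Here \<open>x\<close> and \<open>y\<close> lie outside \<open>U\<close>. Every
      \<open>b\<close> in \<open>U\<close> comes after \<open>x\<close>, and also after
      \<open>y\<close> unless \<open>b < y\<close>; so exactly the \<open>b\<close> with
      \<open>b < y\<close> change their sign.\<close>
    have eps: "shuffle_sign U (insert x I) = (-1) ^ card {z \<in> I. U z \<and> z < y} * shuffle_sign U (I - {y})"
      if y: "y \<in> ?d I" for y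
    proof -
      have "(-1) ^ card {a \<in> insert x I. \<not> U a \<and> a < b} =
          (if b < y then -1 else 1) * (-1 :: complex) ^ card {a \<in> I - {y}. \<not> U a \<and> a < b}"
        if b: "b \<in> ?u I" for b
      proof -
        have "b \<noteq> y" using b y by auto
        then have "{a \<in> insert x I. \<not> U a \<and> a < b} =
            insert x (if b < y then {a \<in> I - {y}. \<not> U a \<and> a < b} else insert y {a \<in> I - {y}. \<not> U a \<and> a < b})"
          using False b y insert.hyps \<open>b \<noteq> y\<close> by auto
        moreover have "x \<notin> I" using insert.hyps by auto
        ultimately show ?thesis
          using y insert.hyps(1) by (auto simp: card_insert_if)
      qed
      then have "shuffle_sign U (insert x I) =
          (\<Prod>b\<in>?u I. (if b < y then -1 else 1) * (-1) ^ card {a \<in> I - {y}. \<not> U a \<and> a < b})"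
        by (simp only: shuffle_sign_def sets cong: prod.cong)
      also have "\<dots> = (\<Prod>b\<in>?u I. if b < y then -1 else 1) * shuffle_sign U (I - {y})"
      proof -
        have "?u (I - {y}) = ?u I" using y by auto
        then show ?thesis by (simp add: prod.distrib shuffle_sign_def)
      qed
      also have "(\<Prod>b\<in>?u I. if b < y then -1 else 1) = (-1 :: complex) ^ card {z \<in> I. U z \<and> z < y}"
      proof -
        have "(\<Prod>b\<in>?u I. if b < y then -1 else 1) = (\<Prod>b\<in>{b \<in> ?u I. b < y}. - 1 :: complex)"
          by (rule prod.inter_filter[symmetric]) (rule fin)
        then show ?thesis by (simp add: conj_assoc)
      qed
      finally show ?thesis .
    qed
    have "pf_set B (insert x I) =
      (\<Sum>y\<in>I. (-1) ^ card {z \<in> I. z < y} * B x y * pf_set B (I - {y}))"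
      by (rule pf_set_insert[OF insert.hyps])
    also have "\<dots> = (\<Sum>y\<in>?d I. (-1) ^ card {z \<in> I. z < y} * B x y * pf_set B (I - {y}))"
      using insert.hyps(1) insert.prems False by (intro sum.mono_neutral_right) auto
    also have "\<dots> = (\<Sum>y\<in>?d I. shuffle_sign U (insert x I) * pf_set B (?u I) *
        ((-1) ^ card {z \<in> ?d I. z < y} * B x y * pf_set B (?d I - {y})))"
    proof (rule sum.cong)
      fix y assume y: "y \<in> ?d I"
      have "?d (I - {y}) = ?d I - {y}" "?u (I - {y}) = ?u I" using y by auto
      then have "pf_set B (I - {y}) = shuffle_sign U (I - {y}) * pf_set B (?u I) * pf_set B (?d I - {y})"
        using IH[of y] y by simp
      moreover have "card {z \<in> I. z < y} = card {z \<in> I. U z \<and> z < y} + card {z \<in> ?d I. z < y}"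
        using card_split_less[OF insert.hyps(1), of y U] by simp
      ultimately show "(-1) ^ card {z \<in> I. z < y} * B x y * pf_set B (I - {y}) =
        shuffle_sign U (insert x I) * pf_set B (?u I) *
        ((-1) ^ card {z \<in> ?d I. z < y} * B x y * pf_set B (?d I - {y}))"
        using eps[OF y] by (simp add: power_add)
    qed simp
    also have "\<dots> = shuffle_sign U (insert x I) * pf_set B (?u I) * pf_set B (insert x (?d I))"
      using insert.hyps fin by (subst pf_set_insert) (auto simp: sum_distrib_left)
    finally show ?thesis by (simp only: sets)
  qed
qed

lemma sum_alternating_rank:
  fixes Y :: "nat set"
  assumes "finite Y"
  shows "(\<Sum>y\<in>Y. (-1) ^ card {z \<in> Y. z < y}) = (if odd (card Y) then 1 else (0::complex))"
  using assms
proof (induction Y rule: finite_linorder_min_induct)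
  case (insert x Y)
  have "(\<Sum>y\<in>insert x Y. (-1) ^ card {z \<in> insert x Y. z < y}) =
    1 + (\<Sum>y\<in>Y. (-1 :: complex) ^ card {z \<in> insert x Y. z < y})"
  proof -
    have "{z \<in> insert x Y. z < x} = {}" "x \<notin> Y" using insert.hyps by auto
    then show ?thesis using insert.hyps by (simp only: sum.insert card.empty power_0 not_False_eq_True)
  qed
  also have "(\<Sum>y\<in>Y. (-1 :: complex) ^ card {z \<in> insert x Y. z < y}) = (\<Sum>y\<in>Y. - ((-1) ^ card {z \<in> Y. z < y}))"
  proof (rule sum.cong)
    fix y assume "y \<in> Y"
    then have "{z \<in> insert x Y. z < y} = insert x {z \<in> Y. z < y}" "x \<notin> {z \<in> Y. z < y}"
      using insert.hyps by auto
    then show "(-1 :: complex) ^ card {z \<in> insert x Y. z < y} = - ((-1) ^ card {z \<in> Y. z < y})"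
      using insert.hyps by simp
  qed simp
  also have "\<dots> = - (\<Sum>y\<in>Y. (-1) ^ card {z \<in> Y. z < y})"
    by (simp only: sum_negf)
  also have "\<dots> = - (if odd (card Y) then 1 else 0)"
    by (simp only: insert.IH)
  finally show ?case
    using insert.hyps by (auto simp: card_insert_if)
qed simp

text \<open>This is the all-ones Pfaffian for the order in which the indices \<open>\<ge> L\<close> are reversed.\<close>

lemma pf_set_signs:
  assumes "finite I" "even (card I)"
  shows "pf_set (\<lambda>m n. if L \<le> m then -1 else 1) I = (-1) ^ (card {z \<in> I. L \<le> z} div 2)"
  using assms
proof (induction I rule: pf_set_induct)
  case (insert x I)
  let ?B = "\<lambda>m n. if L \<le> m then -1 else 1 :: complex"
  let ?r = "card {z \<in> I. L \<le> z}" and ?l = "card {z \<in> I. z < L}"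
  have x: "x \<notin> I" using insert.hyps by auto
  have odd: "odd (card I)"
    using insert.hyps insert.prems x by simp
  have "{z \<in> I. L \<le> z} \<union> {z \<in> I. z < L} = I" by auto
  then have "card I = ?r + ?l"
    using insert.hyps card_Un_disjoint[of "{z \<in> I. L \<le> z}" "{z \<in> I. z < L}"] by (auto simp: disjoint_iff)
  with odd have par: "odd (?r + ?l)" by simp
  have IH: "pf_set ?B (I - {y}) = (-1) ^ (card {z \<in> I - {y}. L \<le> z} div 2)" if "y \<in> I" for y
    using that odd insert.hyps by (intro insert.IH) simp_all
  show ?case
  proof (cases "L \<le> x")
    case True
    then have all: "{z \<in> I - {y}. L \<le> z} = I - {y}" "{z \<in> insert x I. L \<le> z} = insert x I" for y
      using insert.hyps by auto
    have IH': "pf_set ?B (I - {y}) = (-1) ^ ((card I - 1) div 2)" if "y \<in> I" for y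
      using IH[OF that] that insert.hyps(1) by (simp only: all card_Diff_singleton)
    have "pf_set ?B (insert x I) = (\<Sum>y\<in>I. (-1) ^ card {z \<in> I. z < y} * (- ((-1) ^ ((card I - 1) div 2))))"
      using True insert.hyps IH' by (simp add: pf_set_insert)
    also have "\<dots> = - ((-1) ^ ((card I - 1) div 2))"
      using sum_alternating_rank[OF insert.hyps(1)] odd by (simp only: sum_distrib_right[symmetric]) simp
    also have "\<dots> = (-1) ^ (card (insert x I) div 2)"
      using odd insert.hyps x by (auto elim!: oddE)
    finally show ?thesis by (simp only: all)
  next
    case False
    have right: "{z \<in> insert x I. L \<le> z} = {z \<in> I. L \<le> z}"
      using False by auto
    have fin: "finite {z \<in> I. L \<le> z}" "finite {z \<in> I. z < L}"
      using insert.hyps by auto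
    have "pf_set ?B (insert x I) = (\<Sum>y\<in>I. (-1) ^ card {z \<in> I. z < y} * pf_set ?B (I - {y}))"
      using False insert.hyps by (simp add: pf_set_insert)
    also have "\<dots> = (\<Sum>y\<in>{z \<in> I. z < L}. (-1) ^ card {z \<in> I. z < y} * pf_set ?B (I - {y})) +
        (\<Sum>y\<in>{z \<in> I. L \<le> z}. (-1) ^ card {z \<in> I. z < y} * pf_set ?B (I - {y}))"
      using fin by (subst sum.union_disjoint[symmetric]) (auto intro!: sum.cong)
    also have "(\<Sum>y\<in>{z \<in> I. z < L}. (-1) ^ card {z \<in> I. z < y} * pf_set ?B (I - {y})) =
        (\<Sum>y\<in>{z \<in> I. z < L}. (-1) ^ card {z \<in> {z \<in> I. z < L}. z < y} * (-1) ^ (?r div 2))"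
    proof (rule sum.cong)
      fix y assume y: "y \<in> {z \<in> I. z < L}"
      have "{z \<in> I - {y}. L \<le> z} = {z \<in> I. L \<le> z}" "{z \<in> {z \<in> I. z < L}. z < y} = {z \<in> I. z < y}"
        using y by auto
      then show "(-1) ^ card {z \<in> I. z < y} * pf_set ?B (I - {y}) =
        (-1) ^ card {z \<in> {z \<in> I. z < L}. z < y} * (-1) ^ (?r div 2)"
        using IH[of y] y by simp
    qed simp
    also have "(\<Sum>y\<in>{z \<in> I. L \<le> z}. (-1) ^ card {z \<in> I. z < y} * pf_set ?B (I - {y})) =
        (\<Sum>y\<in>{z \<in> I. L \<le> z}. (-1) ^ card {z \<in> {z \<in> I. L \<le> z}. z < y} * ((-1) ^ ?l * (-1) ^ ((?r - 1) div 2)))"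
    proof (rule sum.cong)
      fix y assume y: "y \<in> {z \<in> I. L \<le> z}"
      have "{z \<in> I - {y}. L \<le> z} = {z \<in> I. L \<le> z} - {y}" "{z \<in> I. L \<le> z \<and> z < y} = {z \<in> {z \<in> I. L \<le> z}. z < y}"
        "{z \<in> I. \<not> L \<le> z \<and> z < y} = {z \<in> I. z < L}"
        using y by auto
      then show "(-1) ^ card {z \<in> I. z < y} * pf_set ?B (I - {y}) =
        (-1) ^ card {z \<in> {z \<in> I. L \<le> z}. z < y} * ((-1) ^ ?l * (-1) ^ ((?r - 1) div 2))"
        using IH[of y] y fin card_split_less[OF insert.hyps(1), of y "\<lambda>z. L \<le> z"] by (simp add: power_add)
    qed simp
    also have "(\<Sum>y\<in>{z \<in> I. z < L}. (-1) ^ card {z \<in> {z \<in> I. z < L}. z < y} * (-1) ^ (?r div 2)) +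
      (\<Sum>y\<in>{z \<in> I. L \<le> z}. (-1) ^ card {z \<in> {z \<in> I. L \<le> z}. z < y} * ((-1) ^ ?l * (-1) ^ ((?r - 1) div 2))) =
      (if odd ?l then 1 else 0) * (-1) ^ (?r div 2) +
      (if odd ?r then 1 else 0) * ((-1) ^ ?l * (-1 :: complex) ^ ((?r - 1) div 2))"
      by (simp only: sum_distrib_right[symmetric] sum_alternating_rank fin)
    \<comment> \<open>Since \<open>?l + ?r\<close> is odd, exactly one summand survives. If it is
      the second, \<open>?l\<close> is even and \<open>(?r - 1) div 2 = ?r div 2\<close>.\<close>
    also have "\<dots> = (-1) ^ (?r div 2)"
      using par by (cases "odd ?r") (auto elim!: oddE)
    finally show ?thesis by (simp only: right)
  qed
qed simp

subsection \<open>The matrices \<open>\<Sigma>\<close> and \<open>\<Sigma>'\<close>\<close>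

definition skew_mat :: "nat \<Rightarrow> (nat \<Rightarrow> nat \<Rightarrow> complex) \<Rightarrow> complex mat" where
  "skew_mat n f = mat n n (\<lambda>(i, j). if i < j then f i j else if j < i then - f j i else 0)"

text \<open>The powers on the left half cancel the position signs of
  \<open>shuffle_sign_upto\<close>. On the right half those signs are \<open>(-1) ^ (L + i)\<close>,
  and the constant -1 makes them \<open>(-1) ^ Suc L * (-1) ^ i\<close>.\<close>

definition gauge_up :: "nat \<Rightarrow> nat \<Rightarrow> complex" where
  "gauge_up L m = (if m < L then (-1) ^ m else -1)"

text \<open>On the right half the down sites receive the same \<open>(-1) ^ i\<close> that is left
  over at the up sites. Together they give a product over all \<open>L\<close> sites, independent of
  the configuration.\<close>

definition gauge_down :: "nat \<Rightarrow> nat \<Rightarrow> complex" where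
  "gauge_down L m = (if m < L then 1 else (-1) ^ (m - L))"

text \<open>The leading -1 contributes \<open>(-1) ^ (card U div 2)\<close> for the set
  \<open>U\<close> of up indices and so cancels the last factor of \<open>shuffle_sign_upto\<close>.
  The unsimplified form matches the pattern of \<open>pf_set_gauge\<close>.\<close>

definition sigma_up :: "nat \<Rightarrow> nat \<Rightarrow> nat \<Rightarrow> complex" where
  "sigma_up L m n = -1 * gauge_up L m * gauge_up L n"

text \<open>The last factor yields the Pfaffian evaluated in \<open>pf_set_signs\<close>, a sign
  that depends only on the number of down spins on the right.\<close>

definition sigma_down :: "nat \<Rightarrow> nat \<Rightarrow> nat \<Rightarrow> complex" where
  "sigma_down L m n = 1 * gauge_down L m * gauge_down L n * (if L \<le> m then -1 else 1)"

text \<open>Both matrices carry the same \<open>c\<close> and \<open>e\<close>. A matching that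
  respects the up and down classes has \<open>L\<close> pairs and meets every index once, so the
  total factor is \<open>c ^ L * prod e {0..<2 * L}\<close> for every configuration.\<close>

definition Sigma_pair :: "nat \<Rightarrow> complex \<Rightarrow> (nat \<Rightarrow> complex) \<Rightarrow> complex mat \<times> complex mat" where
  "Sigma_pair L c e = (skew_mat (2 * L) (\<lambda>m n. c * e m * e n * sigma_up L m n),
     skew_mat (2 * L) (\<lambda>m n. c * e m * e n * sigma_down L m n))"

lemma pm_one_mult: "(a::complex) \<in> {1, -1} \<Longrightarrow> b \<in> {1, -1} \<Longrightarrow> a * b \<in> {1, -1}"
  by auto

lemma minus_one_power_pm: "(-1 :: complex) ^ k \<in> {1, -1}"
  by (cases "even k") auto

lemma sign_mat_skew_mat:
  assumes "\<And>i j. i < j \<Longrightarrow> j < n \<Longrightarrow> f i j \<in> {1, -1}"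
  shows "sign_mat n (skew_mat n f)"
proof -
  have "antisymmetric_mat (skew_mat n f)"
    by (auto simp: antisymmetric_mat_def skew_mat_def)
  moreover have "skew_mat n f $$ (i, j) \<in> {1, -1}" if "i < n" "j < n" "i \<noteq> j" for i j
    using that assms[of i j] assms[of j i] by (auto simp: skew_mat_def)
  ultimately show ?thesis
    by (simp add: sign_mat_def skew_mat_def)
qed

lemma sigma_pm: "sigma_up L m n \<in> {1, -1}" "sigma_down L m n \<in> {1, -1}"
proof -
  have up: "gauge_up L k \<in> {1, -1}" and down: "gauge_down L k \<in> {1, -1}" for k
    using minus_one_power_pm by (simp_all add: gauge_up_def gauge_down_def)
  show "sigma_up L m n \<in> {1, -1}" unfolding sigma_up_def
    by (intro pm_one_mult up) simp
  show "sigma_down L m n \<in> {1, -1}" unfolding sigma_down_def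
    by (intro pm_one_mult down) auto
qed

lemma sign_mat_Sigma_pair:
  assumes "c \<in> {1, -1}" "\<And>m. e m \<in> {1, -1}" "Sigma_pair L c e = (\<Sigma>, \<Sigma>')"
  shows "sign_mat (2 * L) \<Sigma>" "sign_mat (2 * L) \<Sigma>'"
proof -
  have "c * e i * e j * sigma_up L i j \<in> {1, -1}" "c * e i * e j * sigma_down L i j \<in> {1, -1}" for i j
    by (intro pm_one_mult assms sigma_pm)+
  then show "sign_mat (2 * L) \<Sigma>" "sign_mat (2 * L) \<Sigma>'"
    using assms(3) by (auto simp: Sigma_pair_def intro!: sign_mat_skew_mat)
qed

lemma pfaffian_Kz_eq_pf_set:
  assumes "Sigma_pair L c e = (\<Sigma>, \<Sigma>')" and "c ^ L * prod e {0..<2 * L} = 1"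
  defines "up \<equiv> \<lambda>S S' m. if m < L then S m else S' (m - L)"
  shows "pfaffian (Kz L \<Sigma> \<Sigma>' M S S') =
    pf_set (\<lambda>m n. if up S S' m \<and> up S S' n then sigma_up L m n * A_mat L M $$ (m, n)
      else if \<not> up S S' m \<and> \<not> up S S' n then sigma_down L m n else 0) {0..<2 * L}"
    (is "_ = pf_set ?k _")
proof -
  define f where "f m n = c * e m * e n * ?k m n" for m n
  define B where "B m n = (if m < n then f m n else if n < m then - f n m else 0)" for m n
  have "Kz_entry L \<Sigma> \<Sigma>' M S S' m n = f m n" if "m < n" "n < 2 * L" for m n
    using assms(1) that
    by (auto simp: Kz_entry_def sbar_def f_def up_def Sigma_pair_def skew_mat_def)
  then have "pfaffian (Kz L \<Sigma> \<Sigma>' M S S') = pf_set B {0..<2 * L}"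
    by (intro pfaffian_eq_pf_set) (auto simp: Kz_def B_def)
  also have "\<dots> = pf_set f {0..<2 * L}"
    by (rule pf_set_cong) (simp add: B_def)
  also have "\<dots> = pf_set ?k {0..<2 * L}"
    unfolding f_def by (subst pf_set_gauge) (use assms(2) in auto)
  finally show ?thesis .
qed

text \<open>The ranks are 0, ..., n - 1 with \<open>n = card U\<close>, and their sum
  \<open>n * (n - 1) div 2\<close> has the parity of \<open>n div 2\<close>.\<close>

lemma prod_minus_one_rank:
  assumes "finite (U :: nat set)"
  shows "(\<Prod>b\<in>U. (-1) ^ card {a \<in> U. a < b}) = (-1 :: complex) ^ (card U div 2)"
  using assms
proof (induction U rule: finite_linorder_max_induct)
  case (insert b A)
  have b: "b \<notin> A" "{a \<in> insert b A. a < b} = A" and A: "x \<in> A \<Longrightarrow> {a \<in> insert b A. a < x} = {a \<in> A. a < x}" for x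
    using insert.hyps by auto
  have "(\<Prod>x\<in>insert b A. (-1) ^ card {a \<in> insert b A. a < x}) = (-1) ^ card A * (-1 :: complex) ^ (card A div 2)"
    using insert.hyps(1) insert.IH b A by simp
  also have "\<dots> = (-1) ^ (card (insert b A) div 2)"
    using insert.hyps(1) b by (cases "even (card A)") (auto elim!: evenE oddE)
  finally show ?case .
qed simp

lemma prod_minus_one_upto: "(\<Prod>j<n. (-1) ^ j) = (-1 :: complex) ^ (n div 2)"
proof -
  have "{a \<in> {..<n}. a < j} = {..<j}" if "j < n" for j using that by auto
  then show ?thesis using prod_minus_one_rank[of "{..<n}"] by simp
qed

text \<open>In an initial segment \<open>b\<close> is the number of all indices below it. So the
  number of those outside \<open>U\<close> has the parity of \<open>b\<close> plus the rank of
  \<open>b\<close> in \<open>U\<close>, and the ranks multiply to the last factor.\<close>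

lemma shuffle_sign_upto:
  fixes U :: "nat \<Rightarrow> bool"
  shows "shuffle_sign U {0..<n} = (\<Prod>b\<in>{b \<in> {0..<n}. U b}. (-1) ^ b) * (-1) ^ (card {b \<in> {0..<n}. U b} div 2)"
proof -
  let ?U = "{b \<in> {0..<n}. U b}"
  have "shuffle_sign U {0..<n} = (\<Prod>b\<in>?U. (-1) ^ b * (-1) ^ card {a \<in> ?U. a < b})"
    unfolding shuffle_sign_def
  proof (rule prod.cong)
    fix b assume b: "b \<in> ?U"
    have "{z \<in> {0..<n}. z < b} = {0..<b}" using b by auto
    then have "b = card {a \<in> ?U. a < b} + card {a \<in> {0..<n}. \<not> U a \<and> a < b}"
      using card_split_less[of "{0..<n}" b U] by (simp add: conj_assoc)
    then have "(-1) ^ b = (-1 :: complex) ^ card {a \<in> ?U. a < b} * (-1) ^ card {a \<in> {0..<n}. \<not> U a \<and> a < b}"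
      by (subst (1) \<open>b = _\<close>) (rule power_add)
    then show "(-1) ^ card {a \<in> {0..<n}. \<not> U a \<and> a < b} = (-1 :: complex) ^ b * (-1) ^ card {a \<in> ?U. a < b}"
      by (simp add: power_mult_distrib[symmetric])
  qed simp
  also have "\<dots> = (\<Prod>b\<in>?U. (-1) ^ b) * (-1) ^ (card ?U div 2)"
    by (simp only: prod.distrib) (subst prod_minus_one_rank, auto)
  finally show ?thesis .
qed

text \<open>The gauge factors leave one sign, which depends on the number of up spins on the right.
  \<open>wick\<close> produces the same sign, because contracting two creation operators to the
  right of \<open>g\<close> gives minus an entry of \<open>Z\<close>.\<close>

lemma pfaffian_Kz:
  assumes "Sigma_pair L c e = (\<Sigma>, \<Sigma>')" and "c ^ L * prod e {0..<2 * L} = 1"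
  shows "pfaffian (Kz L \<Sigma> \<Sigma>' M S S') = (-1) ^ (card {i. i < L \<and> S' i} div 2) *
    pf_set (\<lambda>m n. A_mat L M $$ (m, n)) ({j. j < L \<and> S j} \<union> (+) L ` {i. i < L \<and> S' i})"
proof -
  define up where "up m = (if m < L then S m else S' (m - L))" for m
  define U where "U = {j. j < L \<and> S j} \<union> (+) L ` {i. i < L \<and> S' i}"
  define D where "D = {j. j < L \<and> \<not> S j} \<union> (+) L ` {i. i < L \<and> \<not> S' i}"
  let ?k = "\<lambda>m n. if up m \<and> up n then sigma_up L m n * A_mat L M $$ (m, n)
      else if \<not> up m \<and> \<not> up n then sigma_down L m n else 0"
  let ?A = "\<lambda>m n. A_mat L M $$ (m, n)"
  let ?p = "card {i. i < L \<and> S' i}" and ?r = "card {i. i < L \<and> \<not> S' i}"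
  have halves: "{0..<2 * L} = {..<L} \<union> (+) L ` {..<L}"
  proof -
    have "m \<in> (+) L ` {..<L}" if "L \<le> m" "m < 2 * L" for m
      using that by (intro image_eqI[of _ _ "m - L"]) auto
    then have "m < L \<or> m \<in> (+) L ` {..<L}" if "m < 2 * L" for m
      using that not_less by blast
    then have "{0..<2 * L} \<subseteq> {..<L} \<union> (+) L ` {..<L}"
      unfolding subset_iff atLeastLessThan_iff Un_iff lessThan_iff by blast
    then show ?thesis by (rule equalityI) auto
  qed
  have U: "{m \<in> {0..<2 * L}. up m} = U" and D: "{m \<in> {0..<2 * L}. \<not> up m} = D"
    unfolding halves by (auto simp: up_def U_def D_def)
  have fin: "finite U" "finite D" by (auto simp: U_def D_def)
  have UD: "U \<union> D = {0..<2 * L}" "U \<inter> D = {}"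
    unfolding U[symmetric] D[symmetric] by auto
  have "pfaffian (Kz L \<Sigma> \<Sigma>' M S S') = pf_set ?k {0..<2 * L}"
    using pfaffian_Kz_eq_pf_set[OF assms] by (simp only: up_def)
  also have "\<dots> = shuffle_sign up {0..<2 * L} * pf_set ?k U * pf_set ?k D"
    using pf_set_block[of "{0..<2 * L}" up ?k] by (simp only: U D) auto
  also have "pf_set ?k U = pf_set (\<lambda>m n. -1 * gauge_up L m * gauge_up L n * ?A m n) U"
    by (rule pf_set_cong) (auto simp: U[symmetric] sigma_up_def)
  also have "pf_set ?k D = pf_set (\<lambda>m n. 1 * gauge_down L m * gauge_down L n * (if L \<le> m then -1 else 1)) D"
    by (rule pf_set_cong) (auto simp: D[symmetric] sigma_down_def)
  finally have pf: "pfaffian (Kz L \<Sigma> \<Sigma>' M S S') = shuffle_sign up {0..<2 * L} *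
      ((-1) ^ (card U div 2) * prod (gauge_up L) U * pf_set ?A U) *
      (prod (gauge_down L) D * pf_set (\<lambda>m n. if L \<le> m then -1 else 1) D)"
    unfolding pf_set_gauge[OF fin(1)] pf_set_gauge[OF fin(2)] by (simp only: power_one mult_1)
  show ?thesis
  proof (cases "even (card U)")
    \<comment> \<open>Both sides vanish, so no signs have to be compared.\<close>
    case False
    then show ?thesis
      using pf fin pf_set_odd[of U] by (simp add: U_def[symmetric])
  next
    case True
    have "card U + card D = 2 * L"
      using card_Un_disjoint[of U D] fin UD by simp
    with True have "even (card D)" by presburger
    then have "pf_set (\<lambda>m n. if L \<le> m then -1 else 1) D = (-1) ^ (card {z \<in> D. L \<le> z} div 2)"
      using fin by (intro pf_set_signs)
    also have "{z \<in> D. L \<le> z} = (+) L ` {i. i < L \<and> \<not> S' i}"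
      by (auto simp: D_def)
    also have "card \<dots> = ?r" by (simp add: card_image)
    finally have signs: "pf_set (\<lambda>m n. if L \<le> m then -1 else 1) D = (-1) ^ (?r div 2)" .
    have split: "prod f U = prod f {j. j < L \<and> S j} * (\<Prod>i | i < L \<and> S' i. f (L + i))" for f :: "nat \<Rightarrow> complex"
      unfolding U_def by (subst prod.union_disjoint) (auto simp: prod.reindex)
    have "(\<Prod>b\<in>U. (-1) ^ b) * prod (gauge_up L) U = (\<Prod>b\<in>U. (-1) ^ b * gauge_up L b)"
      by (simp add: prod.distrib)
    also have "\<dots> = (\<Prod>i | i < L \<and> S' i. (-1) ^ Suc L * (-1) ^ i)"
      unfolding split by (simp add: gauge_up_def power_add power_mult_distrib[symmetric])
    also have "\<dots> = (-1) ^ (Suc L * ?p) * (\<Prod>i | i < L \<and> S' i. (-1) ^ i)"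
      by (simp only: prod.distrib prod_constant power_mult)
    finally have up_prod: "(\<Prod>b\<in>U. (-1) ^ b) * prod (gauge_up L) U =
      (-1) ^ (Suc L * ?p) * (\<Prod>i | i < L \<and> S' i. (-1) ^ i)" .
    have down_prod: "prod (gauge_down L) D = (\<Prod>i | i < L \<and> \<not> S' i. (-1) ^ i)"
      unfolding D_def by (subst prod.union_disjoint) (auto simp: prod.reindex gauge_down_def)
    have "(\<Prod>i | i < L \<and> S' i. (-1) ^ i) * (\<Prod>i | i < L \<and> \<not> S' i. (-1) ^ i) = (\<Prod>i<L. (-1 :: complex) ^ i)"
      by (subst prod.union_disjoint[symmetric]) (auto intro!: prod.cong)
    then have both: "(\<Prod>i | i < L \<and> S' i. (-1) ^ i) * (\<Prod>i | i < L \<and> \<not> S' i. (-1) ^ i) = (-1 :: complex) ^ (L div 2)"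
      by (simp only: prod_minus_one_upto)
    have "{i. i < L \<and> S' i} \<union> {i. i < L \<and> \<not> S' i} = {..<L}" by auto
    then have L: "L = ?p + ?r"
      using card_Un_disjoint[of "{i. i < L \<and> S' i}" "{i. i < L \<and> \<not> S' i}"] by (auto simp: disjoint_iff)
    \<comment> \<open>The exponents belong to the right half of \<open>gauge_up\<close>, the product
      over all sites, the Pfaffian of the down part and the sign in the claim. With
      \<open>L = p + r\<close> their sum is even.\<close>
    have parity: "even (Suc (p + r) * p + (p + r) div 2 + r div 2 + p div 2)" for p r :: nat
      by (cases "even p"; cases "even r"; elim evenE oddE; simp)
    have "(-1) ^ (Suc L * ?p + L div 2 + ?r div 2 + ?p div 2) = (1::complex)"
      using parity[of ?p ?r] unfolding L[symmetric] by simp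
    then have total: "(-1) ^ (Suc L * ?p) * (-1) ^ (L div 2) * (-1) ^ (?r div 2) = (-1 :: complex) ^ (?p div 2)"
      unfolding power_add by (cases "even (?p div 2)") (auto simp: minus_equation_iff)
    have "shuffle_sign up {0..<2 * L} * (-1) ^ (card U div 2) = (\<Prod>b\<in>U. (-1) ^ b)"
      unfolding shuffle_sign_upto U by (simp add: power_mult_distrib[symmetric])
    then have "pfaffian (Kz L \<Sigma> \<Sigma>' M S S') = ((\<Prod>b\<in>U. (-1) ^ b) * prod (gauge_up L) U) *
        prod (gauge_down L) D * (-1) ^ (?r div 2) * pf_set ?A U"
      unfolding pf signs by (simp add: mult_ac)
    also have "\<dots> = ((-1) ^ (Suc L * ?p) * ((\<Prod>i | i < L \<and> S' i. (-1) ^ i) * (\<Prod>i | i < L \<and> \<not> S' i. (-1) ^ i)) *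
        (-1) ^ (?r div 2)) * pf_set ?A U"
      unfolding up_prod down_prod by (simp only: mult_ac)
    also have "\<dots> = (-1) ^ (?p div 2) * pf_set ?A U"
      unfolding both total ..
    finally show ?thesis by (simp only: U_def)
  qed
qed

text \<open>Each gauge class of signs has a representative with \<open>e 0 = 1\<close>; the condition
  \<open>c ^ L * (\<Prod>m<2 * L. e m) = 1\<close> then determines the last sign.\<close>

definition gauge_signs :: "nat \<Rightarrow> complex \<Rightarrow> nat set \<Rightarrow> nat \<Rightarrow> complex" where
  "gauge_signs L c E m = (if m \<in> E then -1 else if m = 2 * L - 1 then c ^ L * (-1) ^ card E else 1)"

definition admissible_pairs :: "nat \<Rightarrow> (complex mat \<times> complex mat) set" where
  "admissible_pairs L = (\<lambda>(c, E). Sigma_pair L c (gauge_signs L c E)) ` ({1, -1} \<times> Pow {1..<2 * L - 1})"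

lemma gauge_signs_pm:
  assumes "c \<in> {1, -1}" shows "gauge_signs L c E m \<in> {1, -1}"
  using assms minus_one_power_pm[of L] minus_one_power_pm[of "card E"] minus_one_power_pm[of "L + card E"]
  by (auto simp: gauge_signs_def power_add)

lemma prod_gauge_signs:
  assumes "1 \<le> L" "c \<in> {1, -1}" "E \<subseteq> {1..<2 * L - 1}"
  shows "c ^ L * prod (gauge_signs L c E) {0..<2 * L} = 1"
proof -
  have "finite E" using assms(3) finite_subset by blast
  have "{0..<2 * L} = insert (2 * L - 1) {0..<2 * L - 1}" using assms(1) by auto
  then have "prod (gauge_signs L c E) {0..<2 * L} =
      c ^ L * (-1) ^ card E * prod (gauge_signs L c E) {0..<2 * L - 1}"
    using assms(3) by (auto simp: gauge_signs_def)
  also have "prod (gauge_signs L c E) {0..<2 * L - 1} = (\<Prod>m\<in>{0..<2 * L - 1}. if m \<in> E then -1 else 1)"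
    by (rule prod.cong) (auto simp: gauge_signs_def)
  also have "\<dots> = (\<Prod>m\<in>{m \<in> {0..<2 * L - 1}. m \<in> E}. -1)"
    by (rule prod.inter_filter[symmetric]) simp
  also have "{m \<in> {0..<2 * L - 1}. m \<in> E} = E" using assms(3) by auto
  also have "(\<Prod>m\<in>E. - 1 :: complex) = (-1) ^ card E" by simp
  finally have "c ^ L * prod (gauge_signs L c E) {0..<2 * L} = (c * c) ^ L * ((-1) * (-1)) ^ card E"
    by (simp only: power_mult_distrib mult_ac)
  also have "\<dots> = 1" using assms(2) by auto
  finally show ?thesis .
qed

lemma Sigma_pair_factor:
  assumes "Sigma_pair L c e = Sigma_pair L c' e'" "m < n" "n < 2 * L"
  shows "c * e m * e n = c' * e' m * e' n"
proof -
  have "fst (Sigma_pair L c e) $$ (m, n) = fst (Sigma_pair L c' e') $$ (m, n)"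
    using assms(1) by simp
  then have "c * e m * e n * sigma_up L m n = c' * e' m * e' n * sigma_up L m n"
    using assms(2,3) by (simp add: Sigma_pair_def skew_mat_def)
  then show ?thesis using sigma_pm(1)[of L m n] by auto
qed

lemma card_admissible_pairs:
  assumes "1 \<le> L"
  shows "card (admissible_pairs L) = (if L = 1 then 1 else 2 ^ (2 * L - 1))"
proof (cases "L = 1")
  case True
  have "Sigma_pair 1 c (gauge_signs 1 c {}) = Sigma_pair 1 1 (\<lambda>_. 1)" if "c \<in> {1, -1}" for c
    using that by (auto simp: Sigma_pair_def skew_mat_def gauge_signs_def intro!: eq_matI)
  then have "admissible_pairs 1 = {Sigma_pair 1 1 (\<lambda>_. 1)}"
    by (auto simp: admissible_pairs_def)
  then show ?thesis using True by simp
next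
  case False
  then have L: "2 \<le> L" using assms by simp
  have "inj_on (\<lambda>(c, E). Sigma_pair L c (gauge_signs L c E)) ({1, -1} \<times> Pow {1..<2 * L - 1})"
  proof (rule inj_onI, clarify)
    fix c c' :: complex and E E'
    assume c: "c \<in> {1, -1}" "c' \<in> {1, -1}" and E: "E \<subseteq> {1..<2 * L - 1}" "E' \<subseteq> {1..<2 * L - 1}"
      and eq: "Sigma_pair L c (gauge_signs L c E) = Sigma_pair L c' (gauge_signs L c' E')"
    define e where "e = gauge_signs L c E"
    define e' where "e' = gauge_signs L c' E'"
    have e0: "e 0 = 1" "e' 0 = 1" using E L by (auto simp: e_def e'_def gauge_signs_def)
    have pm: "e m \<in> {1, -1}" "e' m \<in> {1, -1}" for m
      unfolding e_def e'_def using c by (simp_all only: gauge_signs_pm)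
    note factor = Sigma_pair_factor[OF eq, folded e_def e'_def]
    \<comment> \<open>As \<open>L\<close> is at least 2, the indices 0, 1, 2 are available. The
      product of the three quantities is \<open>c ^ 3 * e 1 ^ 2 * e 2 ^ 2 = c\<close>, so they
      determine \<open>c\<close>; then the index pair (0, m) determines \<open>e m\<close>.\<close>
    have "c * e 1 = c' * e' 1" "c * e 2 = c' * e' 2" "c * e 1 * e 2 = c' * e' 1 * e' 2"
      using factor[of 0 1] factor[of 0 2] factor[of 1 2] L e0 by simp_all
    then have cc: "c = c'" using c pm[of 1] pm[of 2] by auto
    have "e m = e' m" if "0 < m" "m < 2 * L" for m
      using factor[of 0 m] that e0 c cc by auto
    moreover have "m \<in> E \<longleftrightarrow> e m = -1" "m \<in> E' \<longleftrightarrow> e' m = -1" if "m \<in> {1..<2 * L - 1}" for m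
      using that by (auto simp: e_def e'_def gauge_signs_def)
    ultimately have "m \<in> E \<longleftrightarrow> m \<in> E'" if "m \<in> {1..<2 * L - 1}" for m
      using that by auto
    then show "c = c' \<and> E = E'" using cc E by blast
  qed
  then have "card (admissible_pairs L) = card ({1, -1 :: complex} \<times> Pow {1..<2 * L - 1})"
    unfolding admissible_pairs_def by (rule card_image)
  also have "\<dots> = 2 * 2 ^ (2 * L - 2)"
    by (simp add: card_cartesian_product card_Pow numeral_2_eq_2)
  also have "\<dots> = 2 ^ (2 * L - 1)"
    using L by (simp add: power_Suc[symmetric] Suc_diff_le del: power_Suc)
  finally show ?thesis using False by simp
qed

subsection \<open>Operators on Fock space\<close>

text \<open>Linear operators on the Fock space with infinitely many modes. The canonical anticommutation
  relations hold there without any reference to \<open>L\<close>, and the operators form a ring type.\<close>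

typedef fop = "{f :: (nat \<Rightarrow> complex) \<Rightarrow> nat \<Rightarrow> complex.
    (\<forall>u v. f (\<lambda>i. u i + v i) = (\<lambda>i. f u i + f v i)) \<and> (\<forall>a u. f (\<lambda>i. a * u i) = (\<lambda>i. a * f u i))}"
  morphisms app Abs_fop
  by (rule exI[of _ "\<lambda>v. v"]) simp

setup_lifting type_definition_fop

instantiation fop :: ring_1
begin

lift_definition zero_fop :: fop is "\<lambda>v i. 0" by simp
lift_definition one_fop :: fop is "\<lambda>v. v" by simp
lift_definition plus_fop :: "fop \<Rightarrow> fop \<Rightarrow> fop" is "\<lambda>f g v i. f v i + g v i"
  by (simp add: algebra_simps)
lift_definition minus_fop :: "fop \<Rightarrow> fop \<Rightarrow> fop" is "\<lambda>f g v i. f v i - g v i"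
  by (simp add: algebra_simps)
lift_definition uminus_fop :: "fop \<Rightarrow> fop" is "\<lambda>f v i. - f v i"
  by simp
lift_definition times_fop :: "fop \<Rightarrow> fop \<Rightarrow> fop" is "\<lambda>f g v. f (g v)"
  by simp

instance
proof
  show "(0::fop) \<noteq> 1"
  proof transfer
    show "(\<lambda>v i. 0) \<noteq> (\<lambda>v::nat \<Rightarrow> complex. v)"
      by (metis zero_neq_one)
  qed
qed (transfer; simp add: algebra_simps)+

end

text \<open>Scalars enter as central ring elements, so linear combinations of operators are ordinary
  ring expressions.\<close>

lift_definition sc :: "complex \<Rightarrow> fop" is "\<lambda>a v i. a * v i"
  by (simp add: algebra_simps)

lemma fop_eqI: "(\<And>v i. app X v i = app Y v i) \<Longrightarrow> X = Y"
  by transfer blast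

lemma app_simps [simp]:
  "app 0 v i = 0" "app 1 v = v" "app (X + Y) v i = app X v i + app Y v i"
  "app (X - Y) v i = app X v i - app Y v i" "app (- X) v i = - app X v i"
  "app (X * Y) v = app X (app Y v)" "app (sc a) v i = a * v i"
  by (transfer; simp)+

lemma app_add_vec: "app X (\<lambda>i. u i + v i) i = app X u i + app X v i"
  by transfer simp

lemma app_scale_vec: "app X (\<lambda>i. a * v i) i = a * app X v i"
  by transfer simp

lemma app_zero_vec [simp]: "app X (\<lambda>i. 0) i = 0"
  using app_scale_vec[of X 0 "\<lambda>_. 0" i] by simp

lemma app_sum: "app (\<Sum>k\<in>A. X k) v i = (\<Sum>k\<in>A. app (X k) v i)"
  by (induction A rule: infinite_finite_induct) simp_all

lemma sc_simps [simp]: "sc 0 = 0" "sc 1 = 1" "sc (- 1) = - 1"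
  by (rule fop_eqI; simp)+

lemma sc_hom: "sc (a + b) = sc a + sc b" "sc (a * b) = sc a * sc b" "sc (- a) = - sc a"
  by (rule fop_eqI; simp add: algebra_simps)+

lemma sc_commute: "X * sc a = sc a * X"
proof (rule fop_eqI)
  fix v i
  have "app (sc a) v = (\<lambda>i. a * v i)" by auto
  then show "app (X * sc a) v i = app (sc a * X) v i"
    by (simp add: app_scale_vec)
qed

lemma sc_left_commute: "X * (sc a * Y) = sc a * (X * Y)"
  by (metis sc_commute mult.assoc)

lemma sc_sum: "sc (\<Sum>k\<in>A. f k) = (\<Sum>k\<in>A. sc (f k))"
  by (induction A rule: infinite_finite_induct) (simp_all add: sc_hom)

subsection \<open>Canonical anticommutation relations\<close>

text \<open>Written from the target side: the component at \<open>r\<close> reads the amplitude of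
  the state with bit \<open>l\<close> set. The string ignores bit \<open>l\<close>, so its sign may
  be taken at \<open>r\<close>.\<close>

lift_definition cc :: "nat \<Rightarrow> fop" is
  "\<lambda>l v r. if bit r l then 0 else jw_sign l r * v (set_bit l r)"
  by (auto simp: algebra_simps)

lift_definition cd :: "nat \<Rightarrow> fop" is
  "\<lambda>l v r. if bit r l then jw_sign l r * v (unset_bit l r) else 0"
  by (auto simp: algebra_simps)

lemma app_cc: "app (cc l) v r = (if bit r l then 0 else jw_sign l r * v (set_bit l r))"
  by transfer simp

lemma app_cd: "app (cd l) v r = (if bit r l then jw_sign l r * v (unset_bit l r) else 0)"
  by transfer simp

lemma jw_sign_square [simp]: "jw_sign l r * jw_sign l r = 1"
  by (simp add: jw_sign_def power_mult_distrib[symmetric])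

lemma jw_sign_bit_above:
  assumes "l \<le> m"
  shows "jw_sign l (set_bit m r) = jw_sign l r" "jw_sign l (unset_bit m r) = jw_sign l r"
proof -
  have "{j. j < l \<and> bit (set_bit m r) j} = {j. j < l \<and> bit r j}"
    "{j. j < l \<and> bit (unset_bit m r) j} = {j. j < l \<and> bit r j}"
    using assms by (auto simp: bit_set_bit_iff bit_unset_bit_iff)
  then show "jw_sign l (set_bit m r) = jw_sign l r" "jw_sign l (unset_bit m r) = jw_sign l r"
    by (simp_all add: jw_sign_def)
qed

lemma jw_sign_bit_below:
  assumes "m < l"
  shows "\<not> bit r m \<Longrightarrow> jw_sign l (set_bit m r) = - jw_sign l r"
    "bit r m \<Longrightarrow> jw_sign l (unset_bit m r) = - jw_sign l r"
proof -
  have *: "jw_sign l (set_bit m s) = - jw_sign l s" if "\<not> bit s m" for s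
  proof -
    have "{j. j < l \<and> bit (set_bit m s) j} = insert m {j. j < l \<and> bit s j}"
      using assms by (auto simp: bit_set_bit_iff)
    then show ?thesis using that by (simp add: jw_sign_def)
  qed
  show "\<not> bit r m \<Longrightarrow> jw_sign l (set_bit m r) = - jw_sign l r" by (rule *)
  assume "bit r m"
  then have "set_bit m (unset_bit m r) = r"
    by (intro bit_eqI) (auto simp: bit_set_bit_iff bit_unset_bit_iff)
  then show "jw_sign l (unset_bit m r) = - jw_sign l r"
    using *[of "unset_bit m r"] by (simp add: bit_unset_bit_iff)
qed

lemma set_unset_bit:
  "set_bit l (set_bit m r) = set_bit m (set_bit l r)"
  "unset_bit l (unset_bit m r) = unset_bit m (unset_bit l r)"
  "l \<noteq> m \<Longrightarrow> set_bit l (unset_bit m r) = unset_bit m (set_bit l r)"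
  "bit r l \<Longrightarrow> set_bit l (unset_bit l r) = r"
  "\<not> bit r l \<Longrightarrow> unset_bit l (set_bit l r) = r" for r :: nat
  by (intro bit_eqI; auto simp: bit_set_bit_iff bit_unset_bit_iff)+

text \<open>For different sites exactly one of the two strings crosses the site of the other
  operator, so the two orders differ by one sign.\<close>

lemma anticomm_cc: "cc l * cc m = - (cc m * cc l)"
proof (cases l m rule: linorder_cases)
  case equal
  then show ?thesis by (intro fop_eqI) (simp add: app_cc bit_set_bit_iff)
qed (intro fop_eqI; simp add: app_cc bit_set_bit_iff jw_sign_bit_above jw_sign_bit_below set_unset_bit(1))+

lemma anticomm_cd: "cd l * cd m = - (cd m * cd l)"
proof (cases l m rule: linorder_cases)
  case equal
  then show ?thesis by (intro fop_eqI) (simp add: app_cd bit_unset_bit_iff)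
qed (intro fop_eqI; simp add: app_cd bit_unset_bit_iff jw_sign_bit_above jw_sign_bit_below set_unset_bit(2))+

lemma cc_cd_same: "cc l * cd l = 1 - cd l * cc l"
  by (intro fop_eqI) (simp add: app_cc app_cd bit_set_bit_iff bit_unset_bit_iff jw_sign_bit_above
    set_unset_bit(4,5) mult.assoc[symmetric])

lemma cc_cd_diff: "l \<noteq> m \<Longrightarrow> cc l * cd m = - (cd m * cc l)"
  by (cases l m rule: linorder_cases; intro fop_eqI;
      simp add: app_cc app_cd bit_set_bit_iff bit_unset_bit_iff jw_sign_bit_above jw_sign_bit_below
        set_unset_bit(3))

lemma cc_cd: "cc l * cd m = (if l = m then 1 else 0) - cd m * cc l"
  by (simp add: cc_cd_same cc_cd_diff)

lemma anticomm_self: "cc l * cc l = 0" "cd l * cd l = 0"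
  by (intro fop_eqI; simp add: app_cc app_cd bit_set_bit_iff bit_unset_bit_iff)+

section \<open>The vacuum and vacuum expectation values\<close>

definition vac :: "nat \<Rightarrow> complex" where "vac i = (if i = 0 then 1 else 0)"

definition vev :: "fop \<Rightarrow> complex" where "vev X = app X vac 0"

lemma app_cc_vac [simp]: "app (cc l) vac = (\<lambda>i. 0)"
proof
  fix r
  have "set_bit l (r::nat) \<noteq> 0"
  proof
    assume "set_bit l (r::nat) = 0"
    moreover have "bit (set_bit l (r::nat)) l" by (simp add: bit_set_bit_iff)
    ultimately show False by simp
  qed
  then show "app (cc l) vac r = 0" by (simp add: app_cc vac_def)
qed

lemma app_cd_0 [simp]: "app (cd l) v 0 = 0"
  unfolding app_cd by (rule if_not_P) simp

lemma vev_simps: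
  "vev (X + Y) = vev X + vev Y" "vev (X - Y) = vev X - vev Y" "vev (sc a * X) = a * vev X"
  "vev (- X) = - vev X" "vev 0 = 0" "vev (cd l * X) = 0" "vev (X * cc l) = 0"
  "vev (sum f A) = (\<Sum>k\<in>A. vev (f k))"
  by (simp_all add: vev_def app_sum)

subsection \<open>Matrices as operators\<close>

text \<open>The Fock space of \<open>L\<close> modes is embedded as the functions supported below
  \<open>2 ^ L\<close>. Matrices act as zero outside it, so the identity matrix becomes this
  projection and not 1.\<close>

lift_definition proj :: "nat \<Rightarrow> fop" is "\<lambda>L v r. if r < 2 ^ L then v r else 0"
  by auto

lift_definition op_mat :: "nat \<Rightarrow> complex mat \<Rightarrow> fop" is
  "\<lambda>L A v r. if r < 2 ^ L then \<Sum>s<2 ^ L. A $$ (r, s) * v s else 0"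
  by (auto simp: algebra_simps sum.distrib sum_distrib_left)

lemma app_proj: "app (proj L) v r = (if r < 2 ^ L then v r else 0)"
  by transfer simp

lemma app_op_mat: "app (op_mat L A) v r = (if r < 2 ^ L then \<Sum>s<2 ^ L. A $$ (r, s) * v s else 0)"
  by (simp add: op_mat.rep_eq)

lemma less_pow2_iff: "r < 2 ^ L \<longleftrightarrow> (\<forall>n. bit r n \<longrightarrow> n < L)" for r :: nat
proof -
  have "r < 2 ^ L \<longleftrightarrow> take_bit L r = r" by (simp add: take_bit_nat_eq_self_iff)
  also have "\<dots> \<longleftrightarrow> (\<forall>n. bit r n \<longrightarrow> n < L)" by (auto simp: bit_eq_iff bit_take_bit_iff)
  finally show ?thesis .
qed

lemma set_bit_less_pow2: "l < L \<Longrightarrow> set_bit l r < 2 ^ L \<longleftrightarrow> r < 2 ^ L" for r :: nat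
  by (auto simp: less_pow2_iff bit_set_bit_iff)

lemma unset_bit_less_pow2: "l < L \<Longrightarrow> unset_bit l r < 2 ^ L \<longleftrightarrow> r < 2 ^ L" for r :: nat
  unfolding less_pow2_iff bit_unset_bit_iff by metis

lemma proj_cc: "l < L \<Longrightarrow> proj L * cc l = cc l * proj L"
  by (rule fop_eqI) (simp add: app_proj app_cc set_bit_less_pow2)

lemma proj_cd: "l < L \<Longrightarrow> proj L * cd l = cd l * proj L"
  by (rule fop_eqI) (simp add: app_proj app_cd unset_bit_less_pow2)

lemma proj_op_mat: "proj L * op_mat L A = op_mat L A" "op_mat L A * proj L = op_mat L A"
  by (rule fop_eqI; simp add: app_proj app_op_mat)+

lemma proj_proj: "proj L * proj L = proj L"
  by (rule fop_eqI) (simp add: app_proj)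

lemma app_proj_vac [simp]: "app (proj L) vac = vac"
  by (rule ext) (simp add: app_proj vac_def)

lemma op_mat_one: "op_mat L (1\<^sub>m (2 ^ L)) = proj L"
  by (rule fop_eqI) (simp add: app_proj app_op_mat sum.delta' if_distrib[of "\<lambda>x. x * _"] cong: if_cong)

lemma op_mat_times:
  assumes "A \<in> carrier_mat (2 ^ L) (2 ^ L)" "B \<in> carrier_mat (2 ^ L) (2 ^ L)"
  shows "op_mat L (A * B) = op_mat L A * op_mat L B"
proof (rule fop_eqI)
  fix v r
  have "(\<Sum>s<2 ^ L. (A * B) $$ (r, s) * v s) =
      (\<Sum>k<2 ^ L. A $$ (r, k) * (\<Sum>s<2 ^ L. B $$ (k, s) * v s))" if "r < 2 ^ L"
  proof -
    have "(\<Sum>s<2 ^ L. (A * B) $$ (r, s) * v s) = (\<Sum>s<2 ^ L. \<Sum>k<2 ^ L. A $$ (r, k) * B $$ (k, s) * v s)"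
      using that assms by (intro sum.cong refl)
        (auto simp: scalar_prod_def sum_distrib_right atLeast0LessThan)
    then show ?thesis
      by (subst (asm) sum.swap) (simp add: sum_distrib_left mult.assoc)
  qed
  then show "app (op_mat L (A * B)) v r = app (op_mat L A * op_mat L B) v r"
    by (simp add: app_op_mat)
qed

lemma op_mat_inject:
  assumes "A \<in> carrier_mat (2 ^ L) (2 ^ L)" "B \<in> carrier_mat (2 ^ L) (2 ^ L)" "op_mat L A = op_mat L B"
  shows "A = B"
proof (rule eq_matI)
  fix i j assume ij: "i < dim_row B" "j < dim_col B"
  have "app (op_mat L C) (\<lambda>s. if s = j then 1 else 0) i = C $$ (i, j)" for C
    using ij assms by (simp add: app_op_mat if_distrib[of "\<lambda>x. _ * x"] cong: if_cong)
  then show "A $$ (i, j) = B $$ (i, j)" using assms(3) by metis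
qed (use assms in auto)

lemma annihilate_carrier [simp]: "annihilate L l \<in> carrier_mat (2 ^ L) (2 ^ L)"
  by (simp add: annihilate_def)

lemma create_carrier [simp]: "create L l \<in> carrier_mat (2 ^ L) (2 ^ L)"
  by (simp add: create_def)

lemma op_mat_annihilate:
  assumes "l < L" shows "op_mat L (annihilate L l) = cc l * proj L"
proof (rule fop_eqI)
  fix v r
  have "(\<Sum>s<2 ^ L. annihilate L l $$ (r, s) * v s) = (if bit r l then 0 else jw_sign l r * v (set_bit l r))"
    if r: "r < 2 ^ L"
  proof -
    have "annihilate L l $$ (r, s) = (if s = set_bit l r then if bit r l then 0 else jw_sign l r else 0)"
      if s: "s < 2 ^ L" for s
    proof -
      have "bit s l \<and> r = unset_bit l s \<longleftrightarrow> \<not> bit r l \<and> s = set_bit l r"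
        using set_unset_bit(4)[of s l] set_unset_bit(5)[of r l]
        by (auto simp: bit_unset_bit_iff bit_set_bit_iff)
      then show ?thesis
        using r s jw_sign_bit_above(1)[of l l r] by (auto simp: annihilate_def)
    qed
    then have "(\<Sum>s<2 ^ L. annihilate L l $$ (r, s) * v s) =
        (\<Sum>s<2 ^ L. if s = set_bit l r then (if bit r l then 0 else jw_sign l r) * v s else 0)"
      by (intro sum.cong refl) simp
    then show ?thesis
      using r assms by (simp add: set_bit_less_pow2)
  qed
  then show "app (op_mat L (annihilate L l)) v r = app (cc l * proj L) v r"
    using assms by (simp add: app_op_mat app_cc app_proj set_bit_less_pow2)
qed

lemma op_mat_create:
  assumes "l < L" shows "op_mat L (create L l) = cd l * proj L"
proof (rule fop_eqI)
  fix v r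
  have "(\<Sum>s<2 ^ L. create L l $$ (r, s) * v s) = (if bit r l then jw_sign l r * v (unset_bit l r) else 0)"
    if r: "r < 2 ^ L"
  proof -
    have "create L l $$ (r, s) = (if s = unset_bit l r then if bit r l then jw_sign l r else 0 else 0)"
      if s: "s < 2 ^ L" for s
      using r s by (auto simp: create_def annihilate_def)
    then have "(\<Sum>s<2 ^ L. create L l $$ (r, s) * v s) =
        (\<Sum>s<2 ^ L. if s = unset_bit l r then (if bit r l then jw_sign l r else 0) * v s else 0)"
      by (intro sum.cong refl) simp
    then show ?thesis
      using r assms by (simp add: unset_bit_less_pow2)
  qed
  then show "app (op_mat L (create L l)) v r = app (cd l * proj L) v r"
    using assms by (simp add: app_op_mat app_cd app_proj unset_bit_less_pow2)
qed

section \<open>Basis states as products of mode operators\<close>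

definition vec_fun :: "nat \<Rightarrow> complex vec \<Rightarrow> nat \<Rightarrow> complex" where
  "vec_fun L v i = (if i < 2 ^ L then v $ i else 0)"

lemma vec_fun_mult:
  assumes "A \<in> carrier_mat (2 ^ L) (2 ^ L)" "v \<in> carrier_vec (2 ^ L)"
  shows "vec_fun L (A *\<^sub>v v) = app (op_mat L A) (vec_fun L v)"
proof
  fix i
  have "(A *\<^sub>v v) $ i = (\<Sum>s<2 ^ L. A $$ (i, s) * v $ s)" if "i < 2 ^ L"
  proof -
    have "(A *\<^sub>v v) $ i = row A i \<bullet> v"
      using that assms by (intro index_mult_mat_vec) auto
    also have "\<dots> = (\<Sum>s<2 ^ L. row A i $ s * v $ s)"
      unfolding scalar_prod_def atLeast0LessThan carrier_vecD[OF assms(2)] ..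
    also have "\<dots> = (\<Sum>s<2 ^ L. A $$ (i, s) * v $ s)"
      using that assms by (intro sum.cong) auto
    finally show ?thesis .
  qed
  then show "vec_fun L (A *\<^sub>v v) i = app (op_mat L A) (vec_fun L v) i"
    by (simp add: vec_fun_def app_op_mat)
qed

lemma app_proj_vec_fun [simp]: "app (proj L) (vec_fun L v) = vec_fun L v"
  by (rule ext) (simp add: app_proj vec_fun_def)

lemma vec_fun_vacuum: "vec_fun L (vacuum L) = vac"
  by (rule ext) (simp add: vec_fun_def vacuum_def vac_def)

text \<open>The list is reversed because the bra applies the operator of the smallest site first,
  which puts it rightmost in the product.\<close>

definition left_ops :: "nat list \<Rightarrow> fop" where
  "left_ops xs = prod_list (map cc (rev xs))"

definition right_ops :: "nat list \<Rightarrow> fop" where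
  "right_ops xs = prod_list (map cd xs)"

lemma ket_as_op:
  assumes "set xs \<subseteq> {..<L}"
  shows "foldr (\<lambda>l v. create L l *\<^sub>v v) xs (vacuum L) \<in> carrier_vec (2 ^ L)"
    and "vec_fun L (foldr (\<lambda>l v. create L l *\<^sub>v v) xs (vacuum L)) = app (right_ops xs) vac"
proof -
  have *: "foldr (\<lambda>l v. create L l *\<^sub>v v) xs (vacuum L) \<in> carrier_vec (2 ^ L)" for xs
  proof (induction xs)
    case (Cons l xs)
    then show ?case
      using mult_mat_vec_carrier[OF create_carrier[of L l] Cons.IH] by (simp only: foldr.simps o_apply)
  qed (simp add: vacuum_def)
  then show "foldr (\<lambda>l v. create L l *\<^sub>v v) xs (vacuum L) \<in> carrier_vec (2 ^ L)" .
  show "vec_fun L (foldr (\<lambda>l v. create L l *\<^sub>v v) xs (vacuum L)) = app (right_ops xs) vac"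
    using assms
  proof (induction xs)
    case (Cons l xs)
    then have "vec_fun L (create L l *\<^sub>v foldr (\<lambda>l v. create L l *\<^sub>v v) xs (vacuum L)) =
        app (cd l * proj L) (vec_fun L (foldr (\<lambda>l v. create L l *\<^sub>v v) xs (vacuum L)))"
      using * by (subst vec_fun_mult) (auto simp: op_mat_create)
    also have "\<dots> = app (cd l) (vec_fun L (foldr (\<lambda>l v. create L l *\<^sub>v v) xs (vacuum L)))"
      by (simp only: app_simps app_proj_vec_fun)
    finally show ?case using Cons by (simp add: right_ops_def)
  qed (simp add: vec_fun_vacuum right_ops_def)
qed

lemma bra_as_op:
  assumes "set xs \<subseteq> {..<L}" "w \<in> carrier_vec (2 ^ L)"
  shows "vacuum L \<bullet> fold (\<lambda>l w. annihilate L l *\<^sub>v w) xs w = app (left_ops xs) (vec_fun L w) 0"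
  using assms
proof (induction xs arbitrary: w)
  case Nil
  have "vacuum L \<bullet> w = w $ 0"
    unfolding vacuum_def by (rule scalar_prod_left_unit) (use Nil in auto)
  then show ?case
    by (simp add: left_ops_def vec_fun_def)
next
  case (Cons l xs)
  then have "vacuum L \<bullet> fold (\<lambda>l w. annihilate L l *\<^sub>v w) (l # xs) w =
      app (left_ops xs) (vec_fun L (annihilate L l *\<^sub>v w)) 0"
    using Cons.IH[OF _ mult_mat_vec_carrier[OF annihilate_carrier[of L l]], of w] by simp
  also have "vec_fun L (annihilate L l *\<^sub>v w) = app (cc l * proj L) (vec_fun L w)"
    using Cons.prems by (subst vec_fun_mult) (auto simp: op_mat_annihilate)
  also have "\<dots> = app (cc l) (vec_fun L w)"
    by (simp only: app_simps app_proj_vec_fun)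
  finally show ?case by (simp add: left_ops_def)
qed

lemma matrix_element_as_vev:
  assumes "G \<in> carrier_mat (2 ^ L) (2 ^ L)"
  shows "matrix_element L S G S' =
    vev (left_ops (up_sites L S) * op_mat L G * right_ops (up_sites L S'))"
proof -
  have up: "set (up_sites L S) \<subseteq> {..<L}" for S by (auto simp: up_sites_def)
  have ket: "ket L S' \<in> carrier_vec (2 ^ L)" "vec_fun L (ket L S') = app (right_ops (up_sites L S')) vac"
    unfolding ket_def by (rule ket_as_op(1)[OF up], rule ket_as_op(2)[OF up])
  have "matrix_element L S G S' = app (left_ops (up_sites L S)) (vec_fun L (G *\<^sub>v ket L S')) 0"
    unfolding matrix_element_def bra_def
    by (rule bra_as_op[OF up mult_mat_vec_carrier[OF assms ket(1)]])
  then show ?thesis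
    by (simp only: vec_fun_mult[OF assms ket(1)] ket(2) vev_def app_simps)
qed

subsection \<open>Wick's theorem\<close>

definition left_set :: "nat set \<Rightarrow> fop" where
  "left_set J = left_ops (sorted_list_of_set J)"

definition right_set :: "nat set \<Rightarrow> fop" where
  "right_set I = right_ops (sorted_list_of_set I)"

lemma sorted_list_of_set_insert_min:
  assumes "finite J" "\<forall>z\<in>J. b < (z::nat)"
  shows "sorted_list_of_set (insert b J) = b # sorted_list_of_set J"
proof -
  have "b \<notin> J" using assms by auto
  then have "sorted_list_of_set (insert b J) = insort b (sorted_list_of_set J)"
    using assms by simp
  also have "\<dots> = b # sorted_list_of_set J"
    using assms by (intro insort_is_Cons) (auto intro: less_imp_le)
  finally show ?thesis .
qed

lemma left_set_insert:
  "finite J \<Longrightarrow> \<forall>z\<in>J. b < z \<Longrightarrow> left_set (insert b J) = left_set J * cc b"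
  unfolding left_set_def left_ops_def by (subst sorted_list_of_set_insert_min) simp_all

lemma right_set_insert:
  "finite J \<Longrightarrow> \<forall>z\<in>J. b < z \<Longrightarrow> right_set (insert b J) = cd b * right_set J"
  unfolding right_set_def right_ops_def by (subst sorted_list_of_set_insert_min) simp_all

lemma left_right_set_empty [simp]: "left_set {} = 1" "right_set {} = 1"
  by (simp_all add: left_set_def right_set_def left_ops_def right_ops_def)

text \<open>The creation operator moves left, past the annihilation operators of smaller sites
  first, each costing a sign. It is contracted with its partner or reaches the left vacuum, which
  kills it.\<close>

lemma vev_left_set_cd:
  assumes "finite J"
  shows "vev (left_set J * cd k * Q) =
    (if k \<in> J then (-1) ^ card {z \<in> J. z < k} * vev (left_set (J - {k}) * Q) else 0)"
  using assms
proof (induction J arbitrary: Q rule: finite_linorder_min_induct)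
  case empty
  then show ?case by (simp add: vev_simps)
next
  case (insert b J)
  have b: "b \<notin> J" using insert.hyps by auto
  have "left_set (insert b J) * cd k * Q = left_set J * (cc b * cd k) * Q"
    using insert.hyps by (simp add: left_set_insert mult.assoc)
  also have "\<dots> = (if b = k then left_set J * Q else 0) - left_set J * cd k * (cc b * Q)"
    by (simp add: cc_cd algebra_simps)
  finally have *: "vev (left_set (insert b J) * cd k * Q) =
      (if b = k then vev (left_set J * Q) else 0) - vev (left_set J * cd k * (cc b * Q))"
    by (simp add: vev_simps)
  show ?case
  proof (cases "k = b")
    case True
    then have "{z \<in> insert b J. z < k} = {}" "insert b J - {k} = J"
      using insert.hyps by auto
    then show ?thesis
      unfolding * insert.IH using True b by (simp only: card.empty power_0) simp
  next
    case False
    have "left_set (insert b J - {k}) = left_set (J - {k}) * cc b"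
    proof -
      have "insert b J - {k} = insert b (J - {k})" using False by auto
      then show ?thesis using insert.hyps by (simp add: left_set_insert)
    qed
    moreover have "card {z \<in> insert b J. z < k} = Suc (card {z \<in> J. z < k})" if "k \<in> J"
    proof -
      have "{z \<in> insert b J. z < k} = insert b {z \<in> J. z < k}" using that insert.hyps by auto
      then show ?thesis using insert.hyps b by simp
    qed
    ultimately show ?thesis
      unfolding * insert.IH using False by (simp add: mult.assoc)
  qed
qed

text \<open>The mirror image of \<open>vev_left_set_cd\<close>: the annihilation operator moves
  right to its partner or to the vacuum.\<close>

lemma vev_cc_right_set:
  assumes "finite I"
  shows "vev (Q * cc k * right_set I) =
    (if k \<in> I then (-1) ^ card {z \<in> I. z < k} * vev (Q * right_set (I - {k})) else 0)"
  using assms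
proof (induction I arbitrary: Q rule: finite_linorder_min_induct)
  case empty
  then show ?case by (simp add: vev_simps)
next
  case (insert b I)
  have b: "b \<notin> I" using insert.hyps by auto
  have "Q * cc k * right_set (insert b I) = Q * (cc k * cd b) * right_set I"
    using insert.hyps by (simp add: right_set_insert mult.assoc)
  also have "\<dots> = (if b = k then Q * right_set I else 0) - Q * cd b * cc k * right_set I"
    by (simp add: cc_cd algebra_simps)
  finally have *: "vev (Q * cc k * right_set (insert b I)) =
      (if b = k then vev (Q * right_set I) else 0) - vev (Q * cd b * cc k * right_set I)"
    by (simp add: vev_simps)
  show ?case
  proof (cases "k = b")
    case True
    then have "{z \<in> insert b I. z < k} = {}" "insert b I - {k} = I"
      using insert.hyps by auto
    then show ?thesis
      unfolding * insert.IH using True b by (simp only: card.empty power_0) simp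
  next
    case False
    have "right_set (insert b I - {k}) = cd b * right_set (I - {k})"
    proof -
      have "insert b I - {k} = insert b (I - {k})" using False by auto
      then show ?thesis using insert.hyps by (simp add: right_set_insert)
    qed
    moreover have "card {z \<in> insert b I. z < k} = Suc (card {z \<in> I. z < k})" if "k \<in> I"
    proof -
      have "{z \<in> insert b I. z < k} = insert b {z \<in> I. z < k}" using that insert.hyps by auto
      then show ?thesis using insert.hyps b by simp
    qed
    ultimately show ?thesis
      unfolding * insert.IH using False by (simp add: mult.assoc)
  qed
qed

text \<open>Commuting the operator of the smallest index through \<open>g\<close> contracts it with each of the others,
  which is the expansion of the Pfaffian along its first row.\<close>

lemma wick:
  assumes cc_g: "\<And>i. i < L \<Longrightarrow> cc i * g =
      (\<Sum>j<L. sc (X i j) * (cd j * g)) + (\<Sum>j<L. sc (V i j) * (g * cc j))"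
    and g_cd: "\<And>i. i < L \<Longrightarrow> g * cd i =
      (\<Sum>j<L. sc (R i j) * (cd j * g)) - (\<Sum>j<L. sc (Z i j) * (g * cc j))"
    and A: "\<And>i j. i < L \<Longrightarrow> j < L \<Longrightarrow> A i j = X i j"
      "\<And>i j. i < L \<Longrightarrow> j < L \<Longrightarrow> A i (L + j) = V i j"
      "\<And>i j. i < L \<Longrightarrow> j < L \<Longrightarrow> A (L + i) (L + j) = Z i j"
    and "J \<subseteq> {..<L}" "I \<subseteq> {..<L}"
  shows "vev (left_set J * g * right_set I) =
    (-1) ^ (card I div 2) * vev g * pf_set A (J \<union> (+) L ` I)"
  using assms(6,7)
proof (induction "card J + card I" arbitrary: J I rule: less_induct)
  case less
  have fin: "finite J" "finite I"
    using less.prems finite_subset by blast+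
  show ?case
  proof (cases "J = {}")
    case False
    define j where "j = Min J"
    define J' where "J' = J - {j}"
    let ?U = "J' \<union> (+) L ` I"
    have j: "j \<in> J" "\<forall>z\<in>J'. j < z"
      using False fin less.prems by (auto simp: j_def J'_def order.strict_iff_order)
    have jL: "j < L"
      using j(1) less.prems by auto
    have J: "J = insert j J'" "j \<notin> J'" and fin': "finite J'" and J'L: "J' \<subseteq> {..<L}"
      using j fin less.prems by (auto simp: J'_def)
    have IH1: "vev (left_set (J' - {k}) * g * right_set I) =
        (-1) ^ (card I div 2) * vev g * pf_set A (?U - {k})" if "k \<in> J'" for k
    proof -
      have "(J' - {k}) \<union> (+) L ` I = ?U - {k}" using that J'L by auto
      then show ?thesis
        using less.hyps[of "J' - {k}" I] less.prems J fin' that J'L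
        by (simp add: card_Diff_singleton_if) (metis Diff_subset le_less_trans less_Suc_eq diff_le_self add_le_mono1 subset_trans)
    qed
    have IH2: "(-1) ^ card {z \<in> I. z < k} * vev (left_set J' * g * right_set (I - {k})) =
        (-1) ^ (card I div 2) * vev g * ((-1) ^ card {z \<in> ?U. z < L + k} * pf_set A (?U - {L + k}))"
      if k: "k \<in> I" for k
    proof -
      have U: "J' \<union> (+) L ` (I - {k}) = ?U - {L + k}" using k J'L by auto
      have "card (J' \<union> (+) L ` (I - {k})) = card J' + card (I - {k})"
        using J'L fin fin' by (subst card_Un_disjoint) (auto simp: card_image)
      then have cardU: "card (?U - {L + k}) = card J' + (card I - 1)"
        using fin k by (simp only: U) simp
      have pos: "0 < card I" using k fin by (auto simp: card_gt_0_iff)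
      have less: "card {z \<in> ?U. z < L + k} = card J' + card {z \<in> I. z < k}"
      proof -
        have "{z \<in> ?U. z < L + k} = J' \<union> (+) L ` {z \<in> I. z < k}"
          using J'L by (auto simp: image_iff)
        then show ?thesis
          using J'L fin fin' by (simp only:) (subst card_Un_disjoint, auto simp: card_image)
      qed
      have "card J' + card (I - {k}) < card J + card I"
        using J fin fin' k by (simp add: card_Diff1_less add_less_le_mono less_SucI)
      then have IH: "vev (left_set J' * g * right_set (I - {k})) =
          (-1) ^ ((card I - 1) div 2) * vev g * pf_set A (?U - {L + k})"
        using less.hyps[of J' "I - {k}"] less.prems J'L fin k unfolding U by auto
      show ?thesis
      \<comment> \<open>In the even case, replacing \<open>(card I - 1) div 2\<close> by
        \<open>card I div 2\<close> costs \<open>(-1) ^ card J'\<close>, which is the sign for the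
        left indices that precede \<open>L + k\<close>. In the odd case the remaining Pfaffian is
        zero.\<close>
      proof (cases "even (card J' + (card I - 1))")
        case True
        obtain n where "card I = Suc n" using pos gr0_conv_Suc by blast
        with True have "(-1) ^ ((card I - 1) div 2) = (-1 :: complex) ^ (card I div 2) * (-1) ^ card J'"
          by (cases "even n") (auto elim!: evenE oddE)
        then show ?thesis unfolding IH less by (simp add: power_add)
      next
        case False
        then have "pf_set A (?U - {L + k}) = 0"
          using fin fin' by (intro pf_set_odd) (auto simp only: cardU finite_Diff finite_Un finite_imageI)
        then show ?thesis unfolding IH by simp
      qed
    qed
    have "vev (left_set J * g * right_set I) = vev (left_set J' * (cc j * g) * right_set I)"
      unfolding J(1) left_set_insert[OF fin' j(2)] by (simp add: mult.assoc)
    also have "\<dots> = (\<Sum>k<L. X j k * vev (left_set J' * cd k * (g * right_set I))) +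
        (\<Sum>k<L. V j k * vev (left_set J' * g * cc k * right_set I))"
      unfolding cc_g[OF jL]
      by (simp add: distrib_left distrib_right sum_distrib_left sum_distrib_right mult.assoc
        sc_left_commute vev_simps)
    also have "(\<Sum>k<L. X j k * vev (left_set J' * cd k * (g * right_set I))) =
        (\<Sum>k\<in>J'. X j k * vev (left_set J' * cd k * (g * right_set I)))"
      using J'L by (intro sum.mono_neutral_right) (auto simp: vev_left_set_cd[OF fin'])
    also have "\<dots> = (\<Sum>k\<in>J'. (-1) ^ (card I div 2) * vev g *
        ((-1) ^ card {z \<in> ?U. z < k} * A j k * pf_set A (?U - {k})))"
    proof (rule sum.cong)
      fix k assume k: "k \<in> J'"
      have "{z \<in> ?U. z < k} = {z \<in> J'. z < k}" using k J'L by auto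
      then show "X j k * vev (left_set J' * cd k * (g * right_set I)) = (-1) ^ (card I div 2) * vev g *
          ((-1) ^ card {z \<in> ?U. z < k} * A j k * pf_set A (?U - {k}))"
        using vev_left_set_cd[OF fin', of k "g * right_set I"] IH1[OF k] k J'L j jL
        by (auto simp: A mult.assoc[symmetric])
    qed simp
    also have "(\<Sum>k<L. V j k * vev (left_set J' * g * cc k * right_set I)) =
        (\<Sum>k\<in>I. V j k * vev (left_set J' * g * cc k * right_set I))"
      using less.prems by (intro sum.mono_neutral_right) (auto simp: vev_cc_right_set[OF fin(2)])
    also have "\<dots> = (\<Sum>k\<in>I. (-1) ^ (card I div 2) * vev g *
        ((-1) ^ card {z \<in> ?U. z < L + k} * A j (L + k) * pf_set A (?U - {L + k})))"
    proof (rule sum.cong)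
      fix k assume k: "k \<in> I"
      then have "k < L" using less.prems by auto
      then show "V j k * vev (left_set J' * g * cc k * right_set I) = (-1) ^ (card I div 2) * vev g *
          ((-1) ^ card {z \<in> ?U. z < L + k} * A j (L + k) * pf_set A (?U - {L + k}))"
        using vev_cc_right_set[OF fin(2), of "left_set J' * g" k] IH2[OF k] k j jL
        by (simp add: A)
    qed simp
    also have "(\<Sum>k\<in>J'. (-1) ^ (card I div 2) * vev g *
        ((-1) ^ card {z \<in> ?U. z < k} * A j k * pf_set A (?U - {k}))) +
        (\<Sum>k\<in>I. (-1) ^ (card I div 2) * vev g *
        ((-1) ^ card {z \<in> ?U. z < L + k} * A j (L + k) * pf_set A (?U - {L + k}))) =
        (-1) ^ (card I div 2) * vev g *
        (\<Sum>y\<in>?U. (-1) ^ card {z \<in> ?U. z < y} * A j y * pf_set A (?U - {y}))"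
      using J'L fin fin'
      by (subst sum.union_disjoint) (auto simp: sum.reindex sum_distrib_left distrib_left)
    also have "\<dots> = (-1) ^ (card I div 2) * vev g * pf_set A (insert j ?U)"
      using fin fin' j jL by (subst pf_set_insert) auto
    finally show ?thesis unfolding J(1) by simp
  next
    case JE: True
    show ?thesis
    proof (cases "I = {}")
      case True
      then show ?thesis by (simp add: JE)
    next
      case False
      define i where "i = Min I"
      define I' where "I' = I - {i}"
      let ?U = "(+) L ` I'"
      have i: "i \<in> I" "\<forall>z\<in>I'. i < z"
        using False fin less.prems by (auto simp: i_def I'_def order.strict_iff_order)
      have iL: "i < L"
        using i(1) less.prems by auto
      have I: "I = insert i I'" "i \<notin> I'" and fin': "finite I'" and I'L: "I' \<subseteq> {..<L}"
        using i fin less.prems by (auto simp: I'_def)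
      \<comment> \<open>Removing two right operators lowers \<open>card I div 2\<close> by one; this
        absorbs the minus sign in front of \<open>Z\<close>.\<close>
      have IH: "- vev (g * right_set (I' - {k})) = (-1) ^ (card I div 2) * vev g * pf_set A (?U - {L + k})"
        if k: "k \<in> I'" for k
      proof -
        have "card I = Suc (Suc (card (I' - {k})))"
          using I fin' k card.remove[of I' k] by simp
        moreover have "(+) L ` (I' - {k}) = ?U - {L + k}" by auto
        moreover have "I' - {k} \<subseteq> {..<L}" using I'L by auto
        ultimately show ?thesis
          using less.hyps[of "{}" "I' - {k}"] by (simp add: JE)
      qed
      have "vev (left_set J * g * right_set I) = vev ((g * cd i) * right_set I')"
        unfolding I(1) right_set_insert[OF fin' i(2)] by (simp add: mult.assoc JE)
      \<comment> \<open>With no operators on the left, the terms that begin with a creation operator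
        vanish against the left vacuum.\<close>
      also have "\<dots> = - (\<Sum>k<L. Z i k * vev (g * cc k * right_set I'))"
        unfolding g_cd[OF iL]
        by (simp add: left_diff_distrib sum_distrib_right mult.assoc vev_simps)
      also have "(\<Sum>k<L. Z i k * vev (g * cc k * right_set I')) =
          (\<Sum>k\<in>I'. Z i k * vev (g * cc k * right_set I'))"
        using I'L by (intro sum.mono_neutral_right) (auto simp: vev_cc_right_set[OF fin'])
      also have "- \<dots> = (\<Sum>k\<in>I'. (-1) ^ (card I div 2) * vev g *
          ((-1) ^ card {z \<in> ?U. z < L + k} * A (L + i) (L + k) * pf_set A (?U - {L + k})))"
        unfolding sum_negf[symmetric]
      proof (rule sum.cong)
        fix k assume k: "k \<in> I'"
        have "{z \<in> ?U. z < L + k} = (+) L ` {z \<in> I'. z < k}" by auto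
        then have "card {z \<in> ?U. z < L + k} = card {z \<in> I'. z < k}" by (simp add: card_image)
        then have "- (Z i k * vev (g * cc k * right_set I')) =
            Z i k * ((-1) ^ card {z \<in> ?U. z < L + k} * (- vev (g * right_set (I' - {k}))))"
          using vev_cc_right_set[OF fin', of g k] k by simp
        also have "\<dots> = (-1) ^ (card I div 2) * vev g *
            ((-1) ^ card {z \<in> ?U. z < L + k} * A (L + i) (L + k) * pf_set A (?U - {L + k}))"
          unfolding IH[OF k] using k I'L iL by (auto simp: A)
        finally show "- (Z i k * vev (g * cc k * right_set I')) = (-1) ^ (card I div 2) * vev g *
            ((-1) ^ card {z \<in> ?U. z < L + k} * A (L + i) (L + k) * pf_set A (?U - {L + k}))" .
      qed simp
      also have "\<dots> = (-1) ^ (card I div 2) * vev g *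
          (\<Sum>y\<in>?U. (-1) ^ card {z \<in> ?U. z < y} * A (L + i) y * pf_set A (?U - {y}))"
        by (simp add: sum.reindex sum_distrib_left)
      also have "\<dots> = (-1) ^ (card I div 2) * vev g * pf_set A (insert (L + i) ?U)"
        using fin' i by (subst pf_set_insert) auto
      finally show ?thesis unfolding I(1) by (simp add: JE)
    qed
  qed
qed

subsection \<open>The matrix exponential\<close>

lemma mult_mat_entry:
  assumes "A \<in> carrier_mat n m" "B \<in> carrier_mat m p" "i < n" "j < p"
  shows "(A * B) $$ (i, j) = (\<Sum>k<m. A $$ (i, k) * B $$ (k, j))"
  using assms by (auto simp: scalar_prod_def atLeast0LessThan)

lemma pow_carrier [simp]: "A \<in> carrier_mat n n \<Longrightarrow> A ^\<^sub>m k \<in> carrier_mat n n"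
  by (rule pow_carrier_mat)

lemma pow_mat_Suc_left:
  assumes "A \<in> carrier_mat n n"
  shows "A ^\<^sub>m Suc k = A * A ^\<^sub>m k"
proof (induction k)
  case (Suc k)
  have "A ^\<^sub>m Suc (Suc k) = A * A ^\<^sub>m k * A"
    using Suc.IH by simp
  also have "\<dots> = A * (A ^\<^sub>m k * A)"
    using assms by (intro assoc_mult_mat[of _ n n _ n _ n]) auto
  finally show ?case by simp
qed (use assms in simp)

lemma pow_mat_bound:
  fixes A :: "complex mat" and c :: real
  assumes A: "A \<in> carrier_mat n n" and c: "\<And>i j. i < n \<Longrightarrow> j < n \<Longrightarrow> cmod (A $$ (i, j)) \<le> c"
    and "i < n" "j < n"
  shows "cmod ((A ^\<^sub>m k) $$ (i, j)) \<le> (n * c) ^ k"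
  using assms(3,4)
proof (induction k arbitrary: i j)
  case 0
  then show ?case using A by simp
next
  case (Suc k)
  have "(A ^\<^sub>m Suc k) $$ (i, j) = (\<Sum>l<n. (A ^\<^sub>m k) $$ (i, l) * A $$ (l, j))"
    using A Suc.prems by (simp only: pow_mat.simps) (rule mult_mat_entry, auto)
  also have "cmod \<dots> \<le> (\<Sum>l<n. (n * c) ^ k * c)"
  proof (rule sum_norm_le)
    fix l assume "l \<in> {..<n}"
    moreover have "0 \<le> c" using order_trans[OF norm_ge_zero c[OF Suc.prems]] .
    ultimately show "cmod ((A ^\<^sub>m k) $$ (i, l) * A $$ (l, j)) \<le> (n * c) ^ k * c"
      unfolding norm_mult using Suc by (intro mult_mono Suc.IH c) auto
  qed
  finally show ?case by (simp add: mult_ac)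
qed

text \<open>Absolute convergence, which Cauchy products require: the entries of the powers grow at
  most geometrically.\<close>

lemma summable_mat_exp:
  fixes A :: "complex mat"
  assumes A: "A \<in> carrier_mat n n" and "i < n" "j < n"
  shows "summable (\<lambda>k. norm ((A ^\<^sub>m k) $$ (i, j) / fact k))"
proof -
  define c where "c = Max ((\<lambda>(i, j). cmod (A $$ (i, j))) ` ({..<n} \<times> {..<n}))"
  have "cmod (A $$ (i, j)) \<le> c" if "i < n" "j < n" for i j
    unfolding c_def using that by (intro Max_ge) (auto intro!: image_eqI[of _ _ "(i, j)"])
  then have bound: "cmod ((A ^\<^sub>m k) $$ (i, j)) \<le> (n * c) ^ k" for k
    using assms by (intro pow_mat_bound) auto
  show ?thesis
  proof (rule summable_comparison_test')
    show "summable (\<lambda>k. inverse (fact k) * (n * c) ^ k)"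
      by (rule summable_exp)
    show "norm (norm ((A ^\<^sub>m k) $$ (i, j) / fact k)) \<le> inverse (fact k) * (n * c) ^ k" if "0 \<le> k" for k
      using bound[of k] by (simp add: norm_divide divide_simps)
  qed
qed

lemma mat_exp_carrier [simp]: "A \<in> carrier_mat n n \<Longrightarrow> mat_exp A \<in> carrier_mat n n"
  by (auto simp: mat_exp_def)

lemma mat_exp_sums:
  assumes "A \<in> carrier_mat n n" "i < n" "j < n"
  shows "(\<lambda>k. (A ^\<^sub>m k) $$ (i, j) / fact k) sums (mat_exp A $$ (i, j))"
proof -
  have "mat_exp A $$ (i, j) = (\<Sum>k. (A ^\<^sub>m k) $$ (i, j) / fact k)"
    using assms by (auto simp: mat_exp_def)
  then show ?thesis
    using summable_norm_cancel[OF summable_mat_exp[OF assms]] by (simp add: summable_sums)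
qed

text \<open>The sizes may differ, because conjugation combines the exponential of \<open>M\<close>
  on mode indices with an exponential on the Fock space.\<close>

lemma mat_exp_Cauchy:
  assumes "A \<in> carrier_mat n n" "i < n" "j < n" "B \<in> carrier_mat m m" "p < m" "q < m"
  shows "(\<lambda>k. \<Sum>l\<le>k. (A ^\<^sub>m l) $$ (i, j) / fact l * ((B ^\<^sub>m (k - l)) $$ (p, q) / fact (k - l)))
    sums (mat_exp A $$ (i, j) * mat_exp B $$ (p, q))"
  using Cauchy_product_sums[OF summable_mat_exp[OF assms(1-3)] summable_mat_exp[OF assms(4-6)]]
  by (simp only: sums_unique[OF mat_exp_sums[OF assms(1-3)], symmetric]
    sums_unique[OF mat_exp_sums[OF assms(4-6)], symmetric])

lemma pow_transpose_entry:
  fixes A :: "complex mat"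
  assumes A: "A \<in> carrier_mat n n" and "i < n" "j < n"
  shows "(transpose_mat A ^\<^sub>m k) $$ (i, j) = (A ^\<^sub>m k) $$ (j, i)"
proof -
  have "transpose_mat (A ^\<^sub>m k) = transpose_mat A ^\<^sub>m k" for k
  proof (induction k)
    case (Suc k)
    have "transpose_mat (A ^\<^sub>m Suc k) = transpose_mat (A * A ^\<^sub>m k)"
      by (simp only: pow_mat_Suc_left[OF A])
    also have "\<dots> = transpose_mat (A ^\<^sub>m k) * transpose_mat A"
      using A by (intro transpose_mult[of _ n n _ n]) auto
    finally show ?case by (simp add: Suc.IH)
  qed (use A in \<open>simp add: transpose_one\<close>)
  then show ?thesis
    using assms by (metis carrier_matD index_transpose_mat(1) pow_carrier)
qed

lemma mat_exp_transpose:
  assumes A: "A \<in> carrier_mat n n"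
  shows "mat_exp (transpose_mat A) = transpose_mat (mat_exp A)"
  using A by (intro eq_matI) (auto simp: mat_exp_def pow_transpose_entry)

text \<open>The relation passes to all powers and then to the series term by term. With
  \<open>K = Xi L\<close> it turns the antisymmetry of the generator into the orthogonality of its
  exponential.\<close>

lemma mat_exp_intertwine:
  assumes A: "A \<in> carrier_mat n n" and B: "B \<in> carrier_mat m m" and K: "K \<in> carrier_mat m n"
    and KA: "K * A = B * K"
  shows "K * mat_exp A = mat_exp B * K"
proof (rule eq_matI)
  have pow: "K * A ^\<^sub>m k = B ^\<^sub>m k * K" for k
  proof (induction k)
    case (Suc k)
    have "K * A ^\<^sub>m Suc k = K * A ^\<^sub>m k * A"
      using A K by (simp add: assoc_mult_mat[of K m n "A ^\<^sub>m k" n A n])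
    also have "\<dots> = B ^\<^sub>m k * (K * A)"
      unfolding Suc.IH using A K B by (intro assoc_mult_mat[of _ m m _ n _ n]) auto
    also have "\<dots> = B ^\<^sub>m Suc k * K"
      unfolding KA using B K by (simp add: assoc_mult_mat[of "B ^\<^sub>m k" m m B m K n])
    finally show ?case .
  qed (use A B K in auto)
  fix i j assume "i < dim_row (mat_exp B * K)" "j < dim_col (mat_exp B * K)"
  then have ij: "i < m" "j < n" using B K by (auto simp: mat_exp_def)
  have "(\<lambda>k. \<Sum>p<n. K $$ (i, p) * ((A ^\<^sub>m k) $$ (p, j) / fact k)) sums
      (\<Sum>p<n. K $$ (i, p) * mat_exp A $$ (p, j))"
    using A ij by (intro sums_sum sums_mult mat_exp_sums) auto
  moreover have "(\<lambda>k. \<Sum>p<m. (B ^\<^sub>m k) $$ (i, p) / fact k * K $$ (p, j)) sums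
      (\<Sum>p<m. mat_exp B $$ (i, p) * K $$ (p, j))"
    using B ij by (intro sums_sum sums_mult2 mat_exp_sums) auto
  moreover have "(\<Sum>p<n. K $$ (i, p) * ((A ^\<^sub>m k) $$ (p, j) / fact k)) =
      (\<Sum>p<m. (B ^\<^sub>m k) $$ (i, p) / fact k * K $$ (p, j))" for k
  proof -
    have "(\<Sum>p<n. K $$ (i, p) * ((A ^\<^sub>m k) $$ (p, j) / fact k)) = (K * A ^\<^sub>m k) $$ (i, j) / fact k"
      using A K ij by (subst mult_mat_entry[of _ m n _ n]) (auto simp: sum_divide_distrib)
    also have "\<dots> = (\<Sum>p<m. (B ^\<^sub>m k) $$ (i, p) / fact k * K $$ (p, j))"
      unfolding pow using B K ij by (subst mult_mat_entry[of _ m m _ n]) (auto simp: sum_divide_distrib)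
    finally show ?thesis .
  qed
  ultimately have "(\<Sum>p<n. K $$ (i, p) * mat_exp A $$ (p, j)) = (\<Sum>p<m. mat_exp B $$ (i, p) * K $$ (p, j))"
    by (simp add: sums_unique2)
  then show "(K * mat_exp A) $$ (i, j) = (mat_exp B * K) $$ (i, j)"
    using A B K ij by (simp only: mult_mat_entry[of K m n "mat_exp A" n] mult_mat_entry[of "mat_exp B" m m K n]
      mat_exp_carrier)
qed (use A B K in \<open>auto simp: mat_exp_def\<close>)

lemma uminus_pow_entry:
  fixes A :: "complex mat"
  assumes A: "A \<in> carrier_mat n n" and "i < n" "j < n"
  shows "((- A) ^\<^sub>m k) $$ (i, j) = (-1) ^ k * (A ^\<^sub>m k) $$ (i, j)"
  using assms(2,3)
proof (induction k arbitrary: i j)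
  case (Suc k)
  have "((- A) ^\<^sub>m Suc k) $$ (i, j) = (\<Sum>l<n. ((- A) ^\<^sub>m k) $$ (i, l) * (- A) $$ (l, j))"
    using A Suc.prems by (simp only: pow_mat.simps) (rule mult_mat_entry, auto)
  also have "\<dots> = (-1) ^ Suc k * (\<Sum>l<n. (A ^\<^sub>m k) $$ (i, l) * A $$ (l, j))"
    unfolding sum_distrib_left using carrier_matD[OF A] Suc by (intro sum.cong) auto
  also have "(\<Sum>l<n. (A ^\<^sub>m k) $$ (i, l) * A $$ (l, j)) = (A ^\<^sub>m Suc k) $$ (i, j)"
    using A Suc.prems by (simp only: pow_mat.simps) (rule mult_mat_entry[symmetric], auto)
  finally show ?case .
qed (use A in simp)

lemma pow_mat_add_entry:
  assumes A: "A \<in> carrier_mat n n" and ij: "i < n" "j < n"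
  shows "(A ^\<^sub>m (k + l)) $$ (i, j) = (\<Sum>p<n. (A ^\<^sub>m k) $$ (i, p) * (A ^\<^sub>m l) $$ (p, j))"
proof -
  have "A ^\<^sub>m (k + l) = A ^\<^sub>m k * A ^\<^sub>m l"
  proof (induction l)
    case (Suc l)
    then show ?case using A by (simp add: assoc_mult_mat[of "A ^\<^sub>m k" n n "A ^\<^sub>m l" n A n])
  qed (use A in simp)
  then show ?thesis using A ij mult_mat_entry[of "A ^\<^sub>m k" n n "A ^\<^sub>m l" n i j] by simp
qed

text \<open>The coefficient of degree \<open>k\<close> in the Cauchy product is
  \<open>A ^\<^sub>m k / fact k\<close> times an alternating sum of binomial coefficients, which
  vanishes for positive \<open>k\<close>.\<close>

lemma mat_exp_uminus:
  assumes A: "A \<in> carrier_mat n n"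
  shows "mat_exp (- A) * mat_exp A = 1\<^sub>m n"
proof (rule eq_matI)
  fix i j assume "i < dim_row (1\<^sub>m n)" "j < dim_col (1\<^sub>m n)"
  then have ij: "i < n" "j < n" by auto
  have "(\<lambda>k. \<Sum>p<n. \<Sum>l\<le>k. ((- A) ^\<^sub>m l) $$ (i, p) / fact l * ((A ^\<^sub>m (k - l)) $$ (p, j) / fact (k - l)))
      sums (\<Sum>p<n. mat_exp (- A) $$ (i, p) * mat_exp A $$ (p, j))"
    using A ij by (intro sums_sum mat_exp_Cauchy[of _ n]) auto
  moreover have "(\<Sum>p<n. \<Sum>l\<le>k. ((- A) ^\<^sub>m l) $$ (i, p) / fact l * ((A ^\<^sub>m (k - l)) $$ (p, j) / fact (k - l))) =
      (if k = 0 then (1\<^sub>m n) $$ (i, j) else 0)" for k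
  proof -
    have "(\<Sum>p<n. \<Sum>l\<le>k. ((- A) ^\<^sub>m l) $$ (i, p) / fact l * ((A ^\<^sub>m (k - l)) $$ (p, j) / fact (k - l))) =
        (\<Sum>l\<le>k. (-1) ^ l / (fact l * fact (k - l)) * (\<Sum>p<n. (A ^\<^sub>m l) $$ (i, p) * (A ^\<^sub>m (k - l)) $$ (p, j)))"
      unfolding sum_distrib_left
      by (subst sum.swap) (intro sum.cong refl, simp add: uminus_pow_entry[OF A] ij)
    also have "\<dots> = (\<Sum>l\<le>k. (-1) ^ l * of_nat (k choose l) * ((A ^\<^sub>m k) $$ (i, j) / fact k))"
    proof (rule sum.cong)
      fix l assume l: "l \<in> {..k}"
      then have "(\<Sum>p<n. (A ^\<^sub>m l) $$ (i, p) * (A ^\<^sub>m (k - l)) $$ (p, j)) = (A ^\<^sub>m k) $$ (i, j)"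
        using pow_mat_add_entry[OF A ij, of l "k - l"] by simp
      then show "(-1) ^ l / (fact l * fact (k - l)) * (\<Sum>p<n. (A ^\<^sub>m l) $$ (i, p) * (A ^\<^sub>m (k - l)) $$ (p, j)) =
          (-1) ^ l * of_nat (k choose l) * ((A ^\<^sub>m k) $$ (i, j) / fact k)"
        using l by (simp add: binomial_fact)
    qed simp
    also have "\<dots> = (if k = 0 then (1\<^sub>m n) $$ (i, j) else 0)"
    proof (cases "k = 0")
      case True
      then show ?thesis using A by simp
    next
      case False
      then show ?thesis
        using choose_alternating_sum[of k, where ?'a = complex]
        by (simp only: sum_distrib_right[symmetric] gr0_conv_Suc) (simp add: not0_implies_Suc)
    qed
    finally show ?thesis .
  qed
  ultimately have "(\<lambda>k. if k = 0 then (1\<^sub>m n) $$ (i, j) else 0) sums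
      (\<Sum>p<n. mat_exp (- A) $$ (i, p) * mat_exp A $$ (p, j))"
    by (simp only:)
  moreover have "(\<lambda>k. if k = 0 then (1\<^sub>m n) $$ (i, j) else 0) sums ((1\<^sub>m n) $$ (i, j) :: complex)"
    by (rule sums_single)
  ultimately have "(\<Sum>p<n. mat_exp (- A) $$ (i, p) * mat_exp A $$ (p, j)) = (1\<^sub>m n) $$ (i, j)"
    by (rule sums_unique2)
  moreover have "(mat_exp (- A) * mat_exp A) $$ (i, j) = (\<Sum>p<n. mat_exp (- A) $$ (i, p) * mat_exp A $$ (p, j))"
    using A ij by (intro mult_mat_entry[of _ n]) simp_all
  ultimately show "(mat_exp (- A) * mat_exp A) $$ (i, j) = (1\<^sub>m n) $$ (i, j)"
    by simp
qed (use A in \<open>auto simp: mat_exp_def\<close>)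

subsection \<open>Conjugation by an exponential\<close>

text \<open>The \<open>x k\<close> are iterated commutators with \<open>h\<close>, and commuting is
  a derivation. A sequence \<open>P\<close> replaces the powers of \<open>h\<close> because it is
  applied with \<open>P 0\<close> equal to the projection and not to 1.\<close>

lemma leibniz_power:
  fixes x P :: "nat \<Rightarrow> 'a::ring_1"
  assumes P: "\<And>n. P (Suc n) = h * P n" and x0: "\<And>k. x k * P 0 = P 0 * x k"
    and x: "\<And>k. x k * h = h * x k + x (Suc k)"
  shows "x j * P n = (\<Sum>k\<le>n. of_nat (n choose k) * P (n - k) * x (j + k))"
proof (induction n arbitrary: j)
  case 0
  then show ?case by (simp add: x0)
next
  case (Suc n)
  let ?f = "\<lambda>k. P (Suc n - k) * x (j + k)"
  have "x j * P (Suc n) = h * (x j * P n) + x (Suc j) * P n"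
    by (simp add: P mult.assoc[symmetric] x distrib_right)
  also have "h * (x j * P n) = (\<Sum>k\<le>n. of_nat (n choose k) * ?f k)"
  proof -
    have "h * (of_nat (n choose k) * P (n - k) * x (j + k)) = of_nat (n choose k) * ?f k" if "k \<le> n" for k
      using that P[of "n - k"] mult_of_nat_commute[of "n choose k" h]
      by (simp add: Suc_diff_le mult.assoc[symmetric])
    then show ?thesis by (simp add: Suc.IH sum_distrib_left)
  qed
  also have "\<dots> = (\<Sum>k\<le>Suc n. of_nat (n choose k) * ?f k)"
    by (simp add: binomial_eq_0)
  also have "\<dots> = ?f 0 + (\<Sum>k\<le>n. of_nat (n choose Suc k) * ?f (Suc k))"
    by (subst sum.atMost_Suc_shift) simp
  also have "x (Suc j) * P n = (\<Sum>k\<le>n. of_nat (n choose k) * ?f (Suc k))"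
    by (simp add: Suc.IH mult.assoc)
  also have "?f 0 + (\<Sum>k\<le>n. of_nat (n choose Suc k) * ?f (Suc k)) + (\<Sum>k\<le>n. of_nat (n choose k) * ?f (Suc k)) =
      ?f 0 + (\<Sum>k\<le>n. of_nat (Suc n choose Suc k) * ?f (Suc k))"
    by (simp add: sum.distrib[symmetric] distrib_right add_ac)
  also have "\<dots> = (\<Sum>k\<le>Suc n. of_nat (Suc n choose k) * P (Suc n - k) * x (j + k))"
    by (subst sum.atMost_Suc_shift) (simp add: mult.assoc)
  finally show ?case .
qed

lemma sc_of_nat: "sc (of_nat n) = of_nat n"
  by (induction n) (simp_all add: sc_hom)

lemma op_mat_lincomb:
  assumes "finite D"
  shows "op_mat L (mat (2 ^ L) (2 ^ L) (\<lambda>(r, s). \<Sum>d\<in>D. c d * Y d $$ (r, s))) = (\<Sum>d\<in>D. sc (c d) * op_mat L (Y d))"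
proof (rule fop_eqI)
  fix v r
  have "(\<Sum>s<2 ^ L. (\<Sum>d\<in>D. c d * Y d $$ (r, s)) * v s) = (\<Sum>d\<in>D. c d * (\<Sum>s<2 ^ L. Y d $$ (r, s) * v s))"
    unfolding sum_distrib_left sum_distrib_right by (subst sum.swap) (simp add: mult.assoc)
  then show "app (op_mat L (mat (2 ^ L) (2 ^ L) (\<lambda>(r, s). \<Sum>d\<in>D. c d * Y d $$ (r, s)))) v r =
      app (\<Sum>d\<in>D. sc (c d) * op_mat L (Y d)) v r"
    by (simp add: app_op_mat app_sum)
qed

text \<open>On the span of the \<open>B d\<close> the commutator with \<open>A\<close> acts as the
  matrix \<open>M\<close>, so the \<open>k\<close>-fold commutator has row \<open>a\<close> of
  \<open>M ^\<^sub>m k\<close> as coefficients. Divided by \<open>fact n\<close>, the Leibniz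
  formula is the Cauchy product of the two exponential series.\<close>

lemma mat_exp_conjugation:
  assumes A: "A \<in> carrier_mat (2 ^ L) (2 ^ L)" and M: "M \<in> carrier_mat m m"
    and B: "\<And>a. a < m \<Longrightarrow> B a \<in> carrier_mat (2 ^ L) (2 ^ L)"
    and comm: "\<And>a. a < m \<Longrightarrow> op_mat L (B a) * op_mat L A =
      op_mat L A * op_mat L (B a) + (\<Sum>d<m. sc (M $$ (a, d)) * op_mat L (B d))"
    and a: "a < m"
  shows "op_mat L (B a) * op_mat L (mat_exp A) =
    (\<Sum>d<m. sc (mat_exp M $$ (a, d)) * (op_mat L (mat_exp A) * op_mat L (B d)))"
proof -
  let ?N = "2 ^ L :: nat"
  let ?op = "op_mat L"
  define x where "x k = (\<Sum>d<m. sc ((M ^\<^sub>m k) $$ (a, d)) * ?op (B d))" for k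
  have x_0: "x 0 = ?op (B a)"
  proof -
    have "x 0 = (\<Sum>d<m. if d = a then ?op (B a) else 0)"
      unfolding x_def using M a by (intro sum.cong) auto
    then show ?thesis using a by simp
  qed
  have x_comm: "x k * ?op A = ?op A * x k + x (Suc k)" for k
  proof -
    have "x k * ?op A = (\<Sum>d<m. sc ((M ^\<^sub>m k) $$ (a, d)) * (?op A * ?op (B d) +
        (\<Sum>e<m. sc (M $$ (d, e)) * ?op (B e))))"
      by (simp add: x_def sum_distrib_right mult.assoc comm)
    also have "\<dots> = ?op A * x k + (\<Sum>d<m. \<Sum>e<m. sc ((M ^\<^sub>m k) $$ (a, d) * M $$ (d, e)) * ?op (B e))"
      by (simp add: x_def distrib_left sum.distrib sum_distrib_left sc_left_commute[where X="op_mat L A"] sc_hom mult.assoc)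
    also have "(\<Sum>d<m. \<Sum>e<m. sc ((M ^\<^sub>m k) $$ (a, d) * M $$ (d, e)) * ?op (B e)) =
        (\<Sum>e<m. sc (\<Sum>d<m. (M ^\<^sub>m k) $$ (a, d) * M $$ (d, e)) * ?op (B e))"
      by (subst sum.swap) (simp add: sc_sum sum_distrib_right)
    also have "\<dots> = x (Suc k)"
      unfolding x_def
    proof (rule sum.cong)
      fix e assume "e \<in> {..<m}"
      then have "(M ^\<^sub>m Suc k) $$ (a, e) = (\<Sum>d<m. (M ^\<^sub>m k) $$ (a, d) * M $$ (d, e))"
        using M a by (simp only: pow_mat.simps) (rule mult_mat_entry, auto)
      then show "sc (\<Sum>d<m. (M ^\<^sub>m k) $$ (a, d) * M $$ (d, e)) * ?op (B e) = sc ((M ^\<^sub>m Suc k) $$ (a, e)) * ?op (B e)"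
        by (simp only:)
    qed simp
    finally show ?thesis .
  qed
  have x_proj: "x k * proj L = proj L * x k" for k
    by (simp add: x_def sum_distrib_left sum_distrib_right mult.assoc proj_op_mat sc_left_commute[where X="proj L"])
  have op_pow: "?op (A ^\<^sub>m 0) = proj L" "?op (A ^\<^sub>m Suc k) = ?op A * ?op (A ^\<^sub>m k)" for k
    using A by (simp_all add: op_mat_one op_mat_times pow_mat_Suc_left del: pow_mat.simps(2))
  have "?op (B a) * ?op (A ^\<^sub>m n) = (\<Sum>k\<le>n. of_nat (n choose k) * ?op (A ^\<^sub>m (n - k)) * x k)" for n
    using leibniz_power[of "\<lambda>k. ?op (A ^\<^sub>m k)" "?op A" x 0 n] op_pow x_proj x_comm x_0 by simp
  \<comment> \<open>Both sides are expressed as images of matrices, so that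
    \<open>op_mat_inject\<close> gives an identity of entries; the series converge there.\<close>
  then have main: "?op (B a * A ^\<^sub>m n) = ?op (mat ?N ?N (\<lambda>(r, s). \<Sum>(k, d)\<in>{..n} \<times> {..<m}.
      (of_nat (n choose k) * (M ^\<^sub>m k) $$ (a, d)) * (A ^\<^sub>m (n - k) * B d) $$ (r, s)))" (is "_ = op_mat L (?R n)") for n
  proof -
    have "?op (?R n) = (\<Sum>(k, d)\<in>{..n} \<times> {..<m}. sc (of_nat (n choose k) * (M ^\<^sub>m k) $$ (a, d)) *
        ?op (A ^\<^sub>m (n - k) * B d))"
      using op_mat_lincomb[of "{..n} \<times> {..<m}" L
        "\<lambda>(k, d). of_nat (n choose k) * (M ^\<^sub>m k) $$ (a, d)" "\<lambda>(k, d). A ^\<^sub>m (n - k) * B d"]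
      by (simp add: case_prod_unfold)
    also have "\<dots> = (\<Sum>k\<le>n. \<Sum>d<m. of_nat (n choose k) * (sc ((M ^\<^sub>m k) $$ (a, d)) * (?op (A ^\<^sub>m (n - k)) * ?op (B d))))"
      using A B by (simp add: sum.cartesian_product[symmetric] sc_hom sc_of_nat op_mat_times mult.assoc)
    also have "\<dots> = (\<Sum>k\<le>n. of_nat (n choose k) * ?op (A ^\<^sub>m (n - k)) * x k)"
      by (simp add: x_def sum_distrib_left mult.assoc sc_left_commute[where X="op_mat L K" for K])
    also have "\<dots> = ?op (B a * A ^\<^sub>m n)"
      using A B a \<open>\<And>n. ?op (B a) * ?op (A ^\<^sub>m n) = _ n\<close> by (simp add: op_mat_times)
    finally show ?thesis ..
  qed
  have entry: "(B a * A ^\<^sub>m n) $$ (r, s) / fact n = (\<Sum>d<m. \<Sum>p<?N. (\<Sum>k\<le>n.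
      (M ^\<^sub>m k) $$ (a, d) / fact k * ((A ^\<^sub>m (n - k)) $$ (r, p) / fact (n - k))) * B d $$ (p, s))"
    if rs: "r < ?N" "s < ?N" for n r s
  proof -
    have "B a * A ^\<^sub>m n = ?R n"
      by (rule op_mat_inject[OF mult_carrier_mat[OF B[OF a] pow_carrier[OF A]] _ main]) simp
    then have "(B a * A ^\<^sub>m n) $$ (r, s) / fact n = (\<Sum>k\<le>n. \<Sum>d<m.
        of_nat (n choose k) * (M ^\<^sub>m k) $$ (a, d) * (A ^\<^sub>m (n - k) * B d) $$ (r, s) / fact n)"
      using rs by (simp add: sum.cartesian_product[symmetric] sum_divide_distrib)
    also have "\<dots> = (\<Sum>k\<le>n. \<Sum>d<m. \<Sum>p<?N.
        (M ^\<^sub>m k) $$ (a, d) / fact k * ((A ^\<^sub>m (n - k)) $$ (r, p) / fact (n - k)) * B d $$ (p, s))"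
    proof (intro sum.cong refl)
      fix k d assume kd: "k \<in> {..n}" "d \<in> {..<m}"
      then have "(A ^\<^sub>m (n - k) * B d) $$ (r, s) = (\<Sum>p<?N. (A ^\<^sub>m (n - k)) $$ (r, p) * B d $$ (p, s))"
        using A B rs by (intro mult_mat_entry[of _ ?N]) auto
      then show "of_nat (n choose k) * (M ^\<^sub>m k) $$ (a, d) * (A ^\<^sub>m (n - k) * B d) $$ (r, s) / fact n =
        (\<Sum>p<?N. (M ^\<^sub>m k) $$ (a, d) / fact k * ((A ^\<^sub>m (n - k)) $$ (r, p) / fact (n - k)) * B d $$ (p, s))"
        using kd by (simp add: binomial_fact sum_distrib_left sum_divide_distrib mult_ac)
    qed
    also have "\<dots> = (\<Sum>d<m. \<Sum>k\<le>n. \<Sum>p<?N.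
        (M ^\<^sub>m k) $$ (a, d) / fact k * ((A ^\<^sub>m (n - k)) $$ (r, p) / fact (n - k)) * B d $$ (p, s))"
      by (rule sum.swap)
    also have "\<dots> = (\<Sum>d<m. \<Sum>p<?N. \<Sum>k\<le>n.
        (M ^\<^sub>m k) $$ (a, d) / fact k * ((A ^\<^sub>m (n - k)) $$ (r, p) / fact (n - k)) * B d $$ (p, s))"
      by (intro sum.cong refl sum.swap)
    finally show ?thesis by (simp only: sum_distrib_right)
  qed
  have "B a * mat_exp A = mat ?N ?N (\<lambda>(r, s). \<Sum>d<m. mat_exp M $$ (a, d) * (mat_exp A * B d) $$ (r, s))"
    (is "_ = ?Q")
  proof (rule eq_matI)
    fix r s assume "r < dim_row ?Q" "s < dim_col ?Q"
    then have rs: "r < ?N" "s < ?N" by auto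
    have "(\<lambda>n. \<Sum>p<?N. B a $$ (r, p) * ((A ^\<^sub>m n) $$ (p, s) / fact n)) sums
        (\<Sum>p<?N. B a $$ (r, p) * mat_exp A $$ (p, s))"
      using A rs by (intro sums_sum sums_mult mat_exp_sums) auto
    moreover have "(\<lambda>n. \<Sum>d<m. \<Sum>p<?N. (\<Sum>k\<le>n. (M ^\<^sub>m k) $$ (a, d) / fact k *
        ((A ^\<^sub>m (n - k)) $$ (r, p) / fact (n - k))) * B d $$ (p, s)) sums
        (\<Sum>d<m. \<Sum>p<?N. (mat_exp M $$ (a, d) * mat_exp A $$ (r, p)) * B d $$ (p, s))"
      using A M a rs by (intro sums_sum sums_mult2 mat_exp_Cauchy[of M m]) auto
    moreover have "(\<Sum>p<?N. B a $$ (r, p) * ((A ^\<^sub>m n) $$ (p, s) / fact n)) = (\<Sum>d<m. \<Sum>p<?N. (\<Sum>k\<le>n.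
      (M ^\<^sub>m k) $$ (a, d) / fact k * ((A ^\<^sub>m (n - k)) $$ (r, p) / fact (n - k))) * B d $$ (p, s))" for n
      unfolding entry[OF rs, symmetric]
      using A B[OF a] rs by (subst mult_mat_entry[of _ ?N]) (auto simp: sum_divide_distrib)
    ultimately have "(\<Sum>p<?N. B a $$ (r, p) * mat_exp A $$ (p, s)) =
        (\<Sum>d<m. \<Sum>p<?N. (mat_exp M $$ (a, d) * mat_exp A $$ (r, p)) * B d $$ (p, s))"
      by (simp add: sums_unique2)
    moreover have "(B a * mat_exp A) $$ (r, s) = (\<Sum>p<?N. B a $$ (r, p) * mat_exp A $$ (p, s))"
      using A B[OF a] rs by (intro mult_mat_entry[of _ ?N]) auto
    moreover have "(mat_exp A * B d) $$ (r, s) = (\<Sum>p<?N. mat_exp A $$ (r, p) * B d $$ (p, s))" if "d < m" for d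
      using A B[OF that] rs by (intro mult_mat_entry[of _ ?N]) auto
    ultimately show "(B a * mat_exp A) $$ (r, s) = ?Q $$ (r, s)"
      using rs by (simp add: sum_distrib_left mult.assoc)
  qed (use A B[OF a] in \<open>auto simp: mat_exp_def\<close>)
  then have "?op (B a * mat_exp A) = (\<Sum>d<m. sc (mat_exp M $$ (a, d)) * ?op (mat_exp A * B d))"
    by (simp only: op_mat_lincomb[OF finite_lessThan])
  then show ?thesis
    using A B a by (simp add: op_mat_times)
qed

subsection \<open>Heisenberg evolution of the mode operators\<close>

text \<open>The permutation whose matrix is \<open>Xi\<close>: it exchanges the index of a mode
  operator with that of its adjoint.\<close>

definition mode_swap :: "nat \<Rightarrow> nat \<Rightarrow> nat" where
  "mode_swap L a = (if a < L then L + a else a - L)"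

definition psi :: "nat \<Rightarrow> nat \<Rightarrow> fop" where
  "psi L a = (if a < L then cc a else cd (a - L))"

lemma mode_swap_less: "a < 2 * L \<Longrightarrow> mode_swap L a < 2 * L"
  by (auto simp: mode_swap_def)

lemma mode_swap_swap [simp]: "a < 2 * L \<Longrightarrow> mode_swap L (mode_swap L a) = a"
  by (auto simp: mode_swap_def)

lemma sum_mode_swap: "(\<Sum>a<2 * L. f (mode_swap L a)) = (\<Sum>a<2 * L. f a)"
  by (rule sum.reindex_bij_witness[of _ "mode_swap L" "mode_swap L"]) (auto simp: mode_swap_less)

lemma psi_anticommute:
  assumes "a < 2 * L" "b < 2 * L"
  shows "psi L a * psi L b = (if a = mode_swap L b then 1 else 0) - psi L b * psi L a"
proof -
  consider "a < L" "b < L" | "a < L" "L \<le> b" | "L \<le> a" "b < L" | "L \<le> a" "L \<le> b"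
    by linarith
  then show ?thesis
  proof cases
    case 1
    then show ?thesis using anticomm_cc[of a b] by (simp add: psi_def mode_swap_def)
  next
    case 2
    then show ?thesis using cc_cd[of a "b - L"] by (auto simp: psi_def mode_swap_def)
  next
    case 3
    then show ?thesis using cc_cd[of b "a - L"] by (auto simp: psi_def mode_swap_def algebra_simps)
  next
    case 4
    then show ?thesis using assms anticomm_cd[of "a - L" "b - L"] by (simp add: psi_def mode_swap_def)
  qed
qed

lemma nambu_carrier: "nambu L a \<in> carrier_mat (2 ^ L) (2 ^ L)" "nambu_adj L a \<in> carrier_mat (2 ^ L) (2 ^ L)"
  by (simp_all add: nambu_def nambu_adj_def)

lemma psi_proj: "a < 2 * L \<Longrightarrow> proj L * psi L a = psi L a * proj L"
  by (simp add: psi_def proj_cc proj_cd)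

lemma op_mat_nambu:
  assumes "a < 2 * L"
  shows "op_mat L (nambu L a) = psi L a * proj L"
    "op_mat L (nambu_adj L a) = psi L (mode_swap L a) * proj L"
proof -
  have "a - L < L" if "\<not> a < L" using that assms by linarith
  then show "op_mat L (nambu L a) = psi L a * proj L"
    "op_mat L (nambu_adj L a) = psi L (mode_swap L a) * proj L"
    by (simp_all add: nambu_def nambu_adj_def psi_def mode_swap_def op_mat_annihilate op_mat_create)
qed

lemma op_mat_bilinear:
  assumes "\<And>a. a < n \<Longrightarrow> u a \<in> carrier_mat (2 ^ L) (2 ^ L)" "\<And>a. a < n \<Longrightarrow> v a \<in> carrier_mat (2 ^ L) (2 ^ L)"
  shows "op_mat L (c \<cdot>\<^sub>m bilinear_op L n u W v) =
    (\<Sum>a<n. \<Sum>b<n. sc (c * W $$ (a, b)) * (op_mat L (u a) * op_mat L (v b)))"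
proof -
  have "c \<cdot>\<^sub>m bilinear_op L n u W v = mat (2 ^ L) (2 ^ L)
      (\<lambda>(r, s). \<Sum>(a, b)\<in>{..<n} \<times> {..<n}. (c * W $$ (a, b)) * (u a * v b) $$ (r, s))"
    by (rule eq_matI) (simp_all add: bilinear_op_def sum.cartesian_product[symmetric] sum_distrib_left mult.assoc)
  then have "op_mat L (c \<cdot>\<^sub>m bilinear_op L n u W v) =
      (\<Sum>(a, b)\<in>{..<n} \<times> {..<n}. sc (c * W $$ (a, b)) * op_mat L (u a * v b))"
    using op_mat_lincomb[of "{..<n} \<times> {..<n}" L "\<lambda>(a, b). c * W $$ (a, b)" "\<lambda>(a, b). u a * v b"]
    by (simp add: case_prod_unfold)
  also have "\<dots> = (\<Sum>a<n. \<Sum>b<n. sc (c * W $$ (a, b)) * (op_mat L (u a) * op_mat L (v b)))"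
    unfolding sum.cartesian_product[symmetric] using assms by (intro sum.cong refl) (simp add: op_mat_times)
  finally show ?thesis .
qed

lemma Xi_carrier [simp]: "Xi L \<in> carrier_mat (2 * L) (2 * L)"
  unfolding Xi_def mult_2 by (intro four_block_carrier_mat) auto

lemma Xi_entry: "a < 2 * L \<Longrightarrow> b < 2 * L \<Longrightarrow> Xi L $$ (a, b) = (if a = mode_swap L b then 1 else 0)"
  by (auto simp: Xi_def mode_swap_def)

lemma Xi_mult_entry:
  assumes "M \<in> carrier_mat (2 * L) (2 * L)" "a < 2 * L" "b < 2 * L"
  shows "(Xi L * M) $$ (a, b) = M $$ (mode_swap L a, b)"
proof -
  have "(Xi L * M) $$ (a, b) = (\<Sum>k<2 * L. Xi L $$ (a, k) * M $$ (k, b))"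
    using assms by (intro mult_mat_entry[of _ "2 * L"]) auto
  also have "\<dots> = (\<Sum>k<2 * L. if k = mode_swap L a then M $$ (k, b) else 0)"
    using assms by (intro sum.cong refl) (auto simp: Xi_entry)
  also have "\<dots> = M $$ (mode_swap L a, b)"
    using assms mode_swap_less by simp
  finally show ?thesis .
qed

lemma add_transpose_entry:
  "X \<in> carrier_mat n n \<Longrightarrow> a < n \<Longrightarrow> b < n \<Longrightarrow>
    (X + transpose_mat X) $$ (a, b) = X $$ (a, b) + (X $$ (b, a) :: complex)"
  by simp

lemma sum_halves: "(\<Sum>d<2 * L. f d) = (\<Sum>j<L. f j) + (\<Sum>j<L. f (L + j) :: 'a::comm_monoid_add)" for L :: nat
proof -
  have "(\<Sum>d<L + m. f d) = (\<Sum>j<L. f j) + (\<Sum>j<m. f (L + j))" for m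
    by (induction m) (simp_all add: add.assoc)
  then show ?thesis by (simp add: mult_2)
qed

lemma mat_complement:
  assumes "P \<in> carrier_mat n n" "Q \<in> carrier_mat n n" "S \<in> carrier_mat n n"
    and "P + Q = 0\<^sub>m n n" "Q + S = (1\<^sub>m n :: complex mat)"
  shows "S - P = 1\<^sub>m n"
proof (rule eq_matI)
  fix i j assume "i < dim_row (1\<^sub>m n :: complex mat)" "j < dim_col (1\<^sub>m n :: complex mat)"
  then have ij: "i < n" "j < n" by auto
  then have "(P + Q) $$ (i, j) = 0" "(Q + S) $$ (i, j) = (1\<^sub>m n :: complex mat) $$ (i, j)"
    using assms(4,5) by simp_all
  then have "S $$ (i, j) - P $$ (i, j) = (1\<^sub>m n :: complex mat) $$ (i, j)"
    using assms(1-3) ij by (simp add: add_eq_0_iff)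
  then show "(S - P) $$ (i, j) = (1\<^sub>m n :: complex mat) $$ (i, j)"
    using assms(1-3) ij by simp
qed (use assms in auto)

text \<open>Multiply by the transpose of \<open>D\<close>. The first relation exchanges
  \<open>D\<close> and \<open>B\<close> up to a sign, \<open>D * R\<close> cancels, and the second
  relation makes the result 1. So the Schur complement inverts the transpose of
  \<open>D\<close>.\<close>

lemma schur_complement_orthogonal:
  fixes A B C D R :: "complex mat"
  assumes c: "A \<in> carrier_mat n n" "B \<in> carrier_mat n n" "C \<in> carrier_mat n n"
      "D \<in> carrier_mat n n" "R \<in> carrier_mat n n"
    and DR: "D * R = 1\<^sub>m n"
    and orth: "transpose_mat D * B + transpose_mat B * D = 0\<^sub>m n n"
      "transpose_mat B * C + transpose_mat D * A = 1\<^sub>m n"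
  shows "A - B * (R * C) = transpose_mat R"
proof -
  note ct = c[THEN transpose_carrier_mat[THEN iffD2]]
  have RC: "R * C \<in> carrier_mat n n" using c by simp
  have DB: "transpose_mat D * B \<in> carrier_mat n n" and BD: "transpose_mat B * D \<in> carrier_mat n n"
    using c ct by auto
  have BRC: "B * (R * C) \<in> carrier_mat n n" using c RC by simp
  have "transpose_mat D * B * (R * C) + transpose_mat B * C = 0\<^sub>m n n"
  proof -
    have "D * (R * C) = C"
      using assoc_mult_mat[OF c(4) c(5) c(3)] DR c by simp
    then have "transpose_mat B * C = transpose_mat B * D * (R * C)"
      using assoc_mult_mat[OF ct(2) c(4) RC] by simp
    then have "transpose_mat D * B * (R * C) + transpose_mat B * C =
        (transpose_mat D * B + transpose_mat B * D) * (R * C)"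
      using add_mult_distrib_mat[OF DB BD RC] by simp
    then show ?thesis unfolding orth(1) left_mult_zero_mat[OF RC] .
  qed
  then have "transpose_mat D * A - transpose_mat D * B * (R * C) = 1\<^sub>m n"
    by (rule mat_complement[OF mult_carrier_mat[OF DB RC] mult_carrier_mat[OF ct(2) c(3)]
      mult_carrier_mat[OF ct(4) c(1)] _ orth(2)])
  then have one: "transpose_mat D * (A - B * (R * C)) = 1\<^sub>m n"
    using mult_minus_distrib_mat[OF ct(4) c(1) BRC] assoc_mult_mat[OF ct(4) c(2) RC] by simp
  have tR: "transpose_mat R * transpose_mat D = 1\<^sub>m n"
    using transpose_mult[OF c(4,5)] DR by (simp add: transpose_one)
  have diff: "A - B * (R * C) \<in> carrier_mat n n"
    using minus_carrier_mat[OF BRC, of A] .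
  have "A - B * (R * C) = transpose_mat R * transpose_mat D * (A - B * (R * C))"
    unfolding tR left_mult_one_mat[OF diff] ..
  also have "\<dots> = transpose_mat R * (transpose_mat D * (A - B * (R * C)))"
    by (rule assoc_mult_mat[OF ct(5) ct(4) diff])
  also have "\<dots> = transpose_mat R"
    unfolding one using ct(5) by simp
  finally show ?thesis .
qed

section \<open>Conjugation of mode operators by the Gaussian operator\<close>

locale gaussian =
  fixes L :: nat and M :: "complex mat"
  assumes generator: "gaussian_generator L M"
begin

lemma M_carrier [simp]: "M \<in> carrier_mat (2 * L) (2 * L)"
  using generator by (simp add: gaussian_generator_def)

lemma M_antisym:
  assumes "a < 2 * L" "b < 2 * L"
  shows "M $$ (mode_swap L a, b) = - M $$ (mode_swap L b, a)"
proof -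
  have "(Xi L * M + transpose_mat (Xi L * M)) $$ (a, b) = 0"
    using generator assms by (simp add: gaussian_generator_def)
  then have "(Xi L * M) $$ (a, b) + (Xi L * M) $$ (b, a) = 0"
    using add_transpose_entry[OF mult_carrier_mat[OF Xi_carrier M_carrier] assms] by (simp only:)
  then show ?thesis
    using assms by (simp add: Xi_mult_entry eq_neg_iff_add_eq_0)
qed

definition H :: "complex mat" where
  "H = (1 / 2) \<cdot>\<^sub>m bilinear_op L (2 * L) (nambu_adj L) M (nambu L)"

lemma H_carrier [simp]: "H \<in> carrier_mat (2 ^ L) (2 ^ L)"
  by (simp add: H_def bilinear_op_def)

text \<open>\<open>H\<close> without the projection, so that its commutators can be computed with
  the plain anticommutation relations; \<open>op_mat_H\<close> restores the projection.\<close>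

definition h :: fop where
  "h = (\<Sum>a<2 * L. \<Sum>b<2 * L. sc (M $$ (a, b) / 2) * (psi L (mode_swap L a) * psi L b))"

lemma op_mat_H: "op_mat L H = h * proj L"
proof -
  have "op_mat L H = (\<Sum>a<2 * L. \<Sum>b<2 * L. sc (1 / 2 * M $$ (a, b)) *
      (op_mat L (nambu_adj L a) * op_mat L (nambu L b)))"
    unfolding H_def by (intro op_mat_bilinear nambu_carrier)
  also have "\<dots> = (\<Sum>a<2 * L. \<Sum>b<2 * L. sc (M $$ (a, b) / 2) *
      (psi L (mode_swap L a) * psi L b) * proj L)"
  proof (intro sum.cong refl)
    fix a b assume "a \<in> {..<2 * L}" "b \<in> {..<2 * L}"
    then have "op_mat L (nambu_adj L a) * op_mat L (nambu L b) =
        psi L (mode_swap L a) * (proj L * psi L b) * proj L"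
      by (simp add: op_mat_nambu mult.assoc)
    also have "\<dots> = psi L (mode_swap L a) * psi L b * proj L"
      using \<open>b \<in> _\<close> by (simp add: psi_proj mult.assoc proj_proj)
    finally show "sc (1 / 2 * M $$ (a, b)) * (op_mat L (nambu_adj L a) * op_mat L (nambu L b)) =
        sc (M $$ (a, b) / 2) * (psi L (mode_swap L a) * psi L b) * proj L"
      by (simp add: mult.assoc)
  qed
  finally show ?thesis by (simp add: h_def sum_distrib_right)
qed

text \<open>Moving \<open>psi L c\<close> through a quadratic term leaves two linear contractions.
  By the antisymmetry of \<open>Xi L * M\<close> they contribute equally to the commutator, which
  cancels the factor 1/2.\<close>

lemma psi_h:
  assumes c: "c < 2 * L"
  shows "psi L c * h = h * psi L c + (\<Sum>d<2 * L. sc (M $$ (c, d)) * psi L d)"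
proof -
  have "psi L (mode_swap L a) * psi L b * psi L c =
      (if b = mode_swap L c then psi L (mode_swap L a) else 0) - (if a = c then psi L b else 0) +
      psi L c * (psi L (mode_swap L a) * psi L b)"
    if ab: "a < 2 * L" "b < 2 * L" for a b
  proof -
    have "mode_swap L a = mode_swap L c \<longleftrightarrow> a = c"
      using ab c by (metis mode_swap_swap)
    then have 1: "psi L (mode_swap L a) * psi L c = (if a = c then 1 else 0) - psi L c * psi L (mode_swap L a)"
      using psi_anticommute[of "mode_swap L a" L c] ab c by (simp add: mode_swap_less)
    have "psi L (mode_swap L a) * psi L b * psi L c = psi L (mode_swap L a) * (psi L b * psi L c)"
      by (simp add: mult.assoc)
    also have "\<dots> = (if b = mode_swap L c then psi L (mode_swap L a) else 0) - psi L (mode_swap L a) * psi L c * psi L b"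
      by (simp add: psi_anticommute[OF ab(2) c] right_diff_distrib mult.assoc)
    also have "psi L (mode_swap L a) * psi L c * psi L b = (if a = c then psi L b else 0) - psi L c * (psi L (mode_swap L a) * psi L b)"
      by (simp add: 1 left_diff_distrib mult.assoc)
    finally show ?thesis by (simp add: algebra_simps)
  qed
  then have "h * psi L c = (\<Sum>a<2 * L. \<Sum>b<2 * L. sc (M $$ (a, b) / 2) *
      ((if b = mode_swap L c then psi L (mode_swap L a) else 0) - (if a = c then psi L b else 0) +
      psi L c * (psi L (mode_swap L a) * psi L b)))"
    by (simp add: h_def sum_distrib_right mult.assoc)
  also have "\<dots> = (\<Sum>a<2 * L. \<Sum>b<2 * L. if b = mode_swap L c then sc (M $$ (a, b) / 2) * psi L (mode_swap L a) else 0) -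
      (\<Sum>a<2 * L. \<Sum>b<2 * L. if a = c then sc (M $$ (a, b) / 2) * psi L b else 0) +
      (\<Sum>a<2 * L. \<Sum>b<2 * L. sc (M $$ (a, b) / 2) * (psi L c * (psi L (mode_swap L a) * psi L b)))"
    by (simp add: distrib_left right_diff_distrib sum.distrib sum_subtractf if_distrib[of "\<lambda>x. _ * x"] cong: if_cong)
  also have "(\<Sum>a<2 * L. \<Sum>b<2 * L. if b = mode_swap L c then sc (M $$ (a, b) / 2) * psi L (mode_swap L a) else 0) =
      (\<Sum>a<2 * L. sc (M $$ (a, mode_swap L c) / 2) * psi L (mode_swap L a))"
    using c mode_swap_less by simp
  also have "\<dots> = (\<Sum>a<2 * L. sc (M $$ (mode_swap L (mode_swap L a), mode_swap L c) / 2) * psi L (mode_swap L a))"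
    by (intro sum.cong refl) simp
  also have "\<dots> = (\<Sum>a<2 * L. sc (M $$ (mode_swap L a, mode_swap L c) / 2) * psi L a)"
    by (rule sum_mode_swap)
  also have "\<dots> = - (\<Sum>a<2 * L. sc (M $$ (c, a) / 2) * psi L a)"
    unfolding sum_negf[symmetric]
  proof (intro sum.cong refl)
    fix a assume "a \<in> {..<2 * L}"
    then show "sc (M $$ (mode_swap L a, mode_swap L c) / 2) * psi L a = - (sc (M $$ (c, a) / 2) * psi L a)"
      using M_antisym[of a "mode_swap L c"] c by (simp add: mode_swap_less sc_hom)
  qed
  also have "(\<Sum>a<2 * L. \<Sum>b<2 * L. if a = c then sc (M $$ (a, b) / 2) * psi L b else 0) =
      (\<Sum>b<2 * L. sc (M $$ (c, b) / 2) * psi L b)"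
    using c by (subst sum.swap) simp
  also have "(\<Sum>a<2 * L. \<Sum>b<2 * L. sc (M $$ (a, b) / 2) * (psi L c * (psi L (mode_swap L a) * psi L b))) = psi L c * h"
    by (simp add: h_def sum_distrib_left sc_left_commute[where X="psi L c"])
  finally have "h * psi L c = psi L c * h - (\<Sum>b<2 * L. sc (M $$ (c, b) / 2) * psi L b + sc (M $$ (c, b) / 2) * psi L b)"
    by (simp add: sum.distrib algebra_simps)
  also have "(\<Sum>b<2 * L. sc (M $$ (c, b) / 2) * psi L b + sc (M $$ (c, b) / 2) * psi L b) =
      (\<Sum>b<2 * L. sc (M $$ (c, b)) * psi L b)"
    by (intro sum.cong refl) (simp only: distrib_right[symmetric] sc_hom(1)[symmetric], simp)
  finally show ?thesis by (simp add: algebra_simps)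
qed

lemma h_proj: "proj L * h = h * proj L"
proof -
  have "proj L * (psi L (mode_swap L a) * psi L b) = psi L (mode_swap L a) * psi L b * proj L"
    if "a < 2 * L" "b < 2 * L" for a b
  proof -
    have "proj L * (psi L (mode_swap L a) * psi L b) = (proj L * psi L (mode_swap L a)) * psi L b"
      by (simp add: mult.assoc)
    also have "\<dots> = psi L (mode_swap L a) * (proj L * psi L b)"
      using that by (simp add: psi_proj mode_swap_less mult.assoc)
    finally show ?thesis using that by (simp add: psi_proj mult.assoc)
  qed
  then show ?thesis
    by (simp add: h_def sum_distrib_left sum_distrib_right sc_left_commute[where X="proj L"] mult.assoc)
qed

definition G :: fop where "G = op_mat L (gaussian_op L M)"

abbreviation T :: "complex mat" where "T \<equiv> mat_exp M"

lemma gaussian_op_H: "gaussian_op L M = mat_exp H"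
  by (simp add: gaussian_op_def H_def)

lemma psi_G:
  assumes c: "c < 2 * L"
  shows "psi L c * G = (\<Sum>d<2 * L. sc (T $$ (c, d)) * (G * psi L d))"
proof -
  have "op_mat L (nambu L a) * op_mat L H =
      op_mat L H * op_mat L (nambu L a) + (\<Sum>d<2 * L. sc (M $$ (a, d)) * op_mat L (nambu L d))"
    if a: "a < 2 * L" for a
  proof -
    have "op_mat L (nambu L a) * op_mat L H = psi L a * (proj L * h) * proj L"
      using a by (simp add: op_mat_nambu op_mat_H mult.assoc)
    also have "\<dots> = (psi L a * h) * proj L"
      by (simp add: h_proj mult.assoc proj_proj)
    also have "\<dots> = h * (psi L a * proj L) + (\<Sum>d<2 * L. sc (M $$ (a, d)) * (psi L d * proj L))"
      by (simp add: psi_h[OF a] distrib_right sum_distrib_right mult.assoc)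
    also have "psi L a * proj L = proj L * psi L a * proj L"
      using a by (simp add: psi_proj mult.assoc proj_proj)
    finally show ?thesis
      using a by (simp add: op_mat_nambu op_mat_H mult.assoc)
  qed
  then have "op_mat L (nambu L c) * op_mat L (mat_exp H) =
      (\<Sum>d<2 * L. sc (mat_exp M $$ (c, d)) * (op_mat L (mat_exp H) * op_mat L (nambu L d)))"
    using c by (intro mat_exp_conjugation[of H L M "2 * L" "nambu L"]) (auto simp: nambu_carrier)
  moreover have "op_mat L (nambu L c) * G = psi L c * G"
    using c by (simp add: op_mat_nambu G_def mult.assoc proj_op_mat)
  moreover have "G * op_mat L (nambu L d) = G * psi L d" if "d < 2 * L" for d
  proof -
    have "G * op_mat L (nambu L d) = (G * proj L) * psi L d"
      using that by (simp add: op_mat_nambu psi_proj[symmetric] mult.assoc)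
    then show ?thesis by (simp only: G_def proj_op_mat)
  qed
  ultimately show ?thesis
    by (simp add: G_def gaussian_op_H)
qed

lemma T_carrier [simp]: "T \<in> carrier_mat (2 * L) (2 * L)"
  by simp

text \<open>The condition on \<open>M\<close> says that \<open>Xi\<close> intertwines
  \<open>- M\<close> with the transpose of \<open>M\<close>. Exponentiating this and multiplying by
  \<open>T\<close> from the right shows that \<open>T\<close> preserves the bilinear form
  \<open>Xi\<close>.\<close>

lemma T_orthogonal:
  assumes "a < 2 * L" "b < 2 * L"
  shows "(\<Sum>k<2 * L. T $$ (k, a) * T $$ (mode_swap L k, b)) = (if a = mode_swap L b then 1 else 0)"
proof -
  let ?n = "2 * L"
  have "Xi L * (- M) = transpose_mat M * Xi L"
  proof (rule eq_matI)
    fix i j assume "i < dim_row (transpose_mat M * Xi L)" "j < dim_col (transpose_mat M * Xi L)"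
    then have ij: "i < ?n" "j < ?n" using carrier_matD[OF M_carrier] carrier_matD[OF Xi_carrier[of L]] by auto
    have "(Xi L * (- M)) $$ (i, j) = (- M) $$ (mode_swap L i, j)"
      using ij by (intro Xi_mult_entry) auto
    also have "\<dots> = - M $$ (mode_swap L i, j)"
      using carrier_matD[OF M_carrier] ij mode_swap_less by auto
    also have "\<dots> = M $$ (mode_swap L j, i)"
      using M_antisym[OF ij] by simp
    also have "\<dots> = (\<Sum>k<?n. if k = mode_swap L j then M $$ (k, i) else 0)"
      using ij mode_swap_less by simp
    also have "\<dots> = (\<Sum>k<?n. transpose_mat M $$ (i, k) * Xi L $$ (k, j))"
      using ij carrier_matD[OF M_carrier] by (intro sum.cong refl) (auto simp: Xi_entry)
    also have "\<dots> = (transpose_mat M * Xi L) $$ (i, j)"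
      using ij by (intro mult_mat_entry[symmetric, of _ ?n]) auto
    finally show "(Xi L * (- M)) $$ (i, j) = (transpose_mat M * Xi L) $$ (i, j)" .
  qed (use carrier_matD[OF M_carrier] carrier_matD[OF Xi_carrier[of L]] in auto)
  then have "Xi L * mat_exp (- M) = mat_exp (transpose_mat M) * Xi L"
    by (intro mat_exp_intertwine[of _ ?n _ ?n]) auto
  then have XT: "Xi L * mat_exp (- M) = transpose_mat T * Xi L"
    by (simp add: mat_exp_transpose[OF M_carrier])
  have "transpose_mat T * (Xi L * T) = (Xi L * mat_exp (- M)) * T"
    unfolding XT by (intro assoc_mult_mat[symmetric, of _ ?n ?n _ ?n _ ?n]) auto
  also have "\<dots> = Xi L * (mat_exp (- M) * T)"
    by (intro assoc_mult_mat[of _ ?n ?n _ ?n _ ?n]) auto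
  also have "\<dots> = Xi L"
    by (simp only: mat_exp_uminus[OF M_carrier] right_mult_one_mat[OF Xi_carrier])
  finally have "Xi L $$ (a, b) = (transpose_mat T * (Xi L * T)) $$ (a, b)"
    by simp
  also have "\<dots> = (\<Sum>k<?n. transpose_mat T $$ (a, k) * (Xi L * T) $$ (k, b))"
    using assms by (intro mult_mat_entry[of _ ?n]) (auto intro: mult_carrier_mat[of _ _ ?n])
  also have "\<dots> = (\<Sum>k<?n. T $$ (k, a) * T $$ (mode_swap L k, b))"
    using assms carrier_matD[OF T_carrier] by (intro sum.cong refl) (auto simp: Xi_mult_entry)
  finally show ?thesis using assms by (simp add: Xi_entry)
qed

lemma T_blocks:
  "T12 L M \<in> carrier_mat L L" "T21 L M \<in> carrier_mat L L" "T22 L M \<in> carrier_mat L L"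
  "i < L \<Longrightarrow> j < L \<Longrightarrow> T12 L M $$ (i, j) = T $$ (i, L + j)"
  "i < L \<Longrightarrow> j < L \<Longrightarrow> T21 L M $$ (i, j) = T $$ (L + i, j)"
  "i < L \<Longrightarrow> j < L \<Longrightarrow> T22 L M $$ (i, j) = T $$ (L + i, L + j)"
  using carrier_matD[OF T_carrier]
  by (auto simp: T12_def T21_def T22_def split_block_def Let_def add.commute)

lemma cd_G:
  assumes "i < L"
  shows "cd i * G = (\<Sum>j<L. sc (T21 L M $$ (i, j)) * (G * cc j)) + (\<Sum>j<L. sc (T22 L M $$ (i, j)) * (G * cd j))"
  using psi_G[of "L + i"] assms unfolding sum_halves by (simp add: psi_def T_blocks)

lemma cc_G_raw:
  assumes "i < L"
  shows "cc i * G = (\<Sum>j<L. sc (T $$ (i, j)) * (G * cc j)) + (\<Sum>j<L. sc (T12 L M $$ (i, j)) * (G * cd j))"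
  using psi_G[of i] assms unfolding sum_halves by (simp add: psi_def T_blocks)

end

section \<open>Contraction coefficients for invertible \<open>T22\<close>\<close>

locale gaussian_inv = gaussian +
  assumes T22_invertible: "invertible_mat (T22 L M)"
begin

abbreviation R :: "complex mat" where "R \<equiv> T22_inv L M"

lemma R: "R \<in> carrier_mat L L" "T22 L M * R = 1\<^sub>m L" "R * T22 L M = 1\<^sub>m L"
proof -
  obtain B where B: "inverts_mat (T22 L M) B" "inverts_mat B (T22 L M)"
    using T22_invertible by (auto simp: invertible_mat_def)
  note T22 = carrier_matD[OF T_blocks(3)]
  have "T22 L M * B = 1\<^sub>m L" "B * T22 L M = 1\<^sub>m (dim_row B)"
    using B T22 by (auto simp: inverts_mat_def)
  then have "dim_col B = L" "dim_row B = L"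
    using T22 by (metis index_mult_mat(3) index_one_mat(3))+
  then have Bc: "B \<in> carrier_mat L L" and BT: "B * T22 L M = 1\<^sub>m L"
    using \<open>B * T22 L M = _\<close> by auto
  show "R \<in> carrier_mat L L" "T22 L M * R = 1\<^sub>m L" "R * T22 L M = 1\<^sub>m L"
  proof -
    \<comment> \<open>A two-sided inverse makes \<open>T22\<close> a unit of the matrix ring; hence
      \<open>the\<close> in \<open>T22_inv\<close> is applied to an actual inverse.\<close>
    have "mat_inverse (T22 L M) \<noteq> None"
    proof
      assume "mat_inverse (T22 L M) = None"
      then have "T22 L M \<notin> Units (ring_mat TYPE(complex) L ())"
        by (rule mat_inverse(1)[OF T_blocks(3)])
      moreover have "T22 L M \<in> Units (ring_mat TYPE(complex) L ())"
        using Bc BT \<open>T22 L M * B = 1\<^sub>m L\<close> T_blocks(3)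
        by (auto simp: Units_def ring_mat_simps)
      ultimately show False by simp
    qed
    then obtain C where "mat_inverse (T22 L M) = Some C" by auto
    then have "R = C" "T22 L M * C = 1\<^sub>m L \<and> C * T22 L M = 1\<^sub>m L \<and> C \<in> carrier_mat L L"
      using mat_inverse(2)[OF T_blocks(3)] by (auto simp: T22_inv_def)
    then show "R \<in> carrier_mat L L" "T22 L M * R = 1\<^sub>m L" "R * T22 L M = 1\<^sub>m L" by auto
  qed
qed

lemma X_Z_carrier: "X_mat L M \<in> carrier_mat L L" "Z_mat L M \<in> carrier_mat L L"
  using R T_blocks by (auto simp: X_mat_def Z_mat_def intro: mult_carrier_mat)

lemma X_Z_entry:
  assumes "i < L" "j < L"
  shows "X_mat L M $$ (i, j) = (\<Sum>k<L. T12 L M $$ (i, k) * R $$ (k, j))"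
    "Z_mat L M $$ (i, j) = (\<Sum>k<L. R $$ (i, k) * T21 L M $$ (k, j))"
    "(\<Sum>k<L. R $$ (i, k) * T22 L M $$ (k, j)) = (if i = j then 1 else 0)"
proof -
  show "X_mat L M $$ (i, j) = (\<Sum>k<L. T12 L M $$ (i, k) * R $$ (k, j))"
    unfolding X_mat_def by (rule mult_mat_entry[OF T_blocks(1) R(1) assms])
  show "Z_mat L M $$ (i, j) = (\<Sum>k<L. R $$ (i, k) * T21 L M $$ (k, j))"
    unfolding Z_mat_def by (rule mult_mat_entry[OF R(1) T_blocks(2) assms])
  have "(R * T22 L M) $$ (i, j) = (\<Sum>k<L. R $$ (i, k) * T22 L M $$ (k, j))"
    by (rule mult_mat_entry[OF R(1) T_blocks(3) assms])
  then show "(\<Sum>k<L. R $$ (i, k) * T22 L M $$ (k, j)) = (if i = j then 1 else 0)"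
    using assms by (simp add: R)
qed

text \<open>Multiplying the system \<open>cd_G\<close> by \<open>R\<close> solves it for the
  products \<open>G * cd i\<close>.\<close>

lemma G_cd:
  assumes i: "i < L"
  shows "G * cd i = (\<Sum>j<L. sc (R $$ (i, j)) * (cd j * G)) - (\<Sum>j<L. sc (Z_mat L M $$ (i, j)) * (G * cc j))"
proof -
  have "(\<Sum>j<L. sc (R $$ (i, j)) * (cd j * G)) =
      (\<Sum>j<L. \<Sum>k<L. sc (R $$ (i, j) * T21 L M $$ (j, k)) * (G * cc k)) +
      (\<Sum>j<L. \<Sum>k<L. sc (R $$ (i, j) * T22 L M $$ (j, k)) * (G * cd k))"
    by (simp add: cd_G distrib_left sum.distrib sum_distrib_left sc_hom(2) mult.assoc)
  also have "(\<Sum>j<L. \<Sum>k<L. sc (R $$ (i, j) * T21 L M $$ (j, k)) * (G * cc k)) =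
      (\<Sum>k<L. sc (Z_mat L M $$ (i, k)) * (G * cc k))"
    using i by (subst sum.swap) (simp add: X_Z_entry sc_sum sum_distrib_right)
  also have "(\<Sum>j<L. \<Sum>k<L. sc (R $$ (i, j) * T22 L M $$ (j, k)) * (G * cd k)) =
      (\<Sum>k<L. sc (\<Sum>j<L. R $$ (i, j) * T22 L M $$ (j, k)) * (G * cd k))"
    by (subst sum.swap) (simp add: sc_sum sum_distrib_right)
  also have "\<dots> = (\<Sum>k<L. if k = i then G * cd k else 0)"
    using i by (intro sum.cong refl) (auto simp: X_Z_entry)
  also have "\<dots> = G * cd i" using i by simp
  finally show ?thesis by simp
qed

text \<open>The coefficient \<open>T11 - T12 Z\<close> of the annihilation operators is the transpose of the inverse of
  \<open>T22\<close> because \<open>T\<close> is orthogonal for the bilinear form \<open>Xi\<close>.\<close>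

lemma T11_minus_T12_Z:
  assumes ij: "i < L" "j < L"
  shows "T $$ (i, j) - (\<Sum>k<L. T12 L M $$ (i, k) * Z_mat L M $$ (k, j)) = R $$ (j, i)"
proof -
  define T11 where "T11 = mat L L (\<lambda>(i, j). T $$ (i, j))"
  let ?t = transpose_mat
  note blocks = T_blocks(1-3)
  have T11: "T11 \<in> carrier_mat L L" by (simp add: T11_def)
  have entry: "(?t A * B + ?t C * D) $$ (a, b) = (\<Sum>k<L. A $$ (k, a) * B $$ (k, b)) + (\<Sum>k<L. C $$ (k, a) * D $$ (k, b))"
    if "A \<in> carrier_mat L L" "B \<in> carrier_mat L L" "C \<in> carrier_mat L L" "D \<in> carrier_mat L L"
      "a < L" "b < L" for A B C D :: "complex mat" and a b
  proof -
    have "(?t A * B + ?t C * D) $$ (a, b) = (?t A * B) $$ (a, b) + (?t C * D) $$ (a, b)"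
      using that by (intro index_add_mat) auto
    then show ?thesis
      using that mult_mat_entry[of "?t A" L L B L a b] mult_mat_entry[of "?t C" L L D L a b] by simp
  qed
  have orth: "(\<Sum>k<L. T $$ (k, a) * T $$ (L + k, b)) + (\<Sum>k<L. T $$ (L + k, a) * T $$ (k, b)) =
      (if a = mode_swap L b then 1 else 0)" if "a < 2 * L" "b < 2 * L" for a b
    using T_orthogonal[OF that] unfolding sum_halves by (simp add: mode_swap_def)
  have "T11 - T12 L M * (R * T21 L M) = ?t R"
  proof (rule schur_complement_orthogonal[OF T11 blocks R(1,2)])
    show "?t (T22 L M) * T12 L M + ?t (T12 L M) * T22 L M = 0\<^sub>m L L"
    proof (rule eq_matI)
      fix a b assume "a < dim_row (0\<^sub>m L L :: complex mat)" "b < dim_col (0\<^sub>m L L :: complex mat)"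
      then have ab: "a < L" "b < L" by auto
      have "(?t (T22 L M) * T12 L M + ?t (T12 L M) * T22 L M) $$ (a, b) =
          (\<Sum>k<L. T $$ (L + k, L + a) * T $$ (k, L + b)) + (\<Sum>k<L. T $$ (k, L + a) * T $$ (L + k, L + b))"
        using entry[OF blocks(3,1) blocks(1,3) ab] ab by (simp add: T_blocks)
      then show "(?t (T22 L M) * T12 L M + ?t (T12 L M) * T22 L M) $$ (a, b) = 0\<^sub>m L L $$ (a, b)"
        using orth[of "L + a" "L + b"] ab by (simp add: mode_swap_def add.commute)
    qed (use carrier_matD[OF blocks(1)] carrier_matD[OF blocks(3)] in auto)
    show "?t (T12 L M) * T21 L M + ?t (T22 L M) * T11 = 1\<^sub>m L"
    proof (rule eq_matI)
      fix a b assume "a < dim_row (1\<^sub>m L :: complex mat)" "b < dim_col (1\<^sub>m L :: complex mat)"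
      then have ab: "a < L" "b < L" by auto
      have "(?t (T12 L M) * T21 L M + ?t (T22 L M) * T11) $$ (a, b) =
          (\<Sum>k<L. T $$ (k, L + a) * T $$ (L + k, b)) + (\<Sum>k<L. T $$ (L + k, L + a) * T $$ (k, b))"
        using entry[OF blocks(1,2) blocks(3) T11 ab] ab by (simp add: T_blocks T11_def)
      then show "(?t (T12 L M) * T21 L M + ?t (T22 L M) * T11) $$ (a, b) = 1\<^sub>m L $$ (a, b)"
        using orth[of "L + a" b] ab by (simp add: mode_swap_def)
    qed (use carrier_matD[OF blocks(2)] carrier_matD[OF blocks(1)] carrier_matD[OF blocks(3)] T11 in auto)
  qed
  then have "(T11 - T12 L M * Z_mat L M) $$ (i, j) = ?t R $$ (i, j)"
    by (simp only: Z_mat_def)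
  moreover have "(T11 - T12 L M * Z_mat L M) $$ (i, j) = T11 $$ (i, j) - (T12 L M * Z_mat L M) $$ (i, j)"
    using ij mult_carrier_mat[OF blocks(1) X_Z_carrier(2)] by (intro index_minus_mat) auto
  moreover have "(T12 L M * Z_mat L M) $$ (i, j) = (\<Sum>k<L. T12 L M $$ (i, k) * Z_mat L M $$ (k, j))"
    by (rule mult_mat_entry[OF blocks(1) X_Z_carrier(2) ij])
  moreover have "?t R $$ (i, j) = R $$ (j, i)" "T11 $$ (i, j) = T $$ (i, j)"
    using ij R(1) by (simp_all add: T11_def)
  ultimately show ?thesis by simp
qed

text \<open>Inserting \<open>G_cd\<close> into \<open>cc_G_raw\<close> eliminates the terms
  \<open>G * cd j\<close>. What remains has creation operators only to the left of \<open>G\<close>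
  and annihilation operators only to the right, where the vacua kill them.\<close>

lemma cc_G:
  assumes i: "i < L"
  shows "cc i * G = (\<Sum>j<L. sc (X_mat L M $$ (i, j)) * (cd j * G)) + (\<Sum>j<L. sc (R $$ (j, i)) * (G * cc j))"
proof -
  have "(\<Sum>j<L. sc (T12 L M $$ (i, j)) * (G * cd j)) =
      (\<Sum>j<L. \<Sum>k<L. sc (T12 L M $$ (i, j) * R $$ (j, k)) * (cd k * G)) -
      (\<Sum>j<L. \<Sum>k<L. sc (T12 L M $$ (i, j) * Z_mat L M $$ (j, k)) * (G * cc k))"
    by (simp add: G_cd right_diff_distrib sum_subtractf sum_distrib_left sc_hom(2) mult.assoc)
  also have "(\<Sum>j<L. \<Sum>k<L. sc (T12 L M $$ (i, j) * R $$ (j, k)) * (cd k * G)) =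
      (\<Sum>k<L. sc (X_mat L M $$ (i, k)) * (cd k * G))"
    using i by (subst sum.swap) (simp add: X_Z_entry sc_sum sum_distrib_right)
  also have "(\<Sum>j<L. \<Sum>k<L. sc (T12 L M $$ (i, j) * Z_mat L M $$ (j, k)) * (G * cc k)) =
      (\<Sum>k<L. sc (\<Sum>j<L. T12 L M $$ (i, j) * Z_mat L M $$ (j, k)) * (G * cc k))"
    by (subst sum.swap) (simp add: sc_sum sum_distrib_right)
  finally have "cc i * G = (\<Sum>k<L. sc (X_mat L M $$ (i, k)) * (cd k * G)) +
      (\<Sum>k<L. sc (T $$ (i, k)) * (G * cc k) - sc (\<Sum>j<L. T12 L M $$ (i, j) * Z_mat L M $$ (j, k)) * (G * cc k))"
    unfolding cc_G_raw[OF i] by (simp add: sum_subtractf)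
  also have "(\<Sum>k<L. sc (T $$ (i, k)) * (G * cc k) - sc (\<Sum>j<L. T12 L M $$ (i, j) * Z_mat L M $$ (j, k)) * (G * cc k)) =
      (\<Sum>k<L. sc (R $$ (k, i)) * (G * cc k))"
  proof (intro sum.cong refl)
    fix k assume "k \<in> {..<L}"
    then have "sc (T $$ (i, k)) = sc (R $$ (k, i)) + sc (\<Sum>j<L. T12 L M $$ (i, j) * Z_mat L M $$ (j, k))"
      using T11_minus_T12_Z[OF i, of k] by (simp only: sc_hom(1)[symmetric]) (simp add: algebra_simps)
    then show "sc (T $$ (i, k)) * (G * cc k) - sc (\<Sum>j<L. T12 L M $$ (i, j) * Z_mat L M $$ (j, k)) * (G * cc k) =
      sc (R $$ (k, i)) * (G * cc k)"
      by (simp add: distrib_right)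
  qed
  finally show ?thesis .
qed

lemma A_mat_entry:
  assumes "i < L" "j < L"
  shows "A_mat L M $$ (i, j) = X_mat L M $$ (i, j)" "A_mat L M $$ (i, L + j) = R $$ (j, i)"
    "A_mat L M $$ (L + i, L + j) = Z_mat L M $$ (i, j)"
  using assms X_Z_carrier R(1) by (auto simp: A_mat_def)

end

subsection \<open>Determinants from anticommuting products\<close>

lemma prod_list_anticommute:
  fixes x :: "'b \<Rightarrow> 'a::ring_1"
  assumes "\<And>i. i \<in> set xs \<Longrightarrow> z * x i = - (x i * z)"
  shows "z * prod_list (map x xs) = (-1) ^ length xs * prod_list (map x xs) * z"
  using assms
proof (induction xs)
  case (Cons i xs)
  have "z * prod_list (map x (i # xs)) = - x i * (z * prod_list (map x xs))"
    using Cons.prems[of i] by (simp add: mult.assoc[symmetric])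
  also have "\<dots> = (-1) ^ length (i # xs) * prod_list (map x (i # xs)) * z"
    using Cons by (cases "even (length xs)") (simp_all add: mult.assoc)
  finally show ?case .
qed simp

text \<open>A term \<open>c i * x\<close> can be brought next to the leading \<open>x\<close> up to
  a sign, and \<open>x * x = 0\<close>.\<close>

lemma prod_list_absorb:
  fixes y :: "'b \<Rightarrow> 'a::ring_1"
  assumes "x * x = 0" "\<And>i. x * y i = - (y i * x)" "\<And>i. c i * x = x * c i"
  shows "x * prod_list (map (\<lambda>i. y i + c i * x) xs) = x * prod_list (map y xs)"
proof (induction xs)
  case (Cons i xs)
  have "x * (c i * x) = 0"
    by (metis assms(1,3) mult.assoc mult_zero_left)
  then have "x * prod_list (map (\<lambda>i. y i + c i * x) (i # xs)) =
      - y i * (x * prod_list (map (\<lambda>i. y i + c i * x) xs))"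
    by (simp add: distrib_left distrib_right mult.assoc[symmetric] assms(2))
  also have "\<dots> = x * prod_list (map y (i # xs))"
    by (simp add: Cons.IH mult.assoc[symmetric] assms(2))
  finally show ?case .
qed simp

text \<open>The determinant as the action on the top exterior power, by expansion along row 0. Once
  \<open>x j\<close> is taken from the first factor, \<open>prod_list_absorb\<close> removes it from
  all later ones and leaves the product for a minor.\<close>

lemma prod_list_det:
  fixes x :: "nat \<Rightarrow> fop"
  assumes "A \<in> carrier_mat n n" "\<And>i j. x i * x j = - (x j * x i)" "\<And>i. x i * x i = 0"
  shows "prod_list (map (\<lambda>i. \<Sum>j<n. sc (A $$ (i, j)) * x j) [0..<n]) = sc (det A) * prod_list (map x [0..<n])"
  using assms
proof (induction n arbitrary: A x)
  case 0
  show ?case using 0(1) by simp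
next
  case (Suc n)
  let ?A' = "\<lambda>j. mat_delete A 0 j" and ?x' = "\<lambda>j k. x (insert_index j k)"
  let ?y = "\<lambda>i. \<Sum>j<Suc n. sc (A $$ (Suc i, j)) * x j"
  have step: "x j * prod_list (map ?y [0..<n]) = sc (cofactor A 0 j) * prod_list (map x [0..<Suc n])"
    if j: "j < Suc n" for j
  proof -
    let ?y' = "\<lambda>i. \<Sum>k<n. sc (A $$ (Suc i, insert_index j k)) * ?x' j k"
    have y: "?y i = ?y' i + sc (A $$ (Suc i, j)) * x j" for i
    proof -
      have img: "insert_index j ` {..<n} = {..<Suc n} - {j}"
        using insert_index_image[OF j] by (simp only: atLeast0LessThan)
      have "?y i = sc (A $$ (Suc i, j)) * x j + (\<Sum>k\<in>insert_index j ` {..<n}. sc (A $$ (Suc i, k)) * x k)"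
        unfolding img by (rule sum.remove) (use j in auto)
      also have "(\<Sum>k\<in>insert_index j ` {..<n}. sc (A $$ (Suc i, k)) * x k) = ?y' i"
        by (subst sum.reindex[OF insert_index_inj_on]) (simp only: o_def)
      finally show ?thesis by (simp only: add.commute)
    qed
    have anti: "x j * ?y' i = - (?y' i * x j)" for i
      unfolding sum_distrib_left sum_distrib_right sum_negf[symmetric]
      by (intro sum.cong refl) (simp only: sc_left_commute[where X="x j"] mult.assoc Suc.prems(2)[of j] mult_minus_right)
    have "x j * prod_list (map ?y [0..<n]) = x j * prod_list (map ?y' [0..<n])"
      unfolding y by (rule prod_list_absorb) (rule Suc.prems(3) anti sc_commute[symmetric])+
    also have "map ?y' [0..<n] = map (\<lambda>i. \<Sum>k<n. sc (?A' j $$ (i, k)) * ?x' j k) [0..<n]"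
      using Suc.prems(1) by (auto simp: mat_delete_def insert_index_def intro!: sum.cong)
    also have "prod_list \<dots> = sc (det (?A' j)) * prod_list (map (?x' j) [0..<n])"
      using mat_delete_carrier[OF Suc.prems(1), of 0 j] by (intro Suc.IH Suc.prems(2,3)) simp
    also have "x j * (sc (det (?A' j)) * prod_list (map (?x' j) [0..<n])) =
        sc (det (?A' j)) * (x j * prod_list (map (?x' j) [0..<n]))"
      by (rule sc_left_commute)
    \<comment> \<open>Bringing \<open>x j\<close> to its place passes the \<open>j\<close> operators
      before it; this supplies the sign of the cofactor.\<close>
    also have "x j * prod_list (map (?x' j) [0..<n]) = (-1) ^ j * prod_list (map x [0..<Suc n])"
    proof -
      have split: "[0..<n] = [0..<j] @ [j..<n]" "[0..<Suc n] = [0..<j] @ j # [Suc j..<Suc n]"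
        using j upt_add_eq_append[of 0 j "n - j"] upt_add_eq_append[of 0 j "Suc n - j"]
        by (simp_all add: upt_conv_Cons del: upt_Suc)
      have "map (?x' j) [0..<j] = map x [0..<j]"
        by (auto simp: insert_index_def)
      moreover have "map (?x' j) [j..<n] = map x [Suc j..<Suc n]"
      proof -
        have "map (?x' j) [j..<n] = map (\<lambda>k. x (Suc k)) [j..<n]"
          by (auto simp: insert_index_def)
        then show ?thesis
          by (simp only: map_Suc_upt[symmetric] map_map o_def)
      qed
      ultimately have "x j * prod_list (map (?x' j) [0..<n]) =
          (x j * prod_list (map x [0..<j])) * prod_list (map x [Suc j..<Suc n])"
        by (simp only: split(1) map_append prod_list.append mult.assoc)
      also have "x j * prod_list (map x [0..<j]) = (-1) ^ j * prod_list (map x [0..<j]) * x j"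
        using prod_list_anticommute[of "[0..<j]" "x j" x, OF Suc.prems(2)] by (simp only: length_upt diff_zero)
      finally show ?thesis unfolding split(2) by (simp add: mult.assoc)
    qed
    also have "sc (det (?A' j)) * ((-1) ^ j * prod_list (map x [0..<Suc n])) =
        sc (cofactor A 0 j) * prod_list (map x [0..<Suc n])"
      by (cases "even j") (simp_all add: cofactor_def sc_hom del: upt_Suc)
    finally show ?thesis .
  qed
  have "map (\<lambda>i. \<Sum>j<Suc n. sc (A $$ (i, j)) * x j) [0..<Suc n] =
      (\<Sum>j<Suc n. sc (A $$ (0, j)) * x j) # map ?y [0..<n]"
    by (simp only: upt_conv_Cons[OF zero_less_Suc] list.map map_Suc_upt[symmetric] map_map o_def)
  then have "prod_list (map (\<lambda>i. \<Sum>j<Suc n. sc (A $$ (i, j)) * x j) [0..<Suc n]) =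
      (\<Sum>j<Suc n. sc (A $$ (0, j)) * (x j * prod_list (map ?y [0..<n])))"
    by (simp only: prod_list.Cons sum_distrib_right mult.assoc)
  also have "\<dots> = (\<Sum>j<Suc n. sc (A $$ (0, j) * cofactor A 0 j) * prod_list (map x [0..<Suc n]))"
    by (intro sum.cong refl) (simp only: step lessThan_iff sc_hom mult.assoc)
  also have "\<dots> = sc (det A) * prod_list (map x [0..<Suc n])"
    using laplace_expansion_row[OF Suc.prems(1), of 0]
    by (simp only: sum_distrib_right[symmetric] sc_sum zero_less_Suc)
  finally show ?case .
qed

subsection \<open>Particle number\<close>

definition particles :: "nat \<Rightarrow> nat" where
  "particles s = card {j. bit s j}"

definition low :: "nat \<Rightarrow> (nat \<Rightarrow> complex) \<Rightarrow> bool" where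
  "low k v \<longleftrightarrow> (\<forall>s. v s \<noteq> 0 \<longrightarrow> particles s < k)"

lemma finite_bits: "finite {j. bit (s::nat) j}"
proof -
  have "{j. bit s j} \<subseteq> {..<s}"
    using less_pow2_iff[of s s] less_exp[of s] by auto
  then show ?thesis using finite_subset by blast
qed

lemma particles_set_bit: "\<not> bit s l \<Longrightarrow> particles (set_bit l s) = Suc (particles s)"
proof -
  assume "\<not> bit s l"
  moreover have "{j. bit (set_bit l s) j} = insert l {j. bit s j}"
    by (auto simp: bit_set_bit_iff)
  ultimately show ?thesis using finite_bits[of s] by (simp add: particles_def)
qed

lemma low_cd: "low k v \<Longrightarrow> low (Suc k) (app (cd l) v)"
proof -
  assume v: "low k v"
  show ?thesis unfolding low_def
  proof (intro allI impI)
    fix s assume "app (cd l) v s \<noteq> 0"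
    then have s: "bit s l" "v (unset_bit l s) \<noteq> 0" by (auto simp: app_cd split: if_splits)
    have "particles s = Suc (particles (unset_bit l s))"
      using particles_set_bit[of "unset_bit l s" l] s by (simp add: set_unset_bit(4) bit_unset_bit_iff)
    then show "particles s < Suc k" using v s by (simp add: low_def)
  qed
qed

lemma low_cc: "low k v \<Longrightarrow> low k (app (cc l) v)"
proof -
  assume v: "low k v"
  show ?thesis unfolding low_def
  proof (intro allI impI)
    fix s assume "app (cc l) v s \<noteq> 0"
    then have s: "\<not> bit s l" "v (set_bit l s) \<noteq> 0" by (auto simp: app_cc split: if_splits)
    then have "Suc (particles s) < k"
      using v by (auto simp: low_def particles_set_bit[symmetric])
    then show "particles s < k" by simp
  qed
qed

lemma low_mono: "low k v \<Longrightarrow> k \<le> l \<Longrightarrow> low l v"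
  by (meson low_def order_less_le_trans)

lemma low_add: "low k u \<Longrightarrow> low k v \<Longrightarrow> low k (\<lambda>i. u i + v i)"
  unfolding low_def by (metis add.right_neutral add.left_neutral)

lemma low_sum_sc:
  assumes "\<And>j. j \<in> A \<Longrightarrow> low k (app (X j) v)"
  shows "low k (app (\<Sum>j\<in>A. sc (c j) * X j) v)"
  unfolding low_def
proof (intro allI impI)
  fix s assume "app (\<Sum>j\<in>A. sc (c j) * X j) v s \<noteq> 0"
  then have "(\<Sum>j\<in>A. c j * app (X j) v s) \<noteq> 0" by (simp add: app_sum)
  then obtain j where "j \<in> A" "c j * app (X j) v s \<noteq> 0" by (rule sum.not_neutral_contains_not_neutral)
  then show "particles s < k" using assms by (auto simp: low_def)
qed

text \<open>Annihilation operators cannot contribute to the component with the most particles.\<close>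

lemma low_difference:
  fixes a b :: "nat \<Rightarrow> nat \<Rightarrow> complex" and L :: nat
  defines "lower \<equiv> \<lambda>i. \<Sum>j<L. sc (a i j) * cc j" and "raise \<equiv> \<lambda>i. \<Sum>j<L. sc (b i j) * cd j"
  shows "low (Suc (length xs)) (app (prod_list (map (\<lambda>i. lower i + raise i) xs)) vac) \<and>
    low (length xs) (\<lambda>r. app (prod_list (map (\<lambda>i. lower i + raise i) xs)) vac r - app (prod_list (map raise xs)) vac r)"
proof (induction xs)
  case Nil
  have "{j. bit (0::nat) j} = {}" by auto
  then have "particles 0 = 0" by (simp only: particles_def card.empty)
  then show ?case by (simp add: low_def vac_def)
next
  case (Cons i xs)
  let ?v = "app (prod_list (map (\<lambda>i. lower i + raise i) xs)) vac"
  let ?w = "app (prod_list (map raise xs)) vac"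
  have v: "low (Suc (length xs)) ?v" and vw: "low (length xs) (\<lambda>r. ?v r - ?w r)"
    using Cons.IH by auto
  have low_lower: "low k u \<Longrightarrow> low k (app (lower i) u)" for k u
    unfolding lower_def by (intro low_sum_sc low_cc)
  have low_raise: "low k u \<Longrightarrow> low (Suc k) (app (raise i) u)" for k u
    unfolding raise_def by (intro low_sum_sc low_cd)
  note lower = low_lower[OF v] and raise = low_raise[OF v] low_raise[OF vw]
  have "app (lower i + raise i) ?v = (\<lambda>r. app (lower i) ?v r + app (raise i) ?v r)"
    by auto
  then have 1: "low (Suc (Suc (length xs))) (app (lower i + raise i) ?v)"
    using low_add[OF low_mono[OF lower] raise(1)] by simp
  have "app (raise i) (\<lambda>r. ?v r - ?w r) r = app (raise i) ?v r - app (raise i) ?w r" for r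
    using app_add_vec[of "raise i" ?v "\<lambda>r. (-1) * ?w r" r] app_scale_vec[of "raise i" "-1" ?w r] by simp
  \<comment> \<open>The new difference is the lowering part of the full product, which does not
    raise its bound, plus the raising part of the old difference, which raises its smaller bound by
    one.\<close>
  then have "(\<lambda>r. app (lower i + raise i) ?v r - app (raise i) ?w r) =
      (\<lambda>r. app (lower i) ?v r + app (raise i) (\<lambda>r. ?v r - ?w r) r)"
    by auto
  then have 2: "low (Suc (length xs)) (\<lambda>r. app (lower i + raise i) ?v r - app (raise i) ?w r)"
    using low_add[OF lower raise(2)] by simp
  show ?case using 1 2 by (simp del: app_simps(3))
qed

subsection \<open>The filled state\<close>

definition fill :: "nat \<Rightarrow> fop" where
  "fill k = prod_list (map cd [0..<k])"

text \<open>A product of Majorana operators. Each factor exchanges empty and occupied at its site,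
  so this is the particle-hole transformation of the first \<open>k\<close> modes.\<close>

definition flip_modes :: "nat \<Rightarrow> fop" where
  "flip_modes k = prod_list (map (\<lambda>l. cc l + cd l) [0..<k])"

lemma jw_sign_push: "jw_sign k (push_bit k r) = 1"
proof -
  have "{j. j < k \<and> bit (push_bit k r) j} = {}" by (auto simp: bit_push_bit_iff)
  then show ?thesis by (simp only: jw_sign_def card.empty power_0)
qed

lemma unset_bit_push_drop: "unset_bit k (push_bit k (drop_bit k r)) = push_bit (Suc k) (drop_bit (Suc k) r)" for r :: nat
  by (rule bit_eqI) (auto simp: bit_unset_bit_iff bit_push_bit_iff bit_drop_bit_eq simp del: push_bit_Suc drop_bit_Suc)

lemma bit_push_drop: "bit (push_bit k (drop_bit k r)) k = bit r k" for r :: nat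
  by (auto simp: bit_push_bit_iff bit_drop_bit_eq)

text \<open>\<open>push_bit k (drop_bit k r)\<close> is \<open>r\<close> with its lowest
  \<open>k\<close> bits cleared. No sign appears, since each creation operator is read at a state
  whose lower sites are already cleared.\<close>

lemma app_fill:
  "app (fill k) v r = (if \<forall>l<k. bit r l then v (push_bit k (drop_bit k r)) else 0)"
proof (induction k arbitrary: v)
  case 0
  then show ?case by (simp add: fill_def)
next
  case (Suc k)
  have "app (fill (Suc k)) v r = app (fill k) (app (cd k) v) r"
    by (simp add: fill_def)
  also have "\<dots> = (if \<forall>l<k. bit r l then app (cd k) v (push_bit k (drop_bit k r)) else 0)"
    by (rule Suc.IH)
  also have "app (cd k) v (push_bit k (drop_bit k r)) =
      (if bit r k then v (push_bit (Suc k) (drop_bit (Suc k) r)) else 0)"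
    unfolding app_cd bit_push_drop jw_sign_push unset_bit_push_drop by simp
  finally show ?case by (auto simp: less_Suc_eq)
qed

lemma app_flip_modes:
  "\<forall>l<k. bit r l \<Longrightarrow> app (flip_modes k) v r = v (push_bit k (drop_bit k r))"
proof (induction k arbitrary: v)
  case 0
  then show ?case by (simp add: flip_modes_def)
next
  case (Suc k)
  have "app (flip_modes (Suc k)) v r = app (flip_modes k) (app (cc k + cd k) v) r"
    by (simp add: flip_modes_def)
  also have "\<dots> = app (cc k + cd k) v (push_bit k (drop_bit k r))"
    using Suc.prems by (intro Suc.IH) auto
  also have "\<dots> = v (push_bit (Suc k) (drop_bit (Suc k) r))"
    using Suc.prems unfolding app_simps app_cc app_cd bit_push_drop jw_sign_push unset_bit_push_drop by simp
  finally show ?case .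
qed

lemma app_zero_fun: "app X (\<lambda>i. 0) = (\<lambda>i. 0)"
  by (rule ext) (rule app_zero_vec)

text \<open>Each annihilation part passes the creation operators of the other sites and reaches the
  vacuum.\<close>

lemma flip_modes_vac: "app (flip_modes k) vac = app (fill k) vac"
proof -
  have "app (prod_list (map (\<lambda>l. cc l + cd l) xs)) vac = app (prod_list (map cd xs)) vac" if "distinct xs" for xs
    using that
  proof (induction xs)
    case (Cons l xs)
    have "cc l * prod_list (map cd xs) = (-1) ^ length xs * prod_list (map cd xs) * cc l"
      using Cons.prems by (intro prod_list_anticommute cc_cd_diff) auto
    then have "app (cc l * prod_list (map cd xs)) vac r = app ((-1) ^ length xs * prod_list (map cd xs) * cc l) vac r" for r
      by (simp only:)
    then have "app (cc l) (app (prod_list (map cd xs)) vac) r = 0" for r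
      by (simp only: app_simps(6) app_cc_vac app_zero_fun)
    moreover have "app (prod_list (map (\<lambda>l. cc l + cd l) xs)) vac = app (prod_list (map cd xs)) vac"
      using Cons by simp
    ultimately show ?case
      by (intro ext) (simp only: list.map prod_list.Cons app_simps add_0_left)
  qed simp
  then show ?thesis by (simp add: flip_modes_def fill_def)
qed

definition filled :: "nat \<Rightarrow> nat" where "filled L = mask L"

lemma bit_filled: "bit (filled L) l \<longleftrightarrow> l < L"
  by (simp add: filled_def bit_mask_iff)

lemma filled_less: "filled L < 2 ^ L"
  by (simp add: less_pow2_iff bit_filled)

lemma push_drop_filled: "push_bit L (drop_bit L (filled L)) = 0"
  by (rule bit_eqI) (auto simp: bit_push_bit_iff bit_drop_bit_eq bit_filled)

lemma particles_filled: "particles (filled L) = L"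
  by (simp add: particles_def bit_filled)

text \<open>Clearing the lowest \<open>L\<close> bits of a state other than the filled one leaves a
  nonzero bit at or above \<open>L\<close>, where \<open>w\<close> vanishes, unless some low bit was
  missing. So on \<open>L\<close> modes \<open>fill L\<close> has rank one.\<close>

lemma app_fill_proj:
  assumes "\<And>r. \<not> r < 2 ^ L \<Longrightarrow> w r = 0"
  shows "app (fill L) w = (\<lambda>r. if r = filled L then w 0 else 0)"
proof
  fix r
  show "app (fill L) w r = (if r = filled L then w 0 else 0)"
  proof (cases "r = filled L")
    case True
    then show ?thesis by (simp add: app_fill bit_filled push_drop_filled)
  next
    case False
    show ?thesis
    proof (cases "\<forall>l<L. bit r l")
      case True
      have "\<exists>n. bit r n \<noteq> bit (filled L) n"
        using False bit_eqI[of r "filled L"] by blast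
      then obtain n where "bit r n" "L \<le> n"
        using True by (auto simp: bit_filled not_less)
      then have "bit (push_bit L (drop_bit L r)) n"
        by (simp add: bit_push_bit_iff bit_drop_bit_eq)
      then have "\<not> push_bit L (drop_bit L r) < 2 ^ L"
        using \<open>L \<le> n\<close> by (auto simp: less_pow2_iff not_less)
      then show ?thesis using False True assms by (simp add: app_fill)
    next
      case not_full: False
      show ?thesis unfolding app_fill if_not_P[OF not_full] using False by simp
    qed
  qed
qed

lemma fill_vac: "app (fill L) vac = (\<lambda>r. if r = filled L then 1 else 0)"
proof -
  have "vac r = 0" if "\<not> r < 2 ^ L" for r
    using that by (cases r) (auto simp: vac_def)
  then show ?thesis by (subst app_fill_proj) (auto simp: vac_def)
qed

subsection \<open>Particle-hole symmetry\<close>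

text \<open>A factor of a different mode anticommutes with \<open>psi L a\<close>; the factor of its
  own mode exchanges it with its adjoint without a sign. Hence \<open>k\<close> signs if the mode is
  not met and \<open>k - 1\<close> if it is.\<close>

lemma flip_modes_psi:
  assumes "a < 2 * L" "k \<le> L"
  shows "flip_modes k * psi L a = (if (if a < L then a else a - L) < k
    then - ((-1) ^ k * psi L (mode_swap L a) * flip_modes k) else (-1) ^ k * psi L a * flip_modes k)"
  using assms
proof (induction k arbitrary: a)
  case 0
  then show ?case by (simp add: flip_modes_def)
next
  case (Suc k)
  let ?m = "if a < L then a else a - L"
  have flip: "flip_modes (Suc k) = flip_modes k * (cc k + cd k)"
    by (simp add: flip_modes_def)
  show ?case
  proof (cases "?m = k")
    case True
    have "(cc k + cd k) * psi L a = psi L (mode_swap L a) * (cc k + cd k)"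
      using True Suc.prems by (auto simp: psi_def mode_swap_def distrib_left distrib_right anticomm_self split: if_splits)
    then have "flip_modes (Suc k) * psi L a = flip_modes k * psi L (mode_swap L a) * (cc k + cd k)"
      by (simp add: flip mult.assoc)
    also have "flip_modes k * psi L (mode_swap L a) = (-1) ^ k * psi L (mode_swap L a) * flip_modes k"
      using Suc.IH[of "mode_swap L a"] Suc.prems True by (auto simp: mode_swap_def split: if_splits)
    finally show ?thesis using True by (simp add: flip mult.assoc)
  next
    case False
    have "(cc k + cd k) * psi L a = - (psi L a * (cc k + cd k))"
      using False Suc.prems anticomm_cc[of k a] cc_cd_diff[of a k] anticomm_cd[of k "a - L"] cc_cd_diff[of k "a - L"]
      by (auto simp: psi_def distrib_left distrib_right split: if_splits)
    then have "flip_modes (Suc k) * psi L a = - (flip_modes k * psi L a * (cc k + cd k))"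
      by (simp add: flip mult.assoc)
    then show ?thesis
      using False Suc by (auto simp: flip mult.assoc less_Suc_eq)
  qed
qed

lemma prod_list_intertwine:
  fixes G :: "'a::monoid_mult"
  assumes "\<And>i. i \<in> set xs \<Longrightarrow> a i * G = G * b i"
  shows "prod_list (map a xs) * G = G * prod_list (map b xs)"
  using assms
proof (induction xs)
  case (Cons i xs)
  have "prod_list (map a (i # xs)) * G = a i * (G * prod_list (map b xs))"
    using Cons by (simp add: mult.assoc)
  also have "\<dots> = G * prod_list (map b (i # xs))"
    using Cons.prems[of i] by (simp add: mult.assoc[symmetric])
  finally show ?case .
qed simp

section \<open>Entries and powers of matrices read off from operators\<close>

lemma app_op_mat_unit:
  assumes "r < 2 ^ L" "s < 2 ^ L"
  shows "app (op_mat L A) (\<lambda>i. if i = s then c else 0) r = A $$ (r, s) * c"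
  using assms by (simp add: app_op_mat if_distrib[of "\<lambda>x. _ * x"] cong: if_cong)

lemma vac_unit: "vac = (\<lambda>i. if i = 0 then 1 else 0)"
  by (rule ext) (simp add: vac_def)

lemma vev_op_mat: "vev (op_mat L A) = A $$ (0, 0)"
  unfolding vev_def vac_unit by (subst app_op_mat_unit) auto

lemma op_mat_uminus: "A \<in> carrier_mat (2 ^ L) (2 ^ L) \<Longrightarrow> op_mat L (- A) = - op_mat L A"
  by (rule fop_eqI) (auto simp: app_op_mat sum_negf)

lemma op_mat_pow:
  assumes A: "A \<in> carrier_mat (2 ^ L) (2 ^ L)" and a: "op_mat L A = a * proj L" "proj L * a = a * proj L"
  shows "op_mat L (A ^\<^sub>m n) = a ^ n * proj L"
proof (induction n)
  case 0
  then show ?case using A by (simp add: op_mat_one)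
next
  case (Suc n)
  have "op_mat L (A ^\<^sub>m Suc n) = op_mat L A * op_mat L (A ^\<^sub>m n)"
    unfolding pow_mat_Suc_left[OF A] using A by (intro op_mat_times pow_carrier)
  also have "\<dots> = a * (proj L * a ^ n) * proj L"
    by (simp add: Suc.IH a mult.assoc)
  also have "proj L * a ^ n = a ^ n * proj L"
    by (rule power_commuting_commutes[OF a(2)[symmetric], symmetric])
  finally show ?case by (simp add: mult.assoc proj_proj)
qed

context gaussian
begin

text \<open>Diagonal entries at an index and its particle-hole partner are opposite. Half of this
  trace is the scalar that reordering produces in \<open>flip_hT\<close>.\<close>

lemma trace_M: "(\<Sum>a<2 * L. M $$ (a, a)) = 0"
proof -
  have "M $$ (a, a) = - M $$ (mode_swap L a, mode_swap L a)" if "a < 2 * L" for a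
    using M_antisym[of "mode_swap L a" a] that by (simp add: mode_swap_less)
  then have "(\<Sum>a<2 * L. M $$ (a, a)) = (\<Sum>a<2 * L. - M $$ (mode_swap L a, mode_swap L a))"
    by simp
  also have "\<dots> = (\<Sum>a<2 * L. - M $$ (a, a))"
    by (rule sum_mode_swap)
  finally show ?thesis by (simp add: sum_negf)
qed

text \<open>The transpose of \<open>H\<close> without the projection: transposing a product reverses
  its order and takes the adjoint of each mode operator.\<close>

definition hT :: fop where
  "hT = (\<Sum>a<2 * L. \<Sum>b<2 * L. sc (M $$ (a, b) / 2) * (psi L (mode_swap L b) * psi L a))"

lemma nambu_transpose: "transpose_mat (nambu L a) = nambu_adj L a" "transpose_mat (nambu_adj L a) = nambu L a"
  by (simp_all add: nambu_def nambu_adj_def create_def)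

lemma op_mat_H_transpose: "op_mat L (transpose_mat H) = hT * proj L"
proof -
  have "transpose_mat H = (1 / 2) \<cdot>\<^sub>m bilinear_op L (2 * L) (nambu_adj L) (transpose_mat M) (nambu L)"
  proof (rule eq_matI)
    fix r s assume "r < dim_row ((1 / 2) \<cdot>\<^sub>m bilinear_op L (2 * L) (nambu_adj L) (transpose_mat M) (nambu L))"
      "s < dim_col ((1 / 2) \<cdot>\<^sub>m bilinear_op L (2 * L) (nambu_adj L) (transpose_mat M) (nambu L))"
    then have rs: "r < 2 ^ L" "s < 2 ^ L" by (simp_all add: bilinear_op_def)
    have "(nambu_adj L a * nambu L b) $$ (s, r) = (nambu_adj L b * nambu L a) $$ (r, s)" for a b
    proof -
      have "(nambu_adj L a * nambu L b) $$ (s, r) = transpose_mat (nambu_adj L a * nambu L b) $$ (r, s)"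
        using rs carrier_matD[OF nambu_carrier(1)[of L b]] carrier_matD[OF nambu_carrier(2)[of L a]] by simp
      also have "transpose_mat (nambu_adj L a * nambu L b) = nambu_adj L b * nambu L a"
        by (simp add: transpose_mult[OF nambu_carrier(2) nambu_carrier(1)] nambu_transpose)
      finally show ?thesis .
    qed
    then have "(\<Sum>a<2 * L. \<Sum>b<2 * L. M $$ (a, b) * (nambu_adj L a * nambu L b) $$ (s, r)) =
        (\<Sum>a<2 * L. \<Sum>b<2 * L. transpose_mat M $$ (b, a) * (nambu_adj L b * nambu L a) $$ (r, s))"
      using carrier_matD[OF M_carrier] by (intro sum.cong refl) simp
    also have "\<dots> = (\<Sum>b<2 * L. \<Sum>a<2 * L. transpose_mat M $$ (b, a) * (nambu_adj L b * nambu L a) $$ (r, s))"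
      by (rule sum.swap)
    finally show "transpose_mat H $$ (r, s) =
        ((1 / 2) \<cdot>\<^sub>m bilinear_op L (2 * L) (nambu_adj L) (transpose_mat M) (nambu L)) $$ (r, s)"
      using rs by (simp add: H_def bilinear_op_def)
  qed (simp_all add: H_def bilinear_op_def)
  then have "op_mat L (transpose_mat H) = (\<Sum>b<2 * L. \<Sum>a<2 * L. sc (1 / 2 * transpose_mat M $$ (b, a)) *
      (op_mat L (nambu_adj L b) * op_mat L (nambu L a)))"
    by (simp only:) (intro op_mat_bilinear nambu_carrier)
  also have "\<dots> = (\<Sum>b<2 * L. \<Sum>a<2 * L. sc (M $$ (a, b) / 2) *
      (psi L (mode_swap L b) * psi L a) * proj L)"
  proof (intro sum.cong refl)
    fix b a assume ab: "b \<in> {..<2 * L}" "a \<in> {..<2 * L}"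
    then have "op_mat L (nambu_adj L b) * op_mat L (nambu L a) =
        psi L (mode_swap L b) * (proj L * psi L a) * proj L"
      by (simp add: op_mat_nambu mult.assoc)
    also have "\<dots> = psi L (mode_swap L b) * psi L a * proj L"
      using ab by (simp add: psi_proj mult.assoc proj_proj)
    finally show "sc (1 / 2 * transpose_mat M $$ (b, a)) * (op_mat L (nambu_adj L b) * op_mat L (nambu L a)) =
        sc (M $$ (a, b) / 2) * (psi L (mode_swap L b) * psi L a) * proj L"
      using ab carrier_matD[OF M_carrier] by (simp add: mult.assoc)
  qed
  also have "\<dots> = hT * proj L"
    by (subst sum.swap) (simp add: hT_def sum_distrib_right)
  finally show ?thesis .
qed

lemma hT_proj: "proj L * hT = hT * proj L"
proof -
  have "proj L * (psi L (mode_swap L b) * psi L a) = psi L (mode_swap L b) * psi L a * proj L"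
    if "a < 2 * L" "b < 2 * L" for a b
  proof -
    have "proj L * (psi L (mode_swap L b) * psi L a) = (proj L * psi L (mode_swap L b)) * psi L a"
      by (simp add: mult.assoc)
    also have "\<dots> = psi L (mode_swap L b) * (proj L * psi L a)"
      using that by (simp add: psi_proj mode_swap_less mult.assoc)
    finally show ?thesis using that by (simp add: psi_proj mult.assoc)
  qed
  then show ?thesis
    by (simp add: hT_def sum_distrib_left sum_distrib_right sc_left_commute[where X="proj L"] mult.assoc)
qed

text \<open>The transformation replaces both mode operators by their adjoints, and the signs cancel
  in pairs. Restoring the order of \<open>h\<close> gives the minus sign and a scalar, which
  vanishes by \<open>trace_M\<close>.\<close>

lemma flip_hT: "flip_modes L * hT = - h * flip_modes L"
proof -
  let ?C = "flip_modes L"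
  have sq: "(-1) ^ L * x * ((-1) ^ L * y) = x * y" for x y :: fop
    by (cases "even L") simp_all
  have flip: "?C * psi L a = - ((-1) ^ L * psi L (mode_swap L a) * ?C)" if "a < 2 * L" for a
    using flip_modes_psi[OF that order_refl] that by (auto split: if_splits)
  have "?C * (psi L (mode_swap L b) * psi L a) = (if a = b then ?C else 0) - psi L (mode_swap L a) * psi L b * ?C"
    if ab: "a < 2 * L" "b < 2 * L" for a b
  proof -
    have "?C * (psi L (mode_swap L b) * psi L a) = - ((-1) ^ L * psi L b * (?C * psi L a))"
      using flip[of "mode_swap L b"] ab by (simp add: mult.assoc[symmetric] mode_swap_less)
    also have "\<dots> = (-1) ^ L * psi L b * ((-1) ^ L * (psi L (mode_swap L a) * ?C))"
      using flip[of a] ab by (simp add: mult.assoc)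
    also have "\<dots> = psi L b * psi L (mode_swap L a) * ?C"
      unfolding sq by (simp add: mult.assoc)
    also have "psi L b * psi L (mode_swap L a) = (if b = a then 1 else 0) - psi L (mode_swap L a) * psi L b"
      using psi_anticommute[of b L "mode_swap L a"] ab by (simp add: mode_swap_less)
    finally show ?thesis by (simp add: left_diff_distrib)
  qed
  then have "?C * hT = (\<Sum>a<2 * L. \<Sum>b<2 * L. sc (M $$ (a, b) / 2) *
      ((if a = b then ?C else 0) - psi L (mode_swap L a) * psi L b * ?C))"
    by (simp add: hT_def sum_distrib_left sc_left_commute[where X="?C"])
  also have "\<dots> = (\<Sum>a<2 * L. sc (M $$ (a, a) / 2)) * ?C - h * ?C"
    by (simp add: h_def right_diff_distrib sum_subtractf sum_distrib_right mult.assoc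
      if_distrib[of "\<lambda>x. _ * x"] cong: if_cong)
  also have "(\<Sum>a<2 * L. sc (M $$ (a, a) / 2)) = 0"
    by (simp only: sc_sum[symmetric] sum_divide_distrib[symmetric] trace_M) simp
  finally show ?thesis by simp
qed

text \<open>The particle-hole transformation turns \<open>-h\<close> into the transpose of \<open>h\<close>, and the filled state into
  the vacuum.\<close>

lemma filled_exp_uminus_H: "mat_exp (- H) $$ (filled L, filled L) = vev G"
proof -
  let ?F = "filled L"
  \<comment> \<open>The symmetry is proved for each power and then summed, so that only polynomials
    in \<open>h\<close> and \<open>hT\<close> are compared.\<close>
  have pow: "((- H) ^\<^sub>m n) $$ (?F, ?F) = (H ^\<^sub>m n) $$ (0, 0)" for n
  proof -
    have neg: "op_mat L ((- H) ^\<^sub>m n) = (- h) ^ n * proj L"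
      using h_proj by (intro op_mat_pow) (simp_all add: op_mat_uminus op_mat_H)
    have tr: "op_mat L (transpose_mat H ^\<^sub>m n) = hT ^ n * proj L"
      using hT_proj by (intro op_mat_pow) (simp_all add: op_mat_H_transpose)
    have fill: "app (fill L) vac = app (proj L) (app (fill L) vac)"
      unfolding fill_vac using filled_less[of L] by (auto simp: app_proj)
    have comm: "flip_modes L * hT ^ k = (- h) ^ k * flip_modes L" for k
    proof (induction k)
      case (Suc k)
      have "flip_modes L * hT ^ Suc k = flip_modes L * hT * hT ^ k"
        by (simp add: mult.assoc)
      also have "\<dots> = - h * (flip_modes L * hT ^ k)"
        by (simp only: flip_hT mult.assoc)
      finally show ?case by (simp only: Suc.IH power_Suc mult.assoc)
    qed simp
    have "((- H) ^\<^sub>m n) $$ (?F, ?F) = app (op_mat L ((- H) ^\<^sub>m n)) (app (fill L) vac) ?F"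
      unfolding fill_vac by (subst app_op_mat_unit) (simp_all add: filled_less)
    also have "\<dots> = app ((- h) ^ n) (app (fill L) vac) ?F"
      unfolding neg by (simp only: app_simps(6) fill[symmetric])
    also have "\<dots> = app ((- h) ^ n * flip_modes L) vac ?F"
      by (simp only: app_simps(6) flip_modes_vac)
    also have "\<dots> = app (flip_modes L) (app (hT ^ n) vac) ?F"
      by (simp only: comm[symmetric] app_simps(6))
    also have "\<dots> = app (hT ^ n) vac 0"
      by (subst app_flip_modes) (simp_all add: bit_filled push_drop_filled)
    also have "\<dots> = app (hT ^ n * proj L) vac 0"
      by (simp only: app_simps(6) app_proj_vac)
    also have "\<dots> = (transpose_mat H ^\<^sub>m n) $$ (0, 0)"
      unfolding tr[symmetric] by (simp only: vev_def[symmetric] vev_op_mat)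
    also have "\<dots> = (H ^\<^sub>m n) $$ (0, 0)"
      by (rule pow_transpose_entry[OF H_carrier]) auto
    finally show ?thesis .
  qed
  have "(\<lambda>n. ((- H) ^\<^sub>m n) $$ (?F, ?F) / fact n) sums (mat_exp (- H) $$ (?F, ?F))"
    by (rule mat_exp_sums[of _ "2 ^ L"]) (simp_all add: filled_less)
  moreover have "(\<lambda>n. (H ^\<^sub>m n) $$ (0, 0) / fact n) sums (mat_exp H $$ (0, 0))"
    by (rule mat_exp_sums[OF H_carrier]) simp_all
  ultimately have "mat_exp (- H) $$ (?F, ?F) = mat_exp H $$ (0, 0)"
    unfolding pow by (rule sums_unique2)
  then show ?thesis
    by (simp only: G_def gaussian_op_H vev_op_mat)
qed

lemma vev_G_square: "(vev G)\<^sup>2 = det (T22 L M)"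
proof -
  let ?F = "filled L"
  define lower where "lower i = (\<Sum>j<L. sc (T21 L M $$ (i, j)) * cc j)" for i
  define raise where "raise i = (\<Sum>j<L. sc (T22 L M $$ (i, j)) * cd j)" for i
  let ?up = "prod_list (map (\<lambda>i. lower i + raise i) [0..<L])"
  have "fill L * G = G * ?up"
    unfolding fill_def
  proof (rule prod_list_intertwine)
    fix i assume "i \<in> set [0..<L]"
    then show "cd i * G = G * (lower i + raise i)"
      by (simp add: cd_G lower_def raise_def distrib_left sum_distrib_left sc_left_commute[where X=G])
  qed
  \<comment> \<open>The exponential of \<open>- H\<close> inverts \<open>G\<close>, with the
    projection as the identity on \<open>L\<close> modes.\<close>
  moreover have "op_mat L (mat_exp (- H)) * G = proj L"
    unfolding G_def gaussian_op_H
    by (simp add: op_mat_times[symmetric] mat_exp_uminus[OF H_carrier] op_mat_one)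
  ultimately have "op_mat L (mat_exp (- H)) * (fill L * G) = proj L * ?up"
    by (simp only: mult.assoc[symmetric])
  then have "app (op_mat L (mat_exp (- H)) * (fill L * G)) vac ?F = app (proj L * ?up) vac ?F"
    by (simp only:)
  also have "app (proj L * ?up) vac ?F = app ?up vac ?F"
    by (simp only: app_simps(6)) (simp add: app_proj filled_less)
  also have "app (op_mat L (mat_exp (- H)) * (fill L * G)) vac ?F =
      app (op_mat L (mat_exp (- H))) (\<lambda>r. if r = ?F then vev G else 0) ?F"
  proof -
    have out: "app G vac r = 0" if "\<not> r < 2 ^ L" for r
      using that by (simp add: G_def app_op_mat)
    have "app (fill L) (app G vac) = (\<lambda>r. if r = ?F then vev G else 0)"
      unfolding vev_def by (rule app_fill_proj) (rule out)
    then show ?thesis by (simp only: app_simps(6))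
  qed
  also have "\<dots> = (vev G)\<^sup>2"
    by (subst app_op_mat_unit) (simp_all add: filled_less filled_exp_uminus_H power2_eq_square)
  finally have 1: "(vev G)\<^sup>2 = app ?up vac ?F" .
  have "low L (\<lambda>r. app ?up vac r - app (prod_list (map raise [0..<L])) vac r)"
    using low_difference[where xs="[0..<L]" and L=L and a="\<lambda>i j. T21 L M $$ (i, j)"
      and b="\<lambda>i j. T22 L M $$ (i, j)", THEN conjunct2]
    unfolding lower_def raise_def length_upt diff_zero .
  \<comment> \<open>The filled state has exactly \<open>L\<close> particles, so a vector in
    \<open>low L\<close> has no component there.\<close>
  then have "app ?up vac ?F = app (prod_list (map raise [0..<L])) vac ?F"
    unfolding low_def by (metis eq_iff_diff_eq_0 less_irrefl particles_filled)
  also have "prod_list (map raise [0..<L]) = sc (det (T22 L M)) * fill L"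
    unfolding raise_def fill_def
    by (rule prod_list_det[OF T_blocks(3)]) (rule anticomm_cd, rule anticomm_self)
  also have "app (sc (det (T22 L M)) * fill L) vac ?F = det (T22 L M)"
    by (simp add: fill_vac)
  finally show ?thesis unfolding 1 .
qed

end

subsection \<open>The Pfaffian formula\<close>

lemma up_sites_sorted: "up_sites L S = sorted_list_of_set {i. i < L \<and> S i}"
proof -
  have "sorted (up_sites L S)" "distinct (up_sites L S)" "set (up_sites L S) = {i. i < L \<and> S i}"
    by (auto simp: up_sites_def sorted_wrt_filter)
  then show ?thesis
    by (metis sorted_list_of_set.idem_if_sorted_distinct)
qed

context gaussian_inv
begin

lemma matrix_element_pfaffian:
  assumes "Sigma_pair L c e = (\<Sigma>, \<Sigma>')" "c ^ L * prod e {0..<2 * L} = 1"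
  shows "matrix_element L S (gaussian_op L M) S' = vev G * pfaffian (Kz L \<Sigma> \<Sigma>' M S S')"
proof -
  have "gaussian_op L M \<in> carrier_mat (2 ^ L) (2 ^ L)"
    by (simp add: gaussian_op_H)
  then have "matrix_element L S (gaussian_op L M) S' =
      vev (left_set {j. j < L \<and> S j} * G * right_set {i. i < L \<and> S' i})"
    by (simp only: matrix_element_as_vev up_sites_sorted left_set_def right_set_def G_def)
  also have "\<dots> = (-1) ^ (card {i. i < L \<and> S' i} div 2) * vev G *
      pf_set (\<lambda>m n. A_mat L M $$ (m, n)) ({j. j < L \<and> S j} \<union> (+) L ` {i. i < L \<and> S' i})"
    by (rule wick[where X="\<lambda>i j. X_mat L M $$ (i, j)" and V="\<lambda>i j. R $$ (j, i)" and R="\<lambda>i j. R $$ (i, j)"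
      and Z="\<lambda>i j. Z_mat L M $$ (i, j)"]) (simp_all add: cc_G G_cd A_mat_entry, auto)
  finally show ?thesis
    by (simp add: pfaffian_Kz[OF assms])
qed

end

section \<open>Evaluating the factorized form in the vacuum\<close>

lemma mat_exp_eigenvector:
  assumes A: "A \<in> carrier_mat (2 ^ L) (2 ^ L)" and v: "app (op_mat L A) v = (\<lambda>i. c * v i)"
    and "app (proj L) v = v"
  shows "app (op_mat L (mat_exp A)) v = (\<lambda>i. exp c * v i)"
proof
  fix r
  have out: "v i = 0" if "\<not> i < 2 ^ L" for i
    using fun_cong[OF assms(3), of i] that by (simp add: app_proj)
  show "app (op_mat L (mat_exp A)) v r = exp c * v r"
  proof (cases "r < 2 ^ L")
    case r: True
    have pow: "app (op_mat L (A ^\<^sub>m n)) v = (\<lambda>i. c ^ n * v i)" for n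
    proof (induction n)
      case 0
      then show ?case using A assms(3) by (simp add: op_mat_one)
    next
      case (Suc n)
      have "app (op_mat L (A ^\<^sub>m Suc n)) v = app (op_mat L A) (app (op_mat L (A ^\<^sub>m n)) v)"
        unfolding pow_mat_Suc_left[OF A] using A by (simp only: op_mat_times pow_carrier app_simps(6))
      also have "\<dots> = (\<lambda>i. c ^ n * app (op_mat L A) v i)"
        unfolding Suc.IH by (rule ext) (rule app_scale_vec)
      finally show ?case by (simp add: v mult_ac)
    qed
    have "(\<lambda>n. \<Sum>s<2 ^ L. (A ^\<^sub>m n) $$ (r, s) / fact n * v s) sums (\<Sum>s<2 ^ L. mat_exp A $$ (r, s) * v s)"
      using A r by (intro sums_sum sums_mult2 mat_exp_sums) auto
    moreover have "(\<Sum>s<2 ^ L. (A ^\<^sub>m n) $$ (r, s) / fact n * v s) = c ^ n /\<^sub>R fact n * v r" for n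
    proof -
      have "(\<Sum>s<2 ^ L. (A ^\<^sub>m n) $$ (r, s) / fact n * v s) = app (op_mat L (A ^\<^sub>m n)) v r / fact n"
        using r by (simp add: app_op_mat sum_divide_distrib)
      then show ?thesis unfolding pow by (simp add: scaleR_conv_of_real divide_simps)
    qed
    moreover have "(\<lambda>n. c ^ n /\<^sub>R fact n * v r) sums (exp c * v r)"
      by (intro sums_mult2 exp_converges)
    ultimately show ?thesis
      using r by (simp add: app_op_mat sums_unique2)
  qed (simp add: app_op_mat out)
qed

lemma bilinear_op_carrier: "bilinear_op L n u W v \<in> carrier_mat (2 ^ L) (2 ^ L)"
  by (simp add: bilinear_op_def)

context gaussian_inv
begin

text \<open>The factor with \<open>Z\<close> fixes the vacuum, the middle factor multiplies it by a
  scalar, and the factor with \<open>X\<close> has the left vacuum as a fixed row. Thus every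
  admissible \<open>Y\<close> gives the same number.\<close>

lemma factorizes_vev:
  assumes "factorizes L M Y"
  shows "vev G = exp (- mat_trace Y / 2)"
proof -
  define N1 where "N1 = (1 / 2) \<cdot>\<^sub>m bilinear_op L L (create L) (X_mat L M) (create L)"
  define N2 where "N2 = bilinear_op L L (create L) Y (annihilate L) - (mat_trace Y / 2) \<cdot>\<^sub>m 1\<^sub>m (2 ^ L)"
  define N3 where "N3 = (1 / 2) \<cdot>\<^sub>m bilinear_op L L (annihilate L) (Z_mat L M) (annihilate L)"
  have carrier: "N1 \<in> carrier_mat (2 ^ L) (2 ^ L)" "N2 \<in> carrier_mat (2 ^ L) (2 ^ L)"
    "N3 \<in> carrier_mat (2 ^ L) (2 ^ L)"
    unfolding N1_def N2_def N3_def by (intro minus_carrier_mat smult_carrier_mat bilinear_op_carrier one_carrier_mat)+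
  have G: "G = op_mat L (mat_exp N1) * op_mat L (mat_exp N2) * op_mat L (mat_exp N3)"
    using assms carrier by (simp add: G_def factorizes_def N1_def[symmetric] N2_def[symmetric] N3_def[symmetric]
      op_mat_times mult_carrier_mat[of _ _ "2 ^ L"])
  have "app (op_mat L N3) vac = (\<lambda>i. 0 * vac i)"
    unfolding N3_def
    by (rule ext) (simp add: op_mat_bilinear app_sum op_mat_annihilate app_zero_fun)
  from mat_exp_eigenvector[OF carrier(3) this app_proj_vac]
  have e3: "app (op_mat L (mat_exp N3)) vac = vac" by simp
  have "op_mat L N2 = (\<Sum>a<L. \<Sum>b<L. sc (Y $$ (a, b)) * (op_mat L (create L a) * op_mat L (annihilate L b)))
      - sc (mat_trace Y / 2) * proj L"
  proof -
    have "op_mat L N2 = op_mat L (1 \<cdot>\<^sub>m bilinear_op L L (create L) Y (annihilate L)) - sc (mat_trace Y / 2) * proj L"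
      by (rule fop_eqI) (simp add: N2_def app_op_mat app_proj bilinear_op_def left_diff_distrib sum_subtractf
        if_distrib[of "\<lambda>x. _ * x"] if_distrib[of "\<lambda>x. x * _"] cong: if_cong)
    then show ?thesis by (simp add: op_mat_bilinear)
  qed
  then have "app (op_mat L N2) vac = (\<lambda>i. - (mat_trace Y / 2) * vac i)"
    by (intro ext) (simp add: app_sum op_mat_annihilate app_zero_fun)
  from mat_exp_eigenvector[OF carrier(2) this app_proj_vac]
  have e2: "app (op_mat L (mat_exp N2)) vac = (\<lambda>i. exp (- (mat_trace Y / 2)) * vac i)" .
  \<comment> \<open>A creation operator never has the empty state as its image, so row 0 of
    \<open>N1\<close> is zero and all positive powers drop out of the vacuum entry.\<close>
  have row: "N1 $$ (0, s) = 0" if "s < 2 ^ L" for s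
  proof -
    have "(create L a * create L b) $$ (0, s) = 0" if "a < L" for a b
    proof -
      have "create L a $$ (0, k) = 0" if "k < 2 ^ L" for k
        using that by (auto simp: create_def annihilate_def)
      then show ?thesis
        using \<open>s < 2 ^ L\<close> by (subst mult_mat_entry[of _ "2 ^ L" "2 ^ L" _ "2 ^ L"]) auto
    qed
    then show ?thesis using that by (simp add: N1_def bilinear_op_def)
  qed
  have e1: "mat_exp N1 $$ (0, 0) = 1"
  proof -
    have "(N1 ^\<^sub>m Suc n) $$ (0, 0) = 0" for n
      unfolding pow_mat_Suc_left[OF carrier(1)] using carrier(1) row
      by (subst mult_mat_entry[of _ "2 ^ L" "2 ^ L" _ "2 ^ L"]) auto
    then have "(N1 ^\<^sub>m n) $$ (0, 0) / fact n = (if n = 0 then 1 else 0)" for n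
      using carrier(1) by (cases n) (auto simp del: pow_mat.simps(2))
    then have "(\<lambda>n. if n = 0 then 1 else 0) sums (mat_exp N1 $$ (0, 0))"
      using mat_exp_sums[OF carrier(1), of 0 0] by simp
    moreover have "(\<lambda>n. if n = 0 then 1 else 0) sums (1 :: complex)"
      by (rule sums_single)
    ultimately show ?thesis by (rule sums_unique2)
  qed
  have "app G vac = app (op_mat L (mat_exp N1)) (\<lambda>i. exp (- (mat_trace Y / 2)) * vac i)"
    unfolding G by (simp only: app_simps(6) e3 e2)
  then have "vev G = exp (- (mat_trace Y / 2)) * vev (op_mat L (mat_exp N1))"
    by (simp only: vev_def app_scale_vec)
  then show ?thesis by (simp add: vev_op_mat e1)
qed

end

theorem theorem2:
  fixes L :: nat
  assumes "1 \<le> L"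
  shows "\<exists>P :: (complex mat \<times> complex mat) set.
    card P = (if L = 1 then 1 else 2 ^ (2 * L - 1)) \<and>
    (\<forall>(\<Sigma>, \<Sigma>')\<in>P. sign_mat (2 * L) \<Sigma> \<and> sign_mat (2 * L) \<Sigma>') \<and>
    (\<forall>M. gaussian_generator L M \<and> invertible_mat (T22 L M) \<longrightarrow>
      (\<exists>d. is_sqrt_det_T22 L M d \<and>
        (\<forall>(\<Sigma>, \<Sigma>')\<in>P. \<forall>S S'.
          matrix_element L S (gaussian_op L M) S' = d * pfaffian (Kz L \<Sigma> \<Sigma>' M S S'))))"
proof (intro exI conjI allI impI)
  have pair: "\<exists>c e. Sigma_pair L c e = (\<Sigma>, \<Sigma>') \<and> c \<in> {1, -1} \<and> (\<forall>m. e m \<in> {1, -1}) \<and>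
      c ^ L * prod e {0..<2 * L} = 1" if P: "(\<Sigma>, \<Sigma>') \<in> admissible_pairs L" for \<Sigma> \<Sigma>'
  proof -
    obtain c E where cE: "c \<in> {1, -1}" "E \<subseteq> {1..<2 * L - 1}"
      "(\<Sigma>, \<Sigma>') = Sigma_pair L c (gauge_signs L c E)"
      using P unfolding admissible_pairs_def by auto
    then show ?thesis
      using gauge_signs_pm[OF cE(1)] prod_gauge_signs[OF assms cE(1,2)] by metis
  qed
  show "card (admissible_pairs L) = (if L = 1 then 1 else 2 ^ (2 * L - 1))"
    by (rule card_admissible_pairs[OF assms])
  show "\<forall>(\<Sigma>, \<Sigma>')\<in>admissible_pairs L. sign_mat (2 * L) \<Sigma> \<and> sign_mat (2 * L) \<Sigma>'"
    using pair sign_mat_Sigma_pair by blast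
  fix M assume "gaussian_generator L M \<and> invertible_mat (T22 L M)"
  then interpret gaussian_inv L M by unfold_locales auto
  \<comment> \<open>The witness \<open>vev G\<close> depends on \<open>M\<close> alone, so one sign
    of the root serves all pairs and configurations.\<close>
  show "is_sqrt_det_T22 L M (vev G)"
    by (simp add: is_sqrt_det_T22_def vev_G_square factorizes_vev)
  show "\<forall>(\<Sigma>, \<Sigma>')\<in>admissible_pairs L. \<forall>S S'.
      matrix_element L S (gaussian_op L M) S' = vev G * pfaffian (Kz L \<Sigma> \<Sigma>' M S S')"
    using pair matrix_element_pfaffian by blast
qed

end
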